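(* Let $V=\bigoplus_{s\geq 0}V^s$, with $V^s=\bigoplus_{N'_s\leq n\leq N_s}V^s_n$ for integers $N'_s\le N_s$ depending on $s$, be a bigraded vector space, with conformal degree $s$ and fermionic degree $n$. Suppose given linear maps, all of conformal degree zero, $$m_1\colon V\to V,\qquad m_2,\ m_{1,1}\colon V\otimes V\to V$$ of fermionic degrees $1$, $0$ and $-1$ respectively, whose duals define a $G_2$ structure on $V$, and a linear map $h\colon V\to V$ of fermionic degree $-1$ and conformal degree zero with $h^2=0$, such that for every $s\ge 0$ and every element $v\in V^s$ $$m_1hv+hm_1v=sv .$$ Then any extension of the (restricted) $G_2$ structure to a $G_\infty$ structure on $V^0$ has an extension to a $G_\infty$ structure on $V$. That is: for every $G_\infty$ structure on $V^0$ whose first two components are the restrictions to $V^0$ of the given $G_2$ structure, there is a $G_\infty$ structure on $V$ whose first two components are the given $G_2$ structure and whose restriction to $V^0$ is the given $G_\infty$ structure on $V^0$.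
   Context: All vector spaces are over a field of characteristic zero. "Degree" without qualification means fermionic degree; only the fermionic degree contributes to Koszul signs. All linear maps considered (including the components of $G_r$ and $G_\infty$ structures) have degree zero with respect to the conformal degree. For a graded space $W$, $W[k]$ is defined by $(W[k])_n=W_{n+k}$. For a graded vector space $A$ let $\mathsf{Lie}(A)=\bigoplus_{p\ge1}L^pA$ be the free graded Lie algebra on $A$, with $L^pA$ spanned by the $(p-1)$-fold commutators of elements of $A$ (so $L^1A=A$). Let $GA=\bigoplus_t\bigwedge^t\mathsf{Lie}(A)[-t]$ be the free graded commutative algebra on $\mathsf{Lie}(A)[-1]$, with product $\wedge$. The Lie bracket extends to a degree $-1$ bilinear operation $[\,,]$ on $GA$ which is a derivation with respect to $\wedge$. Let $G_mA=\bigoplus_{p_1+\cdots+p_t=m}L^{p_1}A\wedge\cdots\wedge L^{p_t}A\,[-t]$; thus $G_1A=A[-1]$ and $G_2A=[A,A][-1]\oplus (A\wedge A)[-2]$. A degree 1 linear map $\gamma_1^{m+1}\colon G_1A\to G_{m+1}A$ extends uniquely to a degree 1 derivation of $GA$ with respect to both $\wedge$ and $[\,,]$ (for the bracket, $f[a,b]=[fa,b]+(-1)^{|f|(|a|-1)}[a,fb]$ with $|a|$ the degree in $GA$); its components are denoted $\gamma_i^{m+i}\colon G_iA\to G_{m+i}A$. Put $A=V[1]^*$, so $A_n=(V_{1-n})^*$. For finite $r\ge1$, a $G_r$ structure on $V$ is a sequence of degree 1 linear maps $\gamma_1^k\colon G_1A\to G_kA$, $1\le k\le r$, which together with their extensions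 $\gamma_i^j$ satisfy $$\mathsf R_1^k:\qquad \sum_{j=1}^k\gamma_j^k\gamma_1^j=0\colon G_1A\to G_kA$$ for $1\le k\le r$. A $G_\infty$ structure on $V$ is a family $(\gamma_1^k)_{k\ge1}$ of degree 1 maps satisfying $\mathsf R_1^k$ for all $k\ge1$ (equivalently, a square zero degree one derivation with respect to both $\wedge$ and $[\,,]$). The $G_2$ structure defined by $m_1,m_2,m_{1,1}$ has $\gamma_1^1$ dual to $m_1$, while $\gamma_1^2\colon G_1A\to [A,A][-1]\oplus (A\wedge A)[-2]$ has first component dual to $m_2$ and second component dual to $m_{1,1}$. The conformal grading is extended to $GA$ by $\|v\wedge w\|=\|[v,w]\|=\|v\|+\|w\|$. The formulation with linear duals implicitly assumes finite dimensionality. When $V$ is not finite dimensional, all notions are understood in the dual form: derivations on free algebras on $V[1]^*$ are replaced by coderivations on the corresponding cofree coalgebras on $V[1]$ (the cofree Lie coalgebra $\mathsf{Lie}^c(V[1])$ and the cofree cocommutative coalgebra $\bigoplus_t\bigwedge^t\mathsf{Lie}^c(V[1])[t]$), so that $\gamma_1^k$ is replaced by a degree 1 map from the length-$k$ part of this coalgebra to its length-1 part $V[2]$, and the relations $\mathsf R_1^k$ by their duals. *)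

theory Defs
  imports Complex_Main "HOL-Library.Poly_Mapping" "HOL-Library.Extended_Nat"
begin

section \<open>Bigraded vector spaces\<close>

text \<open>
  A bigraded vector space is given by its homogeneous components \<open>E s n\<close> (conformal degree \<open>s\<close>,
  fermionic degree \<open>n\<close>) inside the vector space formed by a whole type.
\<close>

definition bigraded_vector_space ::
  "('k::field \<Rightarrow> 'v::ab_group_add \<Rightarrow> 'v) \<Rightarrow> (nat \<Rightarrow> int \<Rightarrow> 'v set) \<Rightarrow> bool" where
  "bigraded_vector_space scale E \<longleftrightarrow>
     vector_space scale \<and> (\<forall>s n. module.subspace scale (E s n)) \<and>
     (\<forall>v. \<exists>!f :: nat \<times> int \<Rightarrow> 'v. (\<forall>s n. f (s, n) \<in> E s n) \<and>
            finite {p. f p \<noteq> 0} \<and> v = (\<Sum>p\<in>{p. f p \<noteq> 0}. f p))"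

definition conformal_part ::
  "('k::field \<Rightarrow> 'v::ab_group_add \<Rightarrow> 'v) \<Rightarrow> (nat \<Rightarrow> int \<Rightarrow> 'v set) \<Rightarrow> nat \<Rightarrow> 'v set" where
  "conformal_part scale E s = module.span scale (\<Union>n. E s n)"

text \<open>\<open>V\<^sup>0\<close> as a bigraded space concentrated in conformal degree 0.\<close>

definition conformal_zero ::
  "(nat \<Rightarrow> int \<Rightarrow> 'v::zero set) \<Rightarrow> nat \<Rightarrow> int \<Rightarrow> 'v set" where
  "conformal_zero E s n = (if s = 0 then E 0 n else {0})"

section \<open>Formal linear combinations\<close>

definition cscale :: "'k::field \<Rightarrow> ('a \<Rightarrow>\<^sub>0 'k) \<Rightarrow> ('a \<Rightarrow>\<^sub>0 'k)" where
  "cscale c x = Poly_Mapping.map ((*) c) x"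

lemma lookup_cscale: "Poly_Mapping.lookup (cscale c x) w = c * Poly_Mapping.lookup x w"
  by (simp add: cscale_def Poly_Mapping.map.rep_eq when_def)

global_interpretation chain: vector_space "cscale :: 'k::field \<Rightarrow> ('a \<Rightarrow>\<^sub>0 'k) \<Rightarrow> ('a \<Rightarrow>\<^sub>0 'k)"
  by unfold_locales
    (simp_all add: poly_mapping_eq_iff fun_eq_iff lookup_cscale lookup_add algebra_simps)

abbreviation basis :: "'a \<Rightarrow> ('a \<Rightarrow>\<^sub>0 'k::field)" where
  "basis w \<equiv> Poly_Mapping.single w 1"

definition lin_ext ::
  "('k::field \<Rightarrow> 'u::ab_group_add \<Rightarrow> 'u) \<Rightarrow> ('a \<Rightarrow> 'u) \<Rightarrow> ('a \<Rightarrow>\<^sub>0 'k) \<Rightarrow> 'u" where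
  "lin_ext scale f x = (\<Sum>w\<in>Poly_Mapping.keys x. scale (Poly_Mapping.lookup x w) (f w))"

definition chain_tensor :: "('a \<Rightarrow>\<^sub>0 'k::field) \<Rightarrow> ('b \<Rightarrow>\<^sub>0 'k) \<Rightarrow> ('a \<times> 'b \<Rightarrow>\<^sub>0 'k)" where
  "chain_tensor x y = lin_ext cscale (\<lambda>a. lin_ext cscale (\<lambda>b. basis (a, b)) y) x"

definition sign :: "int \<Rightarrow> 'k::field" where
  "sign e = (if even e then 1 else - 1)"

text \<open>
  Koszul sign of the permutation that sorts \<open>t\<close> elements of degrees \<open>d 0, \<dots>, d (t - 1)\<close> stably by
  their class \<open>c i\<close>: every inverted pair \<open>i < j\<close> contributes \<open>(-1)\<close> to the power \<open>d i * d j\<close>.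
\<close>

definition koszul_sign :: "nat \<Rightarrow> (nat \<Rightarrow> int) \<Rightarrow> (nat \<Rightarrow> nat) \<Rightarrow> 'k::field" where
  "koszul_sign t d c = (\<Prod>(i, j)\<in>{(i, j). i < j \<and> j < t \<and> c j < c i}. sign (d i * d j))"

section \<open>Block words\<close>

text \<open>
  A letter \<open>(s, n, v)\<close> is a vector \<open>v\<close> of \<open>E s n\<close> together with its bidegree.  A word
  \<open>[v\<^sub>1, \<dots>, v\<^sub>p]\<close> stands for the class of \<open>v\<^sub>1 \<otimes> \<cdots> \<otimes> v\<^sub>p\<close> in the cofree Lie coalgebra
  \<open>Lie\<^sup>c(V[1])\<close>, and a block word \<open>[w\<^sub>1, \<dots>, w\<^sub>t]\<close> for \<open>w\<^sub>1 \<and> \<cdots> \<and> w\<^sub>t\<close> in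
  \<open>\<Oplus>\<^sub>t \<And>\<^sup>t Lie\<^sup>c(V[1])[t]\<close>.
\<close>

type_synonym 'v letter = "nat \<times> int \<times> 'v"
type_synonym 'v lword = "'v letter list"
type_synonym 'v bword = "'v lword list"

definition letters :: "(nat \<Rightarrow> int \<Rightarrow> 'v set) \<Rightarrow> 'v letter set" where
  "letters E = {(s, n, v). v \<in> E s n}"

definition bwords :: "(nat \<Rightarrow> int \<Rightarrow> 'v set) \<Rightarrow> 'v bword set" where
  "bwords E = {X. X \<noteq> [] \<and> [] \<notin> set X \<and> set (concat X) \<subseteq> letters E}"

definition blen :: "'v bword \<Rightarrow> nat" where
  "blen X = length (concat X)"

definition cdeg :: "'v bword \<Rightarrow> nat" where
  "cdeg X = sum_list (map fst (concat X))"

text \<open>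
  Degree in \<open>Lie\<^sup>c(V[1])\<close>; a block has one less in \<open>Lie\<^sup>c(V[1])[1]\<close>, since \<open>W[k]\<^sub>n = W\<^bsub>n+k\<^esub>\<close>.
\<close>

definition lie_deg :: "'v lword \<Rightarrow> int" where
  "lie_deg w = (\<Sum>(s, n, v)\<leftarrow>w. n - 1)"

definition gdeg :: "'v bword \<Rightarrow> int" where
  "gdeg X = (\<Sum>w\<leftarrow>X. lie_deg w - 1)"

section \<open>The cofree coalgebra\<close>

fun shuffle :: "'v lword \<Rightarrow> 'v lword \<Rightarrow> ('v lword \<Rightarrow>\<^sub>0 'k::field)" where
  "shuffle [] w = basis w"
| "shuffle u [] = basis u"
| "shuffle (a # u) (b # w) =
     lin_ext cscale (\<lambda>x. basis (a # x)) (shuffle u (b # w)) +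
     cscale (sign (lie_deg (a # u) * lie_deg [b]))
       (lin_ext cscale (\<lambda>x. basis (b # x)) (shuffle (a # u) w))"

text \<open>
  The coalgebra is presented as the space \<open>chains E\<close> of linear combinations of block words modulo
  \<open>relations scale E\<close>: multilinearity, the vanishing of shuffles of nonempty words (in characteristic
  zero \<open>Lie\<^sup>c(W)\<close> is the tensor coalgebra \<open>T\<^sup>c(W)\<close> modulo shuffles, with the commutator of
  deconcatenation as cobracket), and graded commutativity of \<open>\<and>\<close>.  Linear maps out of the coalgebra
  are the linear maps on \<open>chains E\<close> respecting \<open>relations scale E\<close>.
\<close>

inductive_set coalgebra_rel ::
  "('k::field \<Rightarrow> 'v::ab_group_add \<Rightarrow> 'v) \<Rightarrow> (nat \<Rightarrow> int \<Rightarrow> 'v set) \<Rightarrow> ('v bword \<Rightarrow>\<^sub>0 'k) set"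
  for scale E where
  additive:
    "\<lbrakk>X @ [p @ [(s, n, a)] @ q] @ Y \<in> bwords E; X @ [p @ [(s, n, b)] @ q] @ Y \<in> bwords E\<rbrakk> \<Longrightarrow>
       basis (X @ [p @ [(s, n, a + b)] @ q] @ Y)
         - basis (X @ [p @ [(s, n, a)] @ q] @ Y) - basis (X @ [p @ [(s, n, b)] @ q] @ Y)
       \<in> coalgebra_rel scale E"
| homogeneous:
    "X @ [p @ [(s, n, a)] @ q] @ Y \<in> bwords E \<Longrightarrow>
       basis (X @ [p @ [(s, n, scale c a)] @ q] @ Y)
         - cscale c (basis (X @ [p @ [(s, n, a)] @ q] @ Y))
       \<in> coalgebra_rel scale E"
| shuffle:
    "X @ [u, w] @ Y \<in> bwords E \<Longrightarrow>
       lin_ext cscale (\<lambda>x. basis (X @ [x] @ Y)) (shuffle u w) \<in> coalgebra_rel scale E"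
| commute:
    "X @ [u, w] @ Y \<in> bwords E \<Longrightarrow>
       basis (X @ [u, w] @ Y) - cscale (sign (gdeg [u] * gdeg [w])) (basis (X @ [w, u] @ Y))
       \<in> coalgebra_rel scale E"

definition chains :: "(nat \<Rightarrow> int \<Rightarrow> 'v set) \<Rightarrow> ('v bword \<Rightarrow>\<^sub>0 'k::field) set" where
  "chains E = {x. Poly_Mapping.keys x \<subseteq> bwords E}"

definition relations ::
  "('k::field \<Rightarrow> 'v::ab_group_add \<Rightarrow> 'v) \<Rightarrow> (nat \<Rightarrow> int \<Rightarrow> 'v set) \<Rightarrow> ('v bword \<Rightarrow>\<^sub>0 'k) set" where
  "relations scale E = chain.span (coalgebra_rel scale E)"

definition relations2 ::
  "('k::field \<Rightarrow> 'v::ab_group_add \<Rightarrow> 'v) \<Rightarrow> (nat \<Rightarrow> int \<Rightarrow> 'v set) \<Rightarrow>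
     ('v bword \<times> 'v bword \<Rightarrow>\<^sub>0 'k) set" where
  "relations2 scale E = chain.span
     ({chain_tensor x y | x y. x \<in> relations scale E \<and> y \<in> chains E} \<union>
      {chain_tensor x y | x y. x \<in> chains E \<and> y \<in> relations scale E})"

text \<open>
  The (reduced) coproduct dual to \<open>\<and>\<close>: the sum over \<open>I \<squnion> J = {0..<t}\<close> of \<open>\<plusminus> X\<^sub>I \<otimes> X\<^sub>J\<close>.
\<close>

definition coproduct :: "'v bword \<Rightarrow> ('v bword \<times> 'v bword \<Rightarrow>\<^sub>0 'k::field)" where
  "coproduct X =
     (\<Sum>I\<in>{I. I \<subseteq> {..<length X} \<and> I \<noteq> {} \<and> I \<noteq> {..<length X}}.
        cscale (koszul_sign (length X) (\<lambda>i. gdeg [X ! i]) (\<lambda>i. if i \<in> I then 0 else 1))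
          (basis (nths X I, nths X (- I))))"

text \<open>
  The cobracket dual to the bracket of the free Gerstenhaber algebra \<open>GA\<close>, \<open>A = V[1]\<^sup>*\<close>.  On one word it is the sum over \<open>w = u v\<close> of
  \<open>u \<otimes> v \<minusplus> v \<otimes> u\<close>.  The derivation rule of the bracket with respect to \<open>\<and>\<close> amounts to
  \<open>[X \<and> x, y \<and> Y] = X \<and> [x, y] \<and> Y + \<dots>\<close>, where the other terms come from moving, with Koszul sign,
  another factor next to the comma.  Dually one takes the sum over \<open>I \<squnion> {k} \<squnion> J = {0..<t}\<close> of
  \<open>\<plusminus> (X\<^sub>I \<and> u) \<otimes> (v \<and> X\<^sub>J)\<close>, with \<open>u \<otimes> v\<close> a term of the cobracket of the word \<open>X ! k\<close>.
\<close>

definition cobracket :: "'v bword \<Rightarrow> ('v bword \<times> 'v bword \<Rightarrow>\<^sub>0 'k::field)" where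
  "cobracket X =
     (\<Sum>k<length X. \<Sum>I\<in>Pow ({..<length X} - {k}).
        cscale (koszul_sign (length X) (\<lambda>i. gdeg [X ! i])
                  (\<lambda>i. if i \<in> I then 0 else if i = k then 1 else 2))
          (\<Sum>r\<in>{0<..<length (X ! k)}.
             let u = take r (X ! k); v = drop r (X ! k); XI = nths X I; XJ = nths X (- insert k I)
             in basis (XI @ [u], [v] @ XJ)
                - cscale (sign (lie_deg u * lie_deg v)) (basis (XI @ [v], [u] @ XJ))))"

section \<open>Coderivations and \<open>G\<^sub>r\<close> structures\<close>

text \<open>
  Degree 1 coderivations with respect to both operations.  In the rule for the cobracket the degree
  of the left factor is shifted by one, as in \<open>f[a,b] = [fa,b] + (-1)\<^bsup>|f|(|a|-1)\<^esup> [a,fb]\<close>.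
\<close>

definition coderivation ::
  "('k::field \<Rightarrow> 'v::ab_group_add \<Rightarrow> 'v) \<Rightarrow> (nat \<Rightarrow> int \<Rightarrow> 'v set) \<Rightarrow>
     ('v bword \<Rightarrow> ('v bword \<Rightarrow>\<^sub>0 'k)) \<Rightarrow> bool" where
  "coderivation scale E Q \<longleftrightarrow>
     (\<forall>X\<in>bwords E. Q X \<in> chains E \<and>
        (\<forall>Y\<in>Poly_Mapping.keys (Q X). gdeg Y = gdeg X + 1 \<and> cdeg Y = cdeg X)) \<and>
     (\<forall>x\<in>relations scale E. lin_ext cscale Q x \<in> relations scale E) \<and>
     (\<forall>X\<in>bwords E.
        lin_ext cscale coproduct (Q X)
        - lin_ext cscale (\<lambda>(Y, Z). chain_tensor (Q Y) (basis Z)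
            + cscale (sign (gdeg Y)) (chain_tensor (basis Y) (Q Z))) (coproduct X)
        \<in> relations2 scale E) \<and>
     (\<forall>X\<in>bwords E.
        lin_ext cscale cobracket (Q X)
        - lin_ext cscale (\<lambda>(Y, Z). chain_tensor (Q Y) (basis Z)
            + cscale (sign (gdeg Y + 1)) (chain_tensor (basis Y) (Q Z))) (cobracket X)
        \<in> relations2 scale E)"

fun proj1 :: "'v::zero bword \<Rightarrow> 'v" where
  "proj1 [[(s, n, v)]] = v"
| "proj1 _ = 0"

text \<open>
  \<open>G\<^sub>r\<close> structures are taken in the dual form, which needs no finite dimensionality: the maps
  \<open>\<gamma>\<^sub>1\<^sup>k\<close> out of the generators of \<open>GA\<close> become maps from length \<open>k\<close> to the length 1 part \<open>V[2]\<close> of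
  the cofree coalgebra on \<open>V\<close>, and derivations become coderivations.  The function
  \<open>\<gamma>\<close> collects the maps dual to \<open>\<gamma>\<^sub>1\<^sup>k\<close>, \<open>k \<le> r\<close>, into one function on block words; its values on
  words of length greater than \<open>r\<close> are ignored.  The shift by 3 is one for the degree of \<open>\<gamma>\<close> and
  two for \<open>V[2]\<close>.
\<close>

definition truncate :: "enat \<Rightarrow> ('v::zero bword \<Rightarrow> 'v) \<Rightarrow> 'v bword \<Rightarrow> 'v" where
  "truncate r \<gamma> X = (if enat (blen X) \<le> r then \<gamma> X else 0)"

definition cogenerator_map ::
  "('k::field \<Rightarrow> 'v::ab_group_add \<Rightarrow> 'v) \<Rightarrow> (nat \<Rightarrow> int \<Rightarrow> 'v set) \<Rightarrow> ('v bword \<Rightarrow> 'v) \<Rightarrow> bool" where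
  "cogenerator_map scale E \<gamma> \<longleftrightarrow>
     (\<forall>X\<in>bwords E. \<gamma> X \<in> E (cdeg X) (gdeg X + 3)) \<and>
     (\<forall>x\<in>relations scale E. lin_ext scale \<gamma> x = 0)"

text \<open>
  The relation dual to \<open>R\<^sub>1\<^sup>k: \<Sum>\<^sub>j \<gamma>\<^sub>j\<^sup>k \<gamma>\<^sub>1\<^sup>j = 0\<close>, for the coderivation \<open>Q\<close> extending \<open>\<gamma>\<close>: the component of \<open>Q X\<close> in
  length \<open>j\<close> is the dual of \<open>\<gamma>\<^sub>j\<^sup>k\<close> applied to \<open>X\<close>, and \<open>\<gamma>\<close> sums over all \<open>j\<close>.
\<close>

definition G_structure ::
  "('k::field \<Rightarrow> 'v::ab_group_add \<Rightarrow> 'v) \<Rightarrow> (nat \<Rightarrow> int \<Rightarrow> 'v set) \<Rightarrow> enat \<Rightarrow>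
     ('v bword \<Rightarrow> 'v) \<Rightarrow> bool" where
  "G_structure scale E r \<gamma> \<longleftrightarrow>
     cogenerator_map scale E (truncate r \<gamma>) \<and>
     (\<exists>Q. coderivation scale E Q \<and>
        (\<forall>X\<in>bwords E. lin_ext scale proj1 (Q X) = truncate r \<gamma> X) \<and>
        (\<forall>X\<in>bwords E. enat (blen X) \<le> r \<longrightarrow> lin_ext scale (truncate r \<gamma>) (Q X) = 0))"

abbreviation G_infinity_structure ::
  "('k::field \<Rightarrow> 'v::ab_group_add \<Rightarrow> 'v) \<Rightarrow> (nat \<Rightarrow> int \<Rightarrow> 'v set) \<Rightarrow> ('v bword \<Rightarrow> 'v) \<Rightarrow> bool" where
  "G_infinity_structure scale E \<gamma> \<equiv> G_structure scale E \<infinity> \<gamma>"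

text \<open>
  The components dual to \<open>\<gamma>\<^sub>1\<^sup>1\<close> and \<open>\<gamma>\<^sub>1\<^sup>2\<close> defined by \<open>m\<^sub>1\<close>, \<open>m\<^sub>2\<close>, \<open>m\<^sub>1\<^sub>,\<^sub>1\<close>.  The sign
  \<open>(-1)\<^bsup>|v|\<^esup>\<close> is the one coming from the shifts; with it, vanishing on shuffles and block symmetry
  say that \<open>m\<^sub>2\<close> is graded commutative and \<open>m\<^sub>1\<^sub>,\<^sub>1\<close> is graded antisymmetric for the degree shifted
  by one, and \<open>R\<^sub>1\<^sup>2\<close> says that \<open>m\<^sub>1\<close> is a derivation of both.
\<close>

fun binary_components ::
  "('k::field \<Rightarrow> 'v::ab_group_add \<Rightarrow> 'v) \<Rightarrow> ('v \<Rightarrow> 'v) \<Rightarrow> ('v \<Rightarrow> 'v \<Rightarrow> 'v) \<Rightarrow> ('v \<Rightarrow> 'v \<Rightarrow> 'v) \<Rightarrow>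
     'v bword \<Rightarrow> 'v" where
  "binary_components scale m1 m2 m11 [[(s, n, v)]] = m1 v"
| "binary_components scale m1 m2 m11 [[(s, n, v), (s', n', w)]] = scale (sign n) (m2 v w)"
| "binary_components scale m1 m2 m11 [[(s, n, v)], [(s', n', w)]] = scale (sign n) (m11 v w)"
| "binary_components scale m1 m2 m11 _ = 0"

end

theory Submission
  imports Defs "HOL-Library.Multiset"
begin

text \<open>
  A map \<open>\<gamma>\<close> to the cogenerators has an explicit coextension to a coderivation of the cofree coalgebra,
  and a coderivation is determined by its corestriction, since in characteristic zero an element killed
  by coproduct and cobracket is a cogenerator.  So a \<open>G\<^sub>\<infinity>\<close> structure is a \<open>\<gamma>\<close> whose coextension \<open>Q\<close>
  satisfies \<open>\<gamma> Q = 0\<close>.  Suppose that this holds in lengths below \<open>k\<close>, and let \<open>\<omega>\<close> be the length \<open>k\<close>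
  part of \<open>\<gamma> Q\<close> for \<open>\<gamma>\<close> truncated below \<open>k\<close>.  As \<open>Q\<^sup>2\<close> is again a coderivation, its length \<open>k\<close>
  part is \<open>\<omega>\<close>, and \<open>Q Q\<^sup>2 = Q\<^sup>2 Q\<close> gives \<open>m\<^sub>1 \<omega> = \<omega> Q\<^sub>1\<close>, where \<open>Q\<^sub>1\<close> is the linear part of \<open>Q\<close>.  In
  conformal degree \<open>s > 0\<close> the new component is \<open>\<gamma>\<^sub>k = - h \<omega> / s\<close>: it contributes
  \<open>m\<^sub>1 \<gamma>\<^sub>k + \<gamma>\<^sub>k Q\<^sub>1 = - (m\<^sub>1 h + h m\<^sub>1) \<omega> / s = - \<omega>\<close>.  In conformal degree 0 only words over \<open>V\<^sup>0\<close>
  occur, and \<open>\<gamma>\<^sub>k\<close> is the given one.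
\<close>

section \<open>Signs and degrees\<close>

text \<open>A \<open>G_structure\<close> only asserts that some \<open>Q\<close> exists, and only
  modulo \<open>relations\<close>. Uniqueness of coderivations is what ties a given structure to the
  explicit formula; \<open>G_structure_iff\<close> then eliminates \<open>Q\<close>. The obstacle is
  the quotient: the formula is written on representatives, and both its well-definedness and the two
  coderivation rules hold only modulo shuffles and graded commutativity. So everything is dualised.
  A chain is a relation exactly if it is killed by every functional that is graded symmetric in the
  blocks, multilinear and zero on shuffles. An operation on words is coded by what it does to such a
  functional, and each identity modulo relations becomes a scalar identity, proved by recursion on
  words with the Koszul signs normalised by the simplifier. Characteristic zero enters through three
  divisions: by the length of a word (Dynkin operator), by \<open>2 ^ t - 2\<close> for
  \<open>t\<close> blocks (coproduct), and by the conformal degree (homotopy).\<close>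

lemma sign_add: "sign (a + b) = (sign a * sign b :: 'k::field)"
  by (simp add: sign_def)

lemma sign_diff: "sign (a - b) = (sign a * sign b :: 'k::field)"
  by (simp add: sign_def)

lemma sign_uminus: "sign (- a) = (sign a :: 'k::field)"
  by (simp add: sign_def)

lemma sign_0: "sign 0 = (1 :: 'k::field)" and sign_1: "sign 1 = (- 1 :: 'k::field)"
  by (simp_all add: sign_def)

lemma sign_mult_self: "sign (a * a) = (sign a :: 'k::field)"
  by (simp add: sign_def)

lemma sign_square: "sign a * sign a = (1 :: 'k::field)"
  by (simp add: sign_def)

lemma sign_square_left: "sign a * (sign a * c) = (c :: 'k::field)"
  by (simp add: sign_def)

lemmas sign_simps = sign_add sign_diff sign_uminus sign_0 sign_1 sign_mult_self sign_square
  sign_square_left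

text \<open>Signs act on values in any abelian group, so that one definition of each operation
  serves scalars, vectors and chains.\<close>

definition signed :: "int \<Rightarrow> 'u::ab_group_add \<Rightarrow> 'u" where
  "signed e x = (if even e then x else - x)"

lemma signed_field [simp]: "signed e (x::'k::field) = sign e * x"
  by (simp add: signed_def sign_def)

definition additive_fun :: "('u::ab_group_add \<Rightarrow> 'w::ab_group_add) \<Rightarrow> bool" where
  "additive_fun f \<longleftrightarrow> (\<forall>x y. f (x + y) = f x + f y)"

lemma additive_funD: "additive_fun f \<Longrightarrow> f (x + y) = f x + f y"
  by (simp add: additive_fun_def)

lemma additive_fun_0: assumes "additive_fun f" shows "f 0 = 0"
  using additive_funD[OF assms, of 0 0] by simp

lemma additive_fun_minus: assumes "additive_fun f" shows "f (- x) = - f x"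
  using additive_funD[OF assms, of x "- x"] additive_fun_0[OF assms]
  by (simp add: eq_neg_iff_add_eq_0 add.commute)

lemma additive_fun_signed: "additive_fun f \<Longrightarrow> f (signed e x) = signed e (f x)"
  by (simp add: signed_def additive_fun_minus)

lemma signed_0 [simp]: "signed e 0 = 0"
  by (simp add: signed_def)

lemma signed_add: "signed e (x + y) = signed e x + signed e y"
  by (simp add: signed_def)

text \<open>An operation such as \<open>shuf u w\<close>, seen as an additive functional of its
  continuation. Additivity is all that the \<open>_swap\<close> lemmas need to exchange two signed
  sums; several bound variables are packed into one tuple.\<close>

definition additive_op :: "(('a \<Rightarrow> 'u::ab_group_add) \<Rightarrow> 'u) \<Rightarrow> bool" where
  "additive_op T \<longleftrightarrow> (\<forall>F G. T (\<lambda>x. F x + G x) = T F + T G)"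

lemma additive_opD: "additive_op T \<Longrightarrow> T (\<lambda>x. F x + G x) = T F + T G"
  by (simp add: additive_op_def)

lemma additive_op_0: assumes "additive_op T" shows "T (\<lambda>x. 0) = 0"
  using additive_opD[OF assms, of "\<lambda>x. 0" "\<lambda>x. 0"] by simp

lemma additive_op_signed: assumes "additive_op T" shows "T (\<lambda>x. signed e (F x)) = signed e (T F)"
proof -
  have "T F + T (\<lambda>x. - F x) = 0"
    using additive_opD[OF assms, of F "\<lambda>x. - F x"] additive_op_0[OF assms] by simp
  then have "T (\<lambda>x. - F x) = - T F"
    by (simp add: eq_neg_iff_add_eq_0 add.commute)
  then show ?thesis
    by (simp add: signed_def)
qed

definition letter_deg :: "'v letter \<Rightarrow> int" where
  "letter_deg a = fst (snd a) - 1"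

lemma letter_deg_simp [simp]: "letter_deg (s, n, v) = n - 1"
  by (simp add: letter_deg_def)

lemma lie_deg_Nil [simp]: "lie_deg [] = 0"
  by (simp add: lie_deg_def)

lemma lie_deg_Cons [simp]: "lie_deg (a # w) = letter_deg a + lie_deg w"
  by (simp add: lie_deg_def letter_deg_def split_beta)

lemma lie_deg_append [simp]: "lie_deg (u @ w) = lie_deg u + lie_deg w"
  by (induction u) simp_all

lemma gdeg_Nil [simp]: "gdeg [] = 0"
  by (simp add: gdeg_def)

lemma gdeg_Cons [simp]: "gdeg (w # X) = lie_deg w - 1 + gdeg X"
  by (simp add: gdeg_def)

lemma gdeg_append [simp]: "gdeg (X @ Y) = gdeg X + gdeg Y"
  by (induction X) simp_all

section \<open>Operations on words and block words\<close>

text \<open>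
  The operations are represented by their action on functions: \<open>shuf u w F\<close> is the value on the
  signed shuffle of \<open>u\<close> and \<open>w\<close> of the linear extension of \<open>F\<close>, \<open>dec\<close> belongs to deconcatenation,
  \<open>split_blocks\<close> to the coproduct of the cofree cocommutative coalgebra, and \<open>pick\<close> moves one block
  to the front.  In \<open>slices\<close> every block is cut as \<open>a b c\<close> with \<open>b\<close> nonempty; the pieces \<open>a\<close> are
  shuffled to \<open>x\<close>, the pieces \<open>c\<close> to \<open>z\<close>, and the pieces \<open>b\<close> form the block word \<open>Y\<close>.
\<close>

fun shuf :: "'v lword \<Rightarrow> 'v lword \<Rightarrow> ('v lword \<Rightarrow> 'u::ab_group_add) \<Rightarrow> 'u" where
  "shuf [] w F = F w"
| "shuf (a # u) [] F = F (a # u)"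
| "shuf (a # u) (b # w) F =
     shuf u (b # w) (\<lambda>x. F (a # x)) +
     signed ((letter_deg a + lie_deg u) * letter_deg b) (shuf (a # u) w (\<lambda>x. F (b # x)))"

text \<open>Unlike \<open>shuf.induct\<close>, this rule does not mention the continuation, which
  changes in the recursive calls and can thus be generalised freely.\<close>

lemma shuf_induct [case_names Nil Nil2 Cons]:
  assumes "\<And>w. P [] w" "\<And>a u. P (a # u) []"
    "\<And>a u b w. P u (b # w) \<Longrightarrow> P (a # u) w \<Longrightarrow> P (a # u) (b # w)"
  shows "P u w"
  using assms by induction_schema (pat_completeness, lexicographic_order)

lemma shuf_Nil2 [simp]: "shuf u [] F = F u"
  by (cases u) simp_all

fun dec :: "'v lword \<Rightarrow> ('v lword \<Rightarrow> 'v lword \<Rightarrow> 'u::ab_group_add) \<Rightarrow> 'u" where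
  "dec [] F = F [] []"
| "dec (a # w) F = F [] (a # w) + dec w (\<lambda>x y. F (a # x) y)"

fun split_blocks :: "'v bword \<Rightarrow> ('v bword \<Rightarrow> 'v bword \<Rightarrow> 'u::ab_group_add) \<Rightarrow> 'u" where
  "split_blocks [] F = F [] []"
| "split_blocks (w # X) F = split_blocks X (\<lambda>I J. F (w # I) J) +
     split_blocks X (\<lambda>I J. signed ((lie_deg w - 1) * gdeg I) (F I (w # J)))"

fun pick :: "'v bword \<Rightarrow> ('v lword \<Rightarrow> 'v bword \<Rightarrow> 'u::ab_group_add) \<Rightarrow> 'u" where
  "pick [] F = 0"
| "pick (w # X) F = F w X +
     pick X (\<lambda>u Y. signed ((lie_deg w - 1) * (lie_deg u - 1)) (F u (w # Y)))"

definition dec3 ::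
  "'v lword \<Rightarrow> ('v lword \<Rightarrow> 'v lword \<Rightarrow> 'v lword \<Rightarrow> 'u::ab_group_add) \<Rightarrow> 'u" where
  "dec3 w F = dec w (\<lambda>a r. dec r (\<lambda>b c. if b = [] then 0 else F a b c))"

text \<open>The exponent is the Koszul sign for rearranging \<open>a b c x Y z\<close> into
  \<open>a x b Y c z\<close>: the odd shift of the block passes \<open>a\<close>, then
  \<open>x\<close> passes \<open>c\<close> and the shifted \<open>b\<close>, then \<open>c\<close>
  passes \<open>Y\<close>.\<close>

fun slices ::
  "'v bword \<Rightarrow> ('v lword \<Rightarrow> 'v bword \<Rightarrow> 'v lword \<Rightarrow> 'u::ab_group_add) \<Rightarrow> 'u" where
  "slices [] F = F [] [] []"
| "slices (w # X) F = dec3 w (\<lambda>a b c. slices X (\<lambda>x Y z.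
     signed (lie_deg a + lie_deg x * (lie_deg b - 1 + lie_deg c) + gdeg Y * lie_deg c)
       (shuf a x (\<lambda>x'. shuf c z (\<lambda>z'. F x' (b # Y) z')))))"

section \<open>Additivity of the operations, exchange of two operations, and additive maps applied
  to them\<close>

lemma shuf_add: "shuf u w (\<lambda>x. F x + G x) = shuf u w F + shuf u w G"
  by (induction u w F arbitrary: G rule: shuf.induct) (simp_all add: signed_add)

lemma dec_add: "dec w (\<lambda>x y. F x y + G x y) = dec w F + dec w G"
  by (induction w arbitrary: F G) simp_all

lemma split_blocks_add:
  "split_blocks X (\<lambda>x y. F x y + G x y) = split_blocks X F + split_blocks X G"
  by (induction X arbitrary: F G) (simp_all add: signed_add)

lemma pick_add: "pick X (\<lambda>x y. F x y + G x y) = pick X F + pick X G"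
  by (induction X arbitrary: F G) (simp_all add: signed_add)

lemma dec3_add: "dec3 w (\<lambda>a b c. F a b c + G a b c) = dec3 w F + dec3 w G"
proof -
  have "dec3 w (\<lambda>a b c. F a b c + G a b c) = dec w (\<lambda>a r. dec r (\<lambda>b c.
      (if b = [] then 0 else F a b c) + (if b = [] then 0 else G a b c)))"
    unfolding dec3_def by (intro arg_cong[where f = "dec w"] ext arg_cong2[where f = dec] refl) auto
  then show ?thesis
    by (simp add: dec_add dec3_def)
qed

lemma slices_add:
  "slices X (\<lambda>x Y z. F x Y z + G x Y z) = slices X F + slices X G"
  by (induction X arbitrary: F G) (simp_all add: signed_add shuf_add dec3_add)

lemmas op_add = shuf_add dec_add split_blocks_add pick_add dec3_add slices_add

lemma shuf_swap:
  fixes F :: "'a \<Rightarrow> 'v lword \<Rightarrow> 'u::ab_group_add"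
  assumes "additive_op T"
  shows "T (\<lambda>y. shuf u w (F y)) = shuf u w (\<lambda>x. T (\<lambda>y. F y x))"
  by (induction u w arbitrary: F rule: shuf_induct)
     (simp_all add: additive_opD[OF assms] additive_op_signed[OF assms])

lemma dec_swap:
  assumes "additive_op T"
  shows "T (\<lambda>t. dec w (F t)) = dec w (\<lambda>x y. T (\<lambda>t. F t x y))"
  by (induction w arbitrary: F) (simp_all add: additive_opD[OF assms])

lemma split_blocks_swap:
  assumes "additive_op T"
  shows "T (\<lambda>t. split_blocks X (F t)) = split_blocks X (\<lambda>x y. T (\<lambda>t. F t x y))"
  by (induction X arbitrary: F) (simp_all add: additive_opD[OF assms] additive_op_signed[OF assms])

lemma pick_swap:
  assumes "additive_op T"
  shows "T (\<lambda>t. pick X (F t)) = pick X (\<lambda>x y. T (\<lambda>t. F t x y))"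
  by (induction X arbitrary: F)
     (simp_all add: additive_opD[OF assms] additive_op_signed[OF assms] additive_op_0[OF assms])

lemma dec3_swap:
  assumes "additive_op T"
  shows "T (\<lambda>t. dec3 w (F t)) = dec3 w (\<lambda>a b c. T (\<lambda>t. F t a b c))"
  unfolding dec3_def dec_swap[OF assms]
  by (intro arg_cong[where f = "dec w"] ext arg_cong2[where f = dec] refl)
     (auto simp: additive_op_0[OF assms])

lemma slices_swap:
  assumes "additive_op T"
  shows "T (\<lambda>t. slices X (F t)) = slices X (\<lambda>x Y z. T (\<lambda>t. F t x Y z))"
  by (induction X arbitrary: F)
     (simp_all add: additive_op_signed[OF assms] dec3_swap[OF assms] shuf_swap[OF assms])

lemma shuf_hom: "additive_fun f \<Longrightarrow> f (shuf u w F) = shuf u w (\<lambda>x. f (F x))"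
  by (induction u w F rule: shuf.induct) (simp_all add: additive_funD additive_fun_signed)

lemma dec_hom: "additive_fun f \<Longrightarrow> f (dec w F) = dec w (\<lambda>x y. f (F x y))"
  by (induction w arbitrary: F) (simp_all add: additive_funD)

lemma split_blocks_hom:
  "additive_fun f \<Longrightarrow> f (split_blocks X F) = split_blocks X (\<lambda>x y. f (F x y))"
  by (induction X arbitrary: F) (simp_all add: additive_funD additive_fun_signed)

lemma pick_hom: "additive_fun f \<Longrightarrow> f (pick X F) = pick X (\<lambda>x y. f (F x y))"
  by (induction X arbitrary: F) (simp_all add: additive_funD additive_fun_signed additive_fun_0)

lemma dec3_hom: "additive_fun f \<Longrightarrow> f (dec3 w F) = dec3 w (\<lambda>a b c. f (F a b c))"
  unfolding dec3_def
  by (simp add: dec_hom if_distrib[where f = f] additive_fun_0 cong: if_cong)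

lemma slices_hom: "additive_fun f \<Longrightarrow> f (slices X F) = slices X (\<lambda>x Y z. f (F x Y z))"
  by (induction X arbitrary: F) (simp_all add: additive_fun_signed dec3_hom shuf_hom)

lemmas op_hom = shuf_hom dec_hom split_blocks_hom pick_hom dec3_hom slices_hom

lemma shuf_push: "(c::'k::field) * shuf u w F = shuf u w (\<lambda>x. c * F x)"
  by (rule shuf_hom) (simp add: additive_fun_def algebra_simps)
lemma dec_push: "(c::'k::field) * dec w F = dec w (\<lambda>x y. c * F x y)"
  by (rule dec_hom) (simp add: additive_fun_def algebra_simps)
lemma split_blocks_push: "(c::'k::field) * split_blocks X F = split_blocks X (\<lambda>x y. c * F x y)"
  by (rule split_blocks_hom) (simp add: additive_fun_def algebra_simps)
lemma pick_push: "(c::'k::field) * pick X F = pick X (\<lambda>x y. c * F x y)"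
  by (rule pick_hom) (simp add: additive_fun_def algebra_simps)
lemma dec3_push: "(c::'k::field) * dec3 w F = dec3 w (\<lambda>x y z. c * F x y z)"
  by (rule dec3_hom) (simp add: additive_fun_def algebra_simps)
lemma slices_push: "(c::'k::field) * slices X F = slices X (\<lambda>x y z. c * F x y z)"
  by (rule slices_hom) (simp add: additive_fun_def algebra_simps)

lemmas op_push = shuf_push dec_push split_blocks_push pick_push dec3_push slices_push

section \<open>Congruence rules that record the letters and degrees of the pieces\<close>

lemma lie_deg_mset: "lie_deg w = sum_mset (image_mset letter_deg (mset w))"
  by (induction w) simp_all

lemma shuf_cong:
  assumes "\<And>x. mset x = mset u + mset w \<Longrightarrow> F x = G x"
  shows "shuf u w F = shuf u w G"
  using assms
proof (induction u w arbitrary: F G rule: shuf_induct)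
  case (Cons a u b w)
  have "shuf u (b # w) (\<lambda>x. F (a # x)) = shuf u (b # w) (\<lambda>x. G (a # x))"
    by (rule Cons.IH(1)) (auto intro: Cons.prems)
  moreover have "shuf (a # u) w (\<lambda>x. F (b # x)) = shuf (a # u) w (\<lambda>x. G (b # x))"
    by (rule Cons.IH(2)) (auto intro: Cons.prems)
  ultimately show ?case
    by simp
qed simp_all

text \<open>As a congruence rule this tells the simplifier the degree of the bound word, so that
  signs depending on that word can be pulled out and compared. The other \<open>_cong_deg\<close>
  rules serve the same purpose.\<close>

lemma shuf_cong_deg [cong]:
  assumes "u = u'" "w = w'" "\<And>x. lie_deg x = lie_deg u' + lie_deg w' \<Longrightarrow> F x = G x"
  shows "shuf u w F = shuf u' w' G"
  unfolding assms(1,2) by (rule shuf_cong) (auto simp: assms(3) lie_deg_mset)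

lemma dec_cong:
  assumes "\<And>x y. x @ y = w \<Longrightarrow> F x y = G x y"
  shows "dec w F = dec w G"
  using assms
proof (induction w arbitrary: F G)
  case (Cons a w)
  have "dec w (\<lambda>x y. F (a # x) y) = dec w (\<lambda>x y. G (a # x) y)"
    by (rule Cons.IH) (auto intro: Cons.prems)
  then show ?case
    using Cons.prems[of "[]" "a # w"] by simp
qed simp

lemma dec_cong_deg [cong]:
  assumes "w = w'" "\<And>x y. lie_deg w' = lie_deg x + lie_deg y \<Longrightarrow> F x y = G x y"
  shows "dec w F = dec w' G"
  unfolding assms(1) by (rule dec_cong) (auto simp: assms(2) lie_deg_append[symmetric] simp del: lie_deg_append)

section \<open>The graded bialgebra of shuffles and deconcatenation\<close>

lemma shuf_commute: "shuf u w F = (sign (lie_deg u * lie_deg w) * shuf w u F :: 'k::field)"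
proof (induction u w arbitrary: F rule: shuf_induct)
  case (Cons a u b w)
  show ?case
    by (simp add: Cons.IH[of "\<lambda>x. F (_ # x)"]) (simp add: algebra_simps sign_simps)
qed (simp_all add: sign_simps)

lemma shuf_assoc:
  "shuf u w (\<lambda>x. shuf x y F) = (shuf w y (\<lambda>x. shuf u x F) :: 'k::field)"
proof (induction "length u + length w + length y" arbitrary: u w y F rule: less_induct)
  case less
  show ?case
  proof (cases "u = [] \<or> w = [] \<or> y = []")
    case False
    then obtain a u' b w' c y' where e: "u = a # u'" "w = b # w'" "y = c # y'"
      by (metis list.exhaust)
    have i1: "shuf u' w (\<lambda>x. shuf x y G) = shuf w y (\<lambda>x. shuf u' x G)" for G :: "_ \<Rightarrow> 'k"
      using less[of u' w y] by (simp add: e)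
    have i2: "shuf u w' (\<lambda>x. shuf x y G) = shuf w' y (\<lambda>x. shuf u x G)" for G :: "_ \<Rightarrow> 'k"
      using less[of u w' y] by (simp add: e)
    have i3: "shuf u w (\<lambda>x. shuf x y' G) = shuf w y' (\<lambda>x. shuf u x G)" for G :: "_ \<Rightarrow> 'k"
      using less[of u w y'] by (simp add: e)
    show ?thesis
      using i1[of "\<lambda>x. F (a # x)"] i2[of "\<lambda>x. F (b # x)"] 
        i3[of "\<lambda>x. sign ((letter_deg a + lie_deg u' + letter_deg b + lie_deg w') * letter_deg c) * F (c # x)"]
      apply (simp add: e shuf_add)
      apply (simp add: algebra_simps sign_simps shuf_add shuf_push)
      done
  qed auto
qed

lemma dec_assoc: "dec w (\<lambda>x y. dec y (F x)) = dec w (\<lambda>x y. dec x (\<lambda>p q. F p q y))"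
  by (induction w arbitrary: F) (simp_all add: dec_add)

text \<open>Deconcatenation is multiplicative for the shuffle product; the sign comes from moving
  \<open>w1\<close> past \<open>u2\<close>.\<close>

lemma shuf_dec:
  "shuf u w (\<lambda>x. dec x F) = dec u (\<lambda>u1 u2. dec w (\<lambda>w1 w2.
     sign (lie_deg u2 * lie_deg w1) * shuf u1 w1 (\<lambda>x. shuf u2 w2 (F x) :: 'k::field)))"
proof (induction u w arbitrary: F rule: shuf_induct)
  case (Cons a u b w)
  show ?case
    by (simp add: shuf_add Cons.IH[of "\<lambda>x y. F (_ # x) y"])
      (simp add: algebra_simps sign_simps shuf_add shuf_push dec_push dec_add)
qed (simp_all add: sign_simps)

lemma dec_marked: "dec (x @ g # z) F =
    dec x (\<lambda>x1 x2. F x1 (x2 @ g # z)) + dec z (\<lambda>z1 z2. F (x @ g # z1) z2)"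
  by (induction x arbitrary: F) (simp_all add: add_ac)

text \<open>The letter \<open>g\<close> cuts every shuffle in two, so \<open>w\<close> splits into a
  part \<open>w1\<close> that goes in front of \<open>g\<close> and a part \<open>w2\<close> that
  goes behind it. This controls the words \<open>x @ g Y # z\<close> produced by the
  coextension.\<close>

lemma shuf_marked:
  "shuf w (p @ g # q) F = dec w (\<lambda>w1 w2. sign (lie_deg w2 * (lie_deg p + letter_deg g)) *
     shuf w1 p (\<lambda>x. shuf w2 q (\<lambda>z. F (x @ g # z) :: 'k::field)))"
proof (induction w arbitrary: p F)
  case Nil
  show ?case by (simp add: sign_simps)
next
  case (Cons b w)
  note IHw = Cons.IH
  show ?case
  proof (induction p arbitrary: F)
    case Nil
    show ?case
      by (simp add: IHw[of "[]", simplified] sign_simps algebra_simps op_push)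
  next
    case (Cons a p)
    show ?case
      by (simp add: dec_add Cons.IH IHw[of "a # p", simplified] sign_simps algebra_simps op_push)
  qed
qed

lemma dec_ext: "(\<And>a b. F a b = G a b) \<Longrightarrow> dec w F = dec w G"
  by (metis ext)
lemma shuf_ext: "(\<And>a. F a = G a) \<Longrightarrow> shuf u w F = shuf u w G"
  by (metis ext)
lemma dec3_ext: "(\<And>a b c. F a b c = G a b c) \<Longrightarrow> dec3 w F = dec3 w G"
  by (metis ext)
lemma slices_ext: "(\<And>a b c. F a b c = G a b c) \<Longrightarrow> slices w F = slices w G"
  by (metis ext)
lemma split_blocks_ext: "(\<And>a b. F a b = G a b) \<Longrightarrow> split_blocks w F = split_blocks w G"
  by (metis ext)
lemma pick_ext: "(\<And>a b. F a b = G a b) \<Longrightarrow> pick w F = pick w G"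
  by (metis ext)
lemma additive_op_shuf: "additive_op (\<lambda>G. shuf u w (\<lambda>x. G x))"
  by (simp add: additive_op_def op_add)
lemma additive_op_dec: "additive_op (\<lambda>G. dec w (\<lambda>x y. G (x, y)))"
  by (simp add: additive_op_def op_add)
lemma additive_op_dec3: "additive_op (\<lambda>G. dec3 w (\<lambda>x y z. G (x, y, z)))"
  by (simp add: additive_op_def op_add)
lemma additive_op_split_blocks: "additive_op (\<lambda>G. split_blocks X (\<lambda>x y. G (x, y)))"
  by (simp add: additive_op_def op_add)
lemma additive_op_pick: "additive_op (\<lambda>G. pick X (\<lambda>x y. G (x, y)))"
  by (simp add: additive_op_def op_add)
lemma additive_op_slices: "additive_op (\<lambda>G. slices X (\<lambda>x y z. G (x, y, z)))"
  by (simp add: additive_op_def op_add)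

lemma dec3_cong:
  assumes "\<And>a b c. a @ b @ c = w \<Longrightarrow> b \<noteq> [] \<Longrightarrow> F a b c = G a b c"
  shows "dec3 w F = dec3 w G"
  unfolding dec3_def
  by (rule dec_cong, rule dec_cong) (auto simp: assms)

lemma dec3_cong_deg [cong]:
  assumes "w = w'" "\<And>a b c. lie_deg w' = lie_deg a + lie_deg b + lie_deg c \<Longrightarrow> F a b c = G a b c"
  shows "dec3 w F = dec3 w' G"
  unfolding assms(1)
  by (rule dec3_cong) (auto simp: assms(2) simp flip: lie_deg_append simp del: lie_deg_append)

lemma split_blocks_cong:
  assumes "\<And>I J. mset X = mset I + mset J \<Longrightarrow> F I J = G I J"
  shows "split_blocks X F = split_blocks X G"
  using assms
proof (induction X arbitrary: F G)
  case (Cons w X)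
  have "split_blocks X (\<lambda>I J. F (w # I) J) = split_blocks X (\<lambda>I J. G (w # I) J)"
    by (rule Cons.IH) (auto intro: Cons.prems)
  moreover have "split_blocks X (\<lambda>I J. signed ((lie_deg w - 1) * gdeg I) (F I (w # J))) =
      split_blocks X (\<lambda>I J. signed ((lie_deg w - 1) * gdeg I) (G I (w # J)))"
    by (rule Cons.IH) (auto intro!: arg_cong[where f = "signed _"] Cons.prems)
  ultimately show ?case
    by simp
qed simp

lemma pick_cong:
  assumes "\<And>w Y. mset X = add_mset w (mset Y) \<Longrightarrow> F w Y = G w Y"
  shows "pick X F = pick X G"
  using assms
proof (induction X arbitrary: F G)
  case (Cons w X)
  have "pick X (\<lambda>u Y. signed ((lie_deg w - 1) * (lie_deg u - 1)) (F u (w # Y))) =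
      pick X (\<lambda>u Y. signed ((lie_deg w - 1) * (lie_deg u - 1)) (G u (w # Y)))"
    by (rule Cons.IH) (auto intro!: arg_cong[where f = "signed _"] Cons.prems)
  then show ?case
    using Cons.prems[of w X] by simp
qed simp

lemma gdeg_mset: "gdeg X = (\<Sum>w\<in>#mset X. lie_deg w - 1)"
  by (induction X) simp_all

lemma split_blocks_cong_deg [cong]:
  assumes "X = X'" "\<And>I J. gdeg X' = gdeg I + gdeg J \<Longrightarrow> F I J = G I J"
  shows "split_blocks X F = split_blocks X' G"
  unfolding assms(1) by (rule split_blocks_cong) (auto simp: assms(2) gdeg_mset)

lemma pick_cong_deg [cong]:
  assumes "X = X'" "\<And>w Y. gdeg X' = lie_deg w - 1 + gdeg Y \<Longrightarrow> F w Y = G w Y"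
  shows "pick X F = pick X' G"
  unfolding assms(1) by (rule pick_cong) (auto simp: assms(2) gdeg_mset)

lemma slices_cong:
  assumes "\<And>x Y z. mset (concat X) = mset x + mset (concat Y) + mset z \<Longrightarrow>
     length Y = length X \<Longrightarrow> [] \<notin> set Y \<Longrightarrow> F x Y z = G x Y z"
  shows "slices X F = slices X G"
  using assms
proof (induction X arbitrary: F G)
  case (Cons w X)
  show ?case
    by (auto intro!: dec3_cong Cons.IH arg_cong[where f = "signed _"] shuf_cong Cons.prems)
qed simp

lemma gdeg_eq_concat: "gdeg X = lie_deg (concat X) - int (length X)"
  by (induction X) simp_all

lemma slices_cong_deg [cong]:
  assumes "X = X'" "\<And>x Y z. gdeg X' = lie_deg x + gdeg Y + lie_deg z \<Longrightarrow> F x Y z = G x Y z"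
  shows "slices X F = slices X' G"
  unfolding assms(1)
  by (rule slices_cong) (auto simp: assms(2) gdeg_eq_concat lie_deg_mset simp del: mset_concat)

lemma additive_fun_uminus: "additive_fun (uminus :: 'u::ab_group_add \<Rightarrow> 'u)"
  by (simp add: additive_fun_def)

lemma op_minus:
  "shuf u w (\<lambda>x. - F x) = - shuf u w F"
  "dec w (\<lambda>x y. - G x y) = - dec w G"
  "split_blocks X (\<lambda>I J. - H I J) = - split_blocks X H"
  "pick X (\<lambda>v Y. - K v Y) = - pick X K"
  "dec3 w (\<lambda>a b c. - L a b c) = - dec3 w L"
  "slices X (\<lambda>x Y z. - M x Y z) = - slices X M"
  by (simp_all add: op_hom[OF additive_fun_uminus])

lemma op_zero:
  "shuf u w (\<lambda>x. 0) = 0"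
  "dec w (\<lambda>x y. 0) = 0"
  "split_blocks X (\<lambda>I J. 0) = 0"
  "pick X (\<lambda>v Y. 0) = 0"
  "dec3 w (\<lambda>a b c. 0) = 0"
  "slices X (\<lambda>x Y z. 0) = 0"
  by (simp_all add: additive_op_0[OF additive_op_shuf] additive_op_0[OF additive_op_dec, simplified]
    additive_op_0[OF additive_op_dec3, simplified] additive_op_0[OF additive_op_pick, simplified]
    additive_op_0[OF additive_op_slices, simplified] additive_op_0[OF additive_op_split_blocks, simplified])

lemma sign_mult_2: "sign (a * 2) = (1::'k::field)" "sign (2 * a) = (1::'k::field)"
  by (simp_all add: sign_def)

section \<open>Graded symmetry of \<open>slices\<close> in the blocks\<close>

lemma shuf_left_commute: "shuf a x (\<lambda>y. shuf b y F) =
    (sign (lie_deg a * lie_deg b) * shuf b x (\<lambda>y. shuf a y F) :: 'k::field)"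
  using shuf_assoc[of b a x F] shuf_assoc[of a b x F] shuf_commute[of b a "\<lambda>y. shuf y x F"]
  by (simp add: sign_simps mult_ac)

lemma slices_Cons2:
  "slices (u # w # X) G = dec3 u (\<lambda>a b c. dec3 w (\<lambda>a' b' c'. slices X (\<lambda>x Y z.
     sign (lie_deg a + (lie_deg a' + lie_deg x) * (lie_deg b - 1 + lie_deg c) +
        (lie_deg b' - 1 + gdeg Y) * lie_deg c + lie_deg a' +
        lie_deg x * (lie_deg b' - 1 + lie_deg c') + gdeg Y * lie_deg c') *
     shuf a' x (\<lambda>x1. shuf a x1 (\<lambda>x2. shuf c' z (\<lambda>z1. shuf c z1 (\<lambda>z2.
       G x2 (b # b' # Y) z2 :: 'k::field)))))))"
proof -
  have sw: "shuf c' z (\<lambda>z1. shuf a x1 (\<lambda>x2. H x2 z1)) = shuf a x1 (\<lambda>x2. shuf c' z (H x2))"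
    for c' z a x1 and H :: "_ \<Rightarrow> _ \<Rightarrow> 'k"
    by (rule shuf_swap) (rule additive_op_shuf)
  show ?thesis
    apply (simp only: slices.simps)
    apply (simp only: signed_field op_push)
    apply (rule dec3_ext)+
    apply (rule slices_ext)
    apply (rule shuf_cong_deg[OF refl refl])
    apply (subst sw)
    apply (rule shuf_ext)+
    apply (simp add: algebra_simps sign_simps sign_mult_2)
    done
qed

text \<open>Exchanging the blocks exchanges \<open>a\<close> with \<open>a'\<close> and
  \<open>c\<close> with \<open>c'\<close> inside shuffles, which are graded commutative, and
  \<open>b\<close> with \<open>b'\<close> inside \<open>G\<close>. The three signs and the two
  rearrangement signs of \<open>slices\<close> combine to that of the shifted blocks.\<close>

lemma slices_commute_head:
  fixes G :: "'v lword \<Rightarrow> 'v bword \<Rightarrow> 'v lword \<Rightarrow> 'k::field"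
  assumes G: "\<And>x b b' Y z. G x (b # b' # Y) z =
    sign ((lie_deg b - 1) * (lie_deg b' - 1)) * G x (b' # b # Y) z"
  shows "slices (u # w # X) G = sign ((lie_deg u - 1) * (lie_deg w - 1)) * slices (w # u # X) G"
proof -
  have sw: "dec3 w (\<lambda>a' b' c'. dec3 u (\<lambda>a b c. H a b c a' b' c')) =
      dec3 u (\<lambda>a b c. dec3 w (\<lambda>a' b' c'. H a b c a' b' c'))"
    for H :: "_ \<Rightarrow> _ \<Rightarrow> _ \<Rightarrow> _ \<Rightarrow> _ \<Rightarrow> _ \<Rightarrow> 'k"
    using dec3_swap[OF additive_op_dec3[of w], where F = "\<lambda>(a', b', c') a b c. H a b c a' b' c'"] by simp
  have e: "shuf a' x (\<lambda>x1. shuf a x1 (\<lambda>x2. shuf c' z (\<lambda>z1. shuf c z1 (\<lambda>z2. s * G x2 (b # b' # Y) z2)))) =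
     sign (lie_deg a * lie_deg a' + lie_deg c * lie_deg c' + (lie_deg b - 1) * (lie_deg b' - 1)) *
     shuf a x (\<lambda>x1. shuf a' x1 (\<lambda>x2. shuf c z (\<lambda>z1. shuf c' z1 (\<lambda>z2. s * G x2 (b' # b # Y) z2))))"
    for a' x a c' z c b b' Y s
    by (subst G, subst shuf_left_commute[of a'], subst shuf_left_commute[of c'])
       (simp add: op_push sign_simps algebra_simps sign_mult_2 op_minus)
  show ?thesis
    apply (subst slices_Cons2[of u w], subst slices_Cons2[of w u], subst sw)
    apply (simp only: op_push)
    apply (rule dec3_cong_deg[OF refl])+
    apply (rule slices_ext)
    apply (subst e)
    apply (simp add: op_push sign_simps algebra_simps sign_mult_2 op_minus)
    done
qed

text \<open>Adjacent transpositions suffice; these are the functionals that descend to the graded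
  symmetric product of the shifted words.\<close>

definition block_symmetric :: "('v bword \<Rightarrow> 'k::field) \<Rightarrow> bool" where
  "block_symmetric F \<longleftrightarrow> (\<forall>X u w Y. F (X @ u # w # Y) =
     sign ((lie_deg u - 1) * (lie_deg w - 1)) * F (X @ w # u # Y))"

lemma block_symmetricD: "block_symmetric F \<Longrightarrow>
    F (X @ u # w # Y) = sign ((lie_deg u - 1) * (lie_deg w - 1)) * F (X @ w # u # Y)"
  unfolding block_symmetric_def by blast

lemma block_symmetric_head: "block_symmetric F \<Longrightarrow>
    F (u # w # Y) = sign ((lie_deg u - 1) * (lie_deg w - 1)) * F (w # u # Y)"
  using block_symmetricD[of F "[]" u w Y] by simp

lemma block_symmetric_Cons: "block_symmetric F \<Longrightarrow> block_symmetric (\<lambda>X. F (w # X))"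
  unfolding block_symmetric_def by (metis append_Cons)

lemma block_symmetric_move: "block_symmetric F \<Longrightarrow>
    F (X @ w # Y) = sign ((lie_deg w - 1) * gdeg X) * F (w # X @ Y)"
proof (induction X arbitrary: F)
  case Nil
  show ?case by (simp add: sign_simps)
next
  case (Cons u X)
  show ?case
    using Cons.IH[OF block_symmetric_Cons[OF Cons.prems]] block_symmetric_head[OF Cons.prems, of u w "X @ Y"]
    by (simp add: sign_simps algebra_simps)
qed

text \<open>The functional of \<open>Y\<close> that \<open>slices\<close> passes on after cutting
  its first block is again symmetric, because the sign in front depends on \<open>Y\<close> only
  through \<open>gdeg Y\<close>. So the exchange can be moved to the head.\<close>

lemma slices_symmetric:
  assumes "\<And>x z. block_symmetric (\<lambda>Y. G x Y z)"
  shows "block_symmetric (\<lambda>X. slices X G)"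
proof -
  have "slices (P @ u # w # X) G = sign ((lie_deg u - 1) * (lie_deg w - 1)) * slices (P @ w # u # X) G"
    for P u w X
    using assms
  proof (induction P arbitrary: G)
    case Nil
    show ?case
      unfolding append_Nil by (rule slices_commute_head) (rule block_symmetric_head[OF Nil])
  next
    case (Cons p P)
    have "block_symmetric (\<lambda>Y. sign (lie_deg a + lie_deg x * (lie_deg b - 1 + lie_deg c) + gdeg Y * lie_deg c) *
      shuf a x (\<lambda>x'. shuf c z (\<lambda>z'. G x' (b # Y) z')))" for a b c x z
      unfolding block_symmetric_def
    proof (intro allI)
      fix P u w Y
      have e: "G x' (b # P @ u # w # Y) z' =
        sign ((lie_deg u - 1) * (lie_deg w - 1)) * G x' (b # P @ w # u # Y) z'" for x' z'
        using block_symmetricD[OF Cons.prems, where X = "b # P" and u = u and w = w and Y = Y]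
        unfolding append_Cons .
      show "sign (lie_deg a + lie_deg x * (lie_deg b - 1 + lie_deg c) + gdeg (P @ u # w # Y) * lie_deg c) *
        shuf a x (\<lambda>x'. shuf c z (\<lambda>z'. G x' (b # P @ u # w # Y) z')) =
        sign ((lie_deg u - 1) * (lie_deg w - 1)) *
        (sign (lie_deg a + lie_deg x * (lie_deg b - 1 + lie_deg c) + gdeg (P @ w # u # Y) * lie_deg c) *
        shuf a x (\<lambda>x'. shuf c z (\<lambda>z'. G x' (b # P @ w # u # Y) z')))"
        unfolding e op_push
        by (intro shuf_ext) (simp add: algebra_simps)
    qed
    note Cons.IH[OF this]
    then show ?case
      by (simp only: append_Cons slices.simps signed_field op_push)
  qed
  then show ?thesis
    unfolding block_symmetric_def by blast
qed

text \<open>The functionals on words that descend to the cofree Lie coalgebra. The empty word has no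
  class there; the value 0 on it lets \<open>shuf_shuffle_free\<close> cover shuffles with empty
  factors.\<close>

definition shuffle_free :: "('v lword \<Rightarrow> 'k::field) \<Rightarrow> bool" where
  "shuffle_free f \<longleftrightarrow> f [] = 0 \<and> (\<forall>u w. u \<noteq> [] \<longrightarrow> w \<noteq> [] \<longrightarrow> shuf u w f = 0)"

lemma shuffle_free_Nil: "shuffle_free f \<Longrightarrow> f [] = 0"
  by (simp add: shuffle_free_def)

lemma shuf_shuffle_free: "shuffle_free f \<Longrightarrow>
    shuf a x f = (if a = [] then f x else 0) + (if x = [] then f a else 0)"
  by (simp add: shuffle_free_def)

lemma dec_first: "dec x (\<lambda>a b. if a = [] then K a b else 0) = K [] x"
  by (cases x) (simp_all add: op_zero)

lemma dec_last: "dec x (\<lambda>a b. if b = [] then K a b else 0) = K x []"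
  by (induction x arbitrary: K) simp_all

lemma shuffle_free_shuf:
  fixes H :: "'v lword \<Rightarrow> 'w lword \<Rightarrow> 'k::field"
  assumes "\<And>y. shuffle_free (\<lambda>x. H x y)"
  shows "shuffle_free (\<lambda>x. shuf u w (H x))"
proof -
  have "shuf p q (\<lambda>x. shuf u w (H x)) = shuf u w (\<lambda>y. shuf p q (\<lambda>x. H x y))" for p q
    by (rule shuf_swap) (rule additive_op_shuf)
  then show ?thesis
    using assms by (simp add: shuffle_free_def op_zero)
qed

text \<open>In \<open>shuf_dec\<close> the first piece is a shuffle of \<open>a1\<close> with
  \<open>x1\<close>, which \<open>H\<close> kills unless one of them is empty. Hence the cut runs
  through \<open>a\<close> alone or through \<open>x\<close> alone.\<close>

lemma shuf_dec_left:
  fixes H :: "'v lword \<Rightarrow> 'v lword \<Rightarrow> 'k::field"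
  assumes "\<And>y. shuffle_free (\<lambda>x. H x y)"
  shows "shuf a x (\<lambda>y. dec y H) = dec a (\<lambda>a1 a2. shuf a2 x (H a1)) +
     dec x (\<lambda>x1 x2. sign (lie_deg a * lie_deg x1) * shuf a x2 (H x1))"
proof -
  have "shuf a x (\<lambda>y. dec y H) = dec a (\<lambda>a1 a2. dec x (\<lambda>x1 x2.
      (if x1 = [] then shuf a2 x2 (H a1) else 0))) + dec a (\<lambda>a1 a2. if a1 = [] then
      dec x (\<lambda>x1 x2. sign (lie_deg a2 * lie_deg x1) * shuf a2 x2 (H x1)) else 0)"
    unfolding shuf_dec
    apply (subst dec_add[symmetric])
    apply (rule dec_ext)
    apply (subst shuf_shuffle_free[OF shuffle_free_shuf[OF assms]])
    apply (auto simp: algebra_simps dec_add op_zero sign_simps intro!: dec_ext)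
    done
  then show ?thesis
    by (simp add: dec_first)
qed

lemma shuf_dec_right:
  fixes H :: "'v lword \<Rightarrow> 'v lword \<Rightarrow> 'k::field"
  assumes "\<And>y. shuffle_free (H y)"
  shows "shuf a x (\<lambda>y. dec y H) =
     dec a (\<lambda>a1 a2. sign (lie_deg a2 * lie_deg x) * shuf a1 x (\<lambda>t. H t a2)) +
     dec x (\<lambda>x1 x2. shuf a x1 (\<lambda>t. H t x2))"
proof -
  have "shuf a x (\<lambda>y. dec y H) = dec a (\<lambda>a1 a2. dec x (\<lambda>x1 x2.
      (if x2 = [] then sign (lie_deg a2 * lie_deg x1) * shuf a1 x1 (\<lambda>t. H t a2) else 0))) +
      dec a (\<lambda>a1 a2. if a2 = [] then dec x (\<lambda>x1 x2. shuf a1 x1 (\<lambda>t. H t x2)) else 0)"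
    unfolding shuf_dec
    apply (subst dec_add[symmetric])
    apply (rule dec_ext)
    apply (subst shuf_shuffle_free[OF assms])
    apply (auto simp: algebra_simps dec_add op_zero shuf_add op_push sign_simps intro!: dec_ext)
    done
  then show ?thesis
    by (simp add: dec_last)
qed

lemma dec3_dec_left: "dec3 w (\<lambda>a b c. dec a (\<lambda>a1 a2. K a1 a2 b c)) =
    dec w (\<lambda>p r. dec3 r (\<lambda>a b c. K p a b c))"
proof -
  have "dec3 w (\<lambda>a b c. dec a (\<lambda>a1 a2. K a1 a2 b c)) =
     dec w (\<lambda>a r. dec a (\<lambda>a1 a2. dec r (\<lambda>b c. if b = [] then 0 else K a1 a2 b c)))"
    unfolding dec3_def
    apply (rule dec_ext)
    apply (subst dec_swap[where F = "\<lambda>(b, c) a1 a2. if b = [] then 0 else K a1 a2 b c",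
      OF additive_op_dec, simplified, symmetric])
    apply (rule dec_ext)
    apply (simp add: op_zero)
    done
  then show ?thesis
    by (simp add: dec3_def dec_assoc[symmetric])
qed

lemma dec3_dec_right: "dec3 w (\<lambda>a b c. dec c (\<lambda>c1 c2. K a b c1 c2)) =
    dec w (\<lambda>r p. dec3 r (\<lambda>a b c. K a b c p))"
proof -
  have "dec3 w (\<lambda>a b c. dec c (\<lambda>c1 c2. K a b c1 c2)) =
     dec w (\<lambda>a r. dec r (\<lambda>b c. dec c (\<lambda>c1 c2. if b = [] then 0 else K a b c1 c2)))"
    unfolding dec3_def by (intro dec_ext) (simp add: op_zero)
  then show ?thesis
    by (simp add: dec3_def dec_assoc)
qed

lemma shuffle_free_signed:
  "shuffle_free f \<Longrightarrow> shuffle_free (\<lambda>x. sign (d + e * lie_deg x) * f x)"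
proof -
  assume f: "shuffle_free f"
  have "shuf u w (\<lambda>x. sign (d + e * lie_deg x) * f x) = sign (d + e * (lie_deg u + lie_deg w)) * shuf u w f" for u w
    by (simp add: op_push)
  then show ?thesis
    using f by (simp add: shuffle_free_def)
qed

text \<open>The prefix \<open>x1\<close> that is cut off is a shuffle of prefixes of the blocks, so
  for a shuffle-free \<open>H\<close> it comes from a single block \<open>w = p @ r\<close>. By
  symmetry this block may be moved to the front; the sign is that of the shift passing
  \<open>p\<close>.\<close>

lemma slices_dec_left:
  fixes H :: "'v lword \<Rightarrow> 'v lword \<Rightarrow> 'v bword \<Rightarrow> 'v lword \<Rightarrow> 'k::field"
  assumes "\<And>x Y z. shuffle_free (\<lambda>p. H p x Y z)"
    and "\<And>p x z. block_symmetric (\<lambda>Y. H p x Y z)"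
  shows "slices X (\<lambda>x Y z. dec x (\<lambda>x1 x2. H x1 x2 Y z)) = pick X (\<lambda>w X'. dec w (\<lambda>p r.
     sign (lie_deg p) * slices (r # X') (H p)))"
  using assms
proof (induction X arbitrary: H)
  case Nil
  show ?case
    using shuffle_free_Nil[OF Nil(1)] by simp
next
  case (Cons w X)
  define s where "s a b c x Y = (sign (lie_deg a + lie_deg x * (lie_deg b - 1 + lie_deg c) + gdeg Y * lie_deg c) :: 'k)"
    for a b c x :: "'v lword" and Y :: "'v bword"
  define H' where "H' a b c x1 x2 Y z = sign (lie_deg a + lie_deg a * lie_deg x1 + (lie_deg x1 + lie_deg x2) *
    (lie_deg b - 1 + lie_deg c) + gdeg Y * lie_deg c) *
    shuf a x2 (\<lambda>t. shuf c z (\<lambda>z'. H x1 t (b # Y) z'))" for a b c x1 x2 :: "'v lword" and Y z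
  have sf: "shuffle_free (\<lambda>p. H' a b c p x Y z)" for a b c x Y z
  proof -
    have "shuffle_free (\<lambda>p. shuf a x (\<lambda>t. shuf c z (\<lambda>z'. H p t (b # Y) z')))"
      by (intro shuffle_free_shuf Cons.prems)
    from shuffle_free_signed[OF this, where d = "lie_deg a + lie_deg x * (lie_deg b - 1 + lie_deg c) + gdeg Y * lie_deg c"
        and e = "lie_deg a + lie_deg b - 1 + lie_deg c"]
    show ?thesis
      by (simp add: H'_def algebra_simps)
  qed
  have bs: "block_symmetric (\<lambda>Y. H' a b c p x Y z)" for a b c p x z
    unfolding block_symmetric_def
  proof (intro allI)
    fix P u w Y
    have e: "H x' t (b # P @ u # w # Y) z' =
      sign ((lie_deg u - 1) * (lie_deg w - 1)) * H x' t (b # P @ w # u # Y) z'" for x' t z'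
      using block_symmetricD[OF Cons.prems(2), where X = "b # P" and u = u and w = w and Y = Y]
      unfolding append_Cons .
    show "H' a b c p x (P @ u # w # Y) z = sign ((lie_deg u - 1) * (lie_deg w - 1)) * H' a b c p x (P @ w # u # Y) z"
      unfolding H'_def e op_push
      by (intro shuf_ext) (simp add: algebra_simps)
  qed
  have sw: "shuf c z (\<lambda>z'. dec x' (\<lambda>x1 x2. K x1 x2 z')) = dec x' (\<lambda>x1 x2. shuf c z (K x1 x2))"
    for c z x' and K :: "_ \<Rightarrow> _ \<Rightarrow> _ \<Rightarrow> 'k"
    by (rule dec_swap) (rule additive_op_shuf)
  \<comment> \<open>The prefix comes either from the first block, through its piece
    \<open>a\<close>, or from a later one, through \<open>x\<close>. The second sum is left to the
    induction hypothesis.\<close>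
  have 1: "s a b c x Y * shuf a x (\<lambda>x'. shuf c z (\<lambda>z'. dec x' (\<lambda>x1 x2. H x1 x2 (b # Y) z'))) =
     dec a (\<lambda>a1 a2. s a b c x Y * shuf a2 x (\<lambda>t. shuf c z (\<lambda>z'. H a1 t (b # Y) z'))) +
     dec x (\<lambda>x1 x2. H' a b c x1 x2 Y z)" for a b c x Y z
    unfolding sw
    apply (subst shuf_dec_left)
    apply (intro shuffle_free_shuf Cons.prems)
    apply (simp add: distrib_left op_push H'_def s_def)
    apply (simp add: algebra_simps sign_simps)
    done
  have "slices (w # X) (\<lambda>x Y z. dec x (\<lambda>x1 x2. H x1 x2 Y z)) =
    dec3 w (\<lambda>a b c. slices X (\<lambda>x Y z. dec a (\<lambda>a1 a2. s a b c x Y * shuf a2 x (\<lambda>t. shuf c z (\<lambda>z'. H a1 t (b # Y) z'))))) +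
    dec3 w (\<lambda>a b c. slices X (\<lambda>x Y z. dec x (\<lambda>x1 x2. H' a b c x1 x2 Y z)))"
    unfolding slices.simps signed_field s_def[symmetric] 1 slices_add dec3_add ..
  moreover have "dec3 w (\<lambda>a b c. slices X (\<lambda>x Y z. dec a (\<lambda>a1 a2. s a b c x Y * shuf a2 x (\<lambda>t. shuf c z (\<lambda>z'. H a1 t (b # Y) z'))))) =
    dec w (\<lambda>p r. sign (lie_deg p) * slices (r # X) (H p))"
    apply (subst dec_swap[OF additive_op_slices, where F = "\<lambda>(x, Y, z) a1 a2. _ x Y z a1 a2", simplified])
    apply (simp only: s_def cong: dec_cong_deg)
    apply (subst dec3_dec_left)
    apply (simp add: op_push)
    apply (simp add: algebra_simps sign_simps)
    done
  moreover have "dec3 w (\<lambda>a b c. slices X (\<lambda>x Y z. dec x (\<lambda>x1 x2. H' a b c x1 x2 Y z))) =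
    pick X (\<lambda>w' X'. sign ((lie_deg w - 1) * (lie_deg w' - 1)) * dec w' (\<lambda>p r. sign (lie_deg p) * slices (r # w # X') (H p)))"
  proof -
    have 2: "dec3 w (\<lambda>a b c. slices Z (H' a b c p)) =
        sign (lie_deg p * (lie_deg w - 1)) * slices (w # Z) (H p)" for p Z
      unfolding slices.simps signed_field op_push
      apply (rule dec3_cong_deg[OF refl])
      apply (rule slices_ext)
      apply (simp add: H'_def op_push)
      apply (simp add: algebra_simps sign_simps op_minus)
      done
    have 3: "slices (r # w # X') (H p) = sign ((lie_deg r - 1) * (lie_deg w - 1)) * slices (w # r # X') (H p)"
      for p r X'
      by (rule slices_commute_head) (rule block_symmetric_head[OF Cons.prems(2)])
    have "dec3 w (\<lambda>a b c. slices X (\<lambda>x Y z. dec x (\<lambda>x1 x2. H' a b c x1 x2 Y z))) =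
      dec3 w (\<lambda>a b c. pick X (\<lambda>w' X'. dec w' (\<lambda>p r. sign (lie_deg p) * slices (r # X') (H' a b c p))))"
      by (subst Cons.IH[OF sf bs]) (rule refl)
    also have "\<dots> = pick X (\<lambda>w' X'. dec w' (\<lambda>p r. dec3 w (\<lambda>a b c. sign (lie_deg p) * slices (r # X') (H' a b c p))))"
      apply (subst pick_swap[OF additive_op_dec3, where F = "\<lambda>(x, Y, z) a1 a2. _ x Y z a1 a2", simplified])
      apply (subst dec_swap[OF additive_op_dec3, where F = "\<lambda>(x, Y, z) a1 a2. _ x Y z a1 a2", simplified])
      apply (rule refl)
      done
    also have "\<dots> = pick X (\<lambda>w' X'. sign ((lie_deg w - 1) * (lie_deg w' - 1)) * dec w' (\<lambda>p r. sign (lie_deg p) * slices (r # w # X') (H p)))"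
      unfolding dec3_push[symmetric] 2 3 op_push(2)
      apply (intro pick_ext dec_cong_deg[OF refl])
      apply (simp del: slices.simps)
      apply (simp add: algebra_simps sign_simps sign_mult_2 del: slices.simps)
      done
    finally show ?thesis .
  qed
  ultimately show ?case
    by simp
qed

text \<open>The mirror image of \<open>slices_dec_left\<close>. Here \<open>p\<close> is the end of
  the chosen block and leaves to the right, past all other blocks, which explains the sign.\<close>

lemma slices_dec_right:
  fixes H :: "'v lword \<Rightarrow> 'v bword \<Rightarrow> 'v lword \<Rightarrow> 'v lword \<Rightarrow> 'k::field"
  assumes "\<And>x Y z. shuffle_free (\<lambda>p. H x Y z p)"
    and "\<And>p x z. block_symmetric (\<lambda>Y. H x Y z p)"
  shows "slices X (\<lambda>x Y z. dec z (\<lambda>z1 z2. H x Y z1 z2)) = pick X (\<lambda>w X'. dec w (\<lambda>r p.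
     sign (lie_deg p * gdeg X') * slices (r # X') (\<lambda>x Y z. H x Y z p)))"
  using assms
proof (induction X arbitrary: H)
  case Nil
  show ?case
    using shuffle_free_Nil[OF Nil(1)] by simp
next
  case (Cons w X)
  define s where "s a b c x Y = (sign (lie_deg a + lie_deg x * (lie_deg b - 1 + lie_deg c) + gdeg Y * lie_deg c) :: 'k)"
    for a b c x :: "'v lword" and Y :: "'v bword"
  define H' where "H' a b c x Y z1 z2 = s a b c x Y *
    shuf a x (\<lambda>x'. shuf c z1 (\<lambda>t. H x' (b # Y) t z2))" for a b c x :: "'v lword" and Y z1 z2
  have sf: "shuffle_free (\<lambda>p. H' a b c x Y z p)" for a b c x Y z
  proof -
    have "shuffle_free (\<lambda>p. shuf a x (\<lambda>x'. shuf c z (\<lambda>t. H x' (b # Y) t p)))"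
      by (intro shuffle_free_shuf Cons.prems)
    from shuffle_free_signed[OF this, where e = 0]
    show ?thesis
      by (simp add: H'_def s_def)
  qed
  have bs: "block_symmetric (\<lambda>Y. H' a b c x Y z p)" for a b c p x z
    unfolding block_symmetric_def
  proof (intro allI)
    fix P u w Y
    have e: "H x' (b # P @ u # w # Y) z' t =
      sign ((lie_deg u - 1) * (lie_deg w - 1)) * H x' (b # P @ w # u # Y) z' t" for x' t z'
      using block_symmetricD[OF Cons.prems(2), where X = "b # P" and u = u and w = w and Y = Y]
      unfolding append_Cons .
    show "H' a b c x (P @ u # w # Y) z p = sign ((lie_deg u - 1) * (lie_deg w - 1)) * H' a b c x (P @ w # u # Y) z p"
      unfolding H'_def e op_push s_def
      by (intro shuf_ext) (simp add: algebra_simps)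
  qed
  have 1: "s a b c x Y * shuf a x (\<lambda>x'. shuf c z (\<lambda>z'. dec z' (\<lambda>z1 z2. H x' (b # Y) z1 z2))) =
     dec c (\<lambda>c1 c2. s a b c x Y * sign (lie_deg c2 * lie_deg z) *
        shuf a x (\<lambda>x'. shuf c1 z (\<lambda>t. H x' (b # Y) t c2))) +
     dec z (\<lambda>z1 z2. H' a b c x Y z1 z2)" for a b c x Y z
    apply (subst shuf_dec_right)
    apply (rule Cons.prems)
    apply (simp add: distrib_left op_push shuf_add)
    apply (subst dec_swap[OF additive_op_shuf])+
    apply (simp add: H'_def op_push)
    apply (simp add: algebra_simps sign_simps)
    done
  have "slices (w # X) (\<lambda>x Y z. dec z (\<lambda>z1 z2. H x Y z1 z2)) =
    dec3 w (\<lambda>a b c. slices X (\<lambda>x Y z. dec c (\<lambda>c1 c2. s a b c x Y * sign (lie_deg c2 * lie_deg z) *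
        shuf a x (\<lambda>x'. shuf c1 z (\<lambda>t. H x' (b # Y) t c2))))) +
    dec3 w (\<lambda>a b c. slices X (\<lambda>x Y z. dec z (\<lambda>z1 z2. H' a b c x Y z1 z2)))"
    unfolding slices.simps signed_field s_def[symmetric] 1 slices_add dec3_add ..
  moreover have "dec3 w (\<lambda>a b c. slices X (\<lambda>x Y z. dec c (\<lambda>c1 c2. s a b c x Y * sign (lie_deg c2 * lie_deg z) *
        shuf a x (\<lambda>x'. shuf c1 z (\<lambda>t. H x' (b # Y) t c2))))) =
    dec w (\<lambda>r p. sign (lie_deg p * gdeg X) * slices (r # X) (\<lambda>x Y z. H x Y z p))"
    apply (subst dec_swap[OF additive_op_slices, where F = "\<lambda>(x, Y, z) a1 a2. _ x Y z a1 a2", simplified])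
    apply (simp only: s_def cong: dec_cong_deg)
    apply (subst dec3_dec_right)
    apply (simp add: op_push)
    apply (simp add: algebra_simps sign_simps)
    done
  moreover have "dec3 w (\<lambda>a b c. slices X (\<lambda>x Y z. dec z (\<lambda>z1 z2. H' a b c x Y z1 z2))) =
    pick X (\<lambda>w' X'. sign ((lie_deg w - 1) * (lie_deg w' - 1)) *
      dec w' (\<lambda>r p. sign (lie_deg p * gdeg (w # X')) * slices (r # w # X') (\<lambda>x Y z. H x Y z p)))"
  proof -
    have 2: "dec3 w (\<lambda>a b c. slices Z (\<lambda>x Y z. H' a b c x Y z p)) = slices (w # Z) (\<lambda>x Y z. H x Y z p)" for p Z
      unfolding slices.simps signed_field H'_def s_def ..
    have 3: "slices (r # w # X') (\<lambda>x Y z. H x Y z p) =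
      sign ((lie_deg r - 1) * (lie_deg w - 1)) * slices (w # r # X') (\<lambda>x Y z. H x Y z p)"
      for p r X'
      by (rule slices_commute_head) (rule block_symmetric_head[OF Cons.prems(2)])
    have "dec3 w (\<lambda>a b c. slices X (\<lambda>x Y z. dec z (\<lambda>z1 z2. H' a b c x Y z1 z2))) =
      dec3 w (\<lambda>a b c. pick X (\<lambda>w' X'. dec w' (\<lambda>r p. sign (lie_deg p * gdeg X') *
         slices (r # X') (\<lambda>x Y z. H' a b c x Y z p))))"
      by (subst Cons.IH[OF sf bs]) (rule refl)
    also have "\<dots> = pick X (\<lambda>w' X'. dec w' (\<lambda>r p. dec3 w (\<lambda>a b c. sign (lie_deg p * gdeg X') *
         slices (r # X') (\<lambda>x Y z. H' a b c x Y z p))))"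
      apply (subst pick_swap[OF additive_op_dec3, where F = "\<lambda>(x, Y, z) a1 a2. _ x Y z a1 a2", simplified])
      apply (subst dec_swap[OF additive_op_dec3, where F = "\<lambda>(x, Y, z) a1 a2. _ x Y z a1 a2", simplified])
      apply (rule refl)
      done
    also have "\<dots> = pick X (\<lambda>w' X'. sign ((lie_deg w - 1) * (lie_deg w' - 1)) * dec w' (\<lambda>r p.
        sign (lie_deg p * gdeg (w # X')) * slices (r # w # X') (\<lambda>x Y z. H x Y z p)))"
      unfolding dec3_push[symmetric] 2 3 op_push(2)
      apply (intro pick_ext dec_cong_deg[OF refl])
      apply (simp del: slices.simps)
      apply (simp add: algebra_simps sign_simps sign_mult_2 del: slices.simps)
      done
    finally show ?thesis .
  qed
  ultimately show ?case
    by simp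
qed

lemma op_diff:
  "shuf u w (\<lambda>x. F x - F' x) = shuf u w F - shuf u w F'"
  "dec w (\<lambda>x y. G x y - G' x y) = dec w G - dec w G'"
  "split_blocks X (\<lambda>I J. H I J - H' I J) = split_blocks X H - split_blocks X H'"
  "pick X (\<lambda>v Y. K v Y - K' v Y) = pick X K - pick X K'"
  "dec3 w (\<lambda>a b c. L a b c - L' a b c) = dec3 w L - dec3 w L'"
  "slices X (\<lambda>x Y z. M x Y z - M' x Y z) = slices X M - slices X M'"
  by (simp_all add: op_add op_minus diff_conv_add_uminus del: add_uminus_conv_diff)

lemmas op_simps = op_diff op_add op_push op_minus op_zero sign_simps sign_mult_2 algebra_simps

section \<open>Coassociativity and cocommutativity of splitting the blocks, and its interplay with
  \<open>pick\<close>\<close>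

lemma split_blocks_assoc: "split_blocks X (\<lambda>I R. split_blocks R (F I)) =
    (split_blocks X (\<lambda>P K. split_blocks P (\<lambda>I J. F I J K)) :: 'k::field)"
  by (induction X arbitrary: F) (simp_all add: op_simps)

lemma split_blocks_commute: "split_blocks X F =
    (split_blocks X (\<lambda>I J. sign (gdeg I * gdeg J) * F J I) :: 'k::field)"
proof (induction X arbitrary: F)
  case Nil
  show ?case by (simp add: sign_simps)
next
  case (Cons w X)
  show ?case
    using Cons.IH[of "\<lambda>I J. F (w # I) J"]
      Cons.IH[of "\<lambda>I J. sign ((lie_deg w - 1) * gdeg I) * F I (w # J)"]
    by (simp add: op_simps)
qed

lemma split_blocks_pick_right:
  "split_blocks X (\<lambda>I R. pick R (F I)) = (pick X (\<lambda>w X'. split_blocks X' (\<lambda>I R'.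
     sign ((lie_deg w - 1) * gdeg I) * F I w R')) :: 'k::field)"
  by (induction X arbitrary: F) (simp_all add: op_simps)

lemma split_blocks_pick_left:
  "split_blocks X (\<lambda>L R. pick L (\<lambda>w L'. F w L' R)) =
    (pick X (\<lambda>w X'. split_blocks X' (\<lambda>L' R. F w L' R)) :: 'k::field)"
  by (induction X arbitrary: F) (simp_all add: op_simps)

section \<open>Explicit coderivations\<close>

text \<open>
  Here \<open>g Y\<close> is the letter that a map to the cogenerators attaches to \<open>Y\<close>.  The coderivation with
  corestriction \<open>g\<close> applies \<open>lie_extension\<close> to part of the blocks, merging them into the single word
  \<open>x (g Y) z\<close>; this is dual to inserting the iterated brackets of a product
  \<open>g\<^sup>* a = b\<^sub>1 \<and> \<cdots> \<and> b\<^sub>t\<close> into a commutator, where the outer letters of the commutator are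
  distributed over \<open>b\<^sub>1, \<dots>, b\<^sub>t\<close> by the derivation rule.
\<close>

definition lie_extension ::
  "('v bword \<Rightarrow> 'v letter) \<Rightarrow> ('v lword \<Rightarrow> 'u::ab_group_add) \<Rightarrow> 'v bword \<Rightarrow> 'u" where
  "lie_extension g f X =
     (if X = [] then 0 else slices X (\<lambda>x Y z. f (x @ g Y # z)))"

definition extension ::
  "('v bword \<Rightarrow> 'v letter) \<Rightarrow> ('v bword \<Rightarrow> 'u::ab_group_add) \<Rightarrow> 'v bword \<Rightarrow> 'u" where
  "extension g F X = split_blocks X (\<lambda>X1 R. lie_extension g (\<lambda>v. F (v # R)) X1)"

text \<open>The value of \<open>B\<close> on \<open>cobracket X\<close>, by recursion instead of
  sums over index sets (see \<open>lin_ext_cobracket\<close>). Bringing \<open>w\<close> between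
  \<open>I\<close> and \<open>J\<close> costs \<open>(lie_deg w - 1) * gdeg I\<close>, moving
  \<open>u\<close> in front of \<open>I\<close> costs \<open>(lie_deg u - 1) * gdeg I\<close>;
  together this is \<open>gdeg I * lie_deg v\<close> modulo 2.\<close>

definition cobracket_sum ::
  "'v bword \<Rightarrow> ('v bword \<Rightarrow> 'v bword \<Rightarrow> 'k::field) \<Rightarrow> 'k" where
  "cobracket_sum X B = pick X (\<lambda>w X'. dec w (\<lambda>u v. split_blocks X' (\<lambda>I J.
     sign (gdeg I * lie_deg v) * B (u # I) (v # J) -
     sign (lie_deg u * lie_deg v + gdeg I * lie_deg u) * B (v # I) (u # J))))"

text \<open>The middle piece of a shuffle of \<open>u\<close> and \<open>w\<close> is itself a
  shuffle, killed by \<open>K\<close> unless it comes from one word only. The other word is then cut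
  into two pieces instead of three.\<close>

lemma shuf_dec3:
  fixes K :: "'v lword \<Rightarrow> 'v lword \<Rightarrow> 'v lword \<Rightarrow> 'k::field"
  assumes "\<And>a c p q. p \<noteq> [] \<Longrightarrow> q \<noteq> [] \<Longrightarrow> shuf p q (\<lambda>b. K a b c) = 0"
  shows "shuf u w (\<lambda>v. dec3 v K) =
    dec3 u (\<lambda>u1 u2 u3. dec w (\<lambda>w1 w3. sign (lie_deg w1 * (lie_deg u2 + lie_deg u3)) *
      shuf u1 w1 (\<lambda>a. shuf u3 w3 (K a u2)))) +
    dec3 w (\<lambda>w1 w2 w3. dec u (\<lambda>u1 u3. sign (lie_deg u3 * (lie_deg w1 + lie_deg w2)) *
      shuf u1 w1 (\<lambda>a. shuf u3 w3 (K a w2))))"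
proof -
  define K' where "K' a b c = (if b = [] then 0 else K a b c)" for a b c
  have sf: "shuffle_free (\<lambda>b. K' a b c)" for a c
  proof -
    have "shuf p q (\<lambda>b. K' a b c) = shuf p q (\<lambda>b. K a b c)" if "p \<noteq> []" for p q
      by (rule shuf_cong) (use that in \<open>auto simp: K'_def\<close>)
    then show ?thesis
      using assms by (simp add: shuffle_free_def K'_def)
  qed
  have "shuf u w (\<lambda>v. dec3 v K) = shuf u w (\<lambda>v. dec v (\<lambda>a r. dec r (K' a)))"
    by (simp add: dec3_def K'_def)
  also have "\<dots> = dec u (\<lambda>u1 ur. dec w (\<lambda>w1 wr. sign (lie_deg ur * lie_deg w1) *
      shuf u1 w1 (\<lambda>a. dec ur (\<lambda>u2 u3. shuf u3 wr (K' a u2)) +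
        dec wr (\<lambda>w2 w3. sign (lie_deg ur * lie_deg w2) * shuf ur w3 (K' a w2)))))"
    unfolding shuf_dec[where F = "\<lambda>a r. dec r (K' a)"]
    by (subst shuf_dec_left[OF sf]) (rule refl)
  also have "\<dots> = dec u (\<lambda>u1 ur. dec w (\<lambda>w1 wr. sign (lie_deg ur * lie_deg w1) *
        dec ur (\<lambda>u2 u3. shuf u1 w1 (\<lambda>a. shuf u3 wr (K' a u2))))) +
     dec u (\<lambda>u1 ur. dec w (\<lambda>w1 wr. dec wr (\<lambda>w2 w3. sign (lie_deg ur * lie_deg w1) *
        sign (lie_deg ur * lie_deg w2) * shuf u1 w1 (\<lambda>a. shuf ur w3 (K' a w2)))))"
    unfolding shuf_add distrib_left dec_add
    apply (subst dec_swap[OF additive_op_shuf])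
    apply (subst dec_swap[OF additive_op_shuf])
    apply (simp add: op_push mult.assoc)
    done
  also have "dec u (\<lambda>u1 ur. dec w (\<lambda>w1 wr. sign (lie_deg ur * lie_deg w1) *
        dec ur (\<lambda>u2 u3. shuf u1 w1 (\<lambda>a. shuf u3 wr (K' a u2))))) =
     dec u (\<lambda>u1 ur. dec ur (\<lambda>u2 u3. dec w (\<lambda>w1 wr. sign (lie_deg w1 * (lie_deg u2 + lie_deg u3)) *
        shuf u1 w1 (\<lambda>a. shuf u3 wr (K' a u2)))))"
    unfolding op_push(2)
    apply (rule dec_ext)
    apply (subst dec_swap[OF additive_op_dec, where F = "\<lambda>(x, y) a1 a2. _ x y a1 a2", simplified])
    apply (simp add: algebra_simps)
    done
  also have "\<dots> = dec3 u (\<lambda>u1 u2 u3. dec w (\<lambda>w1 w3. sign (lie_deg w1 * (lie_deg u2 + lie_deg u3)) *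
      shuf u1 w1 (\<lambda>a. shuf u3 w3 (K a u2))))"
    unfolding dec3_def K'_def by (intro dec_ext) (auto simp: op_zero)
  also have "dec u (\<lambda>u1 ur. dec w (\<lambda>w1 wr. dec wr (\<lambda>w2 w3. sign (lie_deg ur * lie_deg w1) *
        sign (lie_deg ur * lie_deg w2) * shuf u1 w1 (\<lambda>a. shuf ur w3 (K' a w2))))) =
    dec w (\<lambda>w1 wr. dec wr (\<lambda>w2 w3. dec u (\<lambda>u1 ur. sign (lie_deg ur * (lie_deg w1 + lie_deg w2)) *
       shuf u1 w1 (\<lambda>a. shuf ur w3 (K' a w2)))))"
    apply (subst dec_swap[OF additive_op_dec, where F = "\<lambda>(x, y) a1 a2. _ x y a1 a2", simplified])
    apply (rule dec_cong_deg[OF refl])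
    apply (subst dec_swap[OF additive_op_dec, where F = "\<lambda>(x, y) a1 a2. _ x y a1 a2", simplified])
    apply (simp add: algebra_simps sign_simps)
    done
  also have "\<dots> = dec3 w (\<lambda>w1 w2 w3. dec u (\<lambda>u1 u3. sign (lie_deg u3 * (lie_deg w1 + lie_deg w2)) *
      shuf u1 w1 (\<lambda>a. shuf u3 w3 (K a w2))))"
    unfolding dec3_def K'_def by (intro dec_ext) (auto simp: op_zero)
  finally show ?thesis .
qed

lemma shuf_rotate: "shuf u w (\<lambda>a. shuf a x F) =
    (sign (lie_deg u * lie_deg w) * shuf u x (\<lambda>p. shuf w p F) :: 'k::field)"
  using shuf_assoc[of u w x F] shuf_left_commute[of w x u F] by (simp add: sign_simps mult_ac)

lemma shuf_rotate2: "shuf u1 w1 (\<lambda>a. shuf u3 w3 (\<lambda>c. shuf a x (\<lambda>x'. shuf c z (K x')))) =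
    (sign (lie_deg u1 * lie_deg w1 + lie_deg u3 * lie_deg w3) *
      shuf u1 x (\<lambda>p. shuf u3 z (\<lambda>q. shuf w1 p (\<lambda>x'. shuf w3 q (K x')))) :: 'k::field)"
proof -
  have "shuf u1 w1 (\<lambda>a. shuf u3 w3 (\<lambda>c. shuf a x (\<lambda>x'. shuf c z (K x')))) =
     shuf u1 w1 (\<lambda>a. shuf a x (\<lambda>x'. shuf u3 w3 (\<lambda>c. shuf c z (K x'))))"
    by (intro shuf_ext shuf_swap) (rule additive_op_shuf)
  also have "\<dots> = sign (lie_deg u1 * lie_deg w1) * shuf u1 x (\<lambda>p. shuf w1 p (\<lambda>x'.
      sign (lie_deg u3 * lie_deg w3) * shuf u3 z (\<lambda>q. shuf w3 q (K x'))))"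
    unfolding shuf_rotate ..
  also have "\<dots> = sign (lie_deg u1 * lie_deg w1) * shuf u1 x (\<lambda>p.
      sign (lie_deg u3 * lie_deg w3) * shuf u3 z (\<lambda>q. shuf w1 p (\<lambda>x'. shuf w3 q (K x'))))"
    unfolding shuf_push[of "sign (lie_deg u3 * lie_deg w3)"]
    by (rule arg_cong[where f = "(*) _"], rule shuf_ext, rule shuf_swap) (rule additive_op_shuf)
  finally show ?thesis
    by (simp add: op_push sign_simps mult.assoc)
qed

text \<open>This makes the explicit formula well defined on the cofree Lie coalgebra. As the letter
  \<open>g (b # Y)\<close> is shuffle-free in \<open>b\<close> when seen through \<open>f\<close>,
  \<open>shuf_dec3\<close> leaves two sums, with the middle piece in \<open>u\<close> or in
  \<open>w\<close>; each of them vanishes.\<close>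

lemma lie_extension_shuffle:
  fixes f :: "'v lword \<Rightarrow> 'k::field"
  assumes g: "\<And>Y. letter_deg (g Y) = gdeg Y + 2"
    and f: "shuffle_free f"
    and fg: "\<And>x Y z. shuffle_free (\<lambda>b. f (x @ g (b # Y) # z))"
    and "u \<noteq> []" "w \<noteq> []"
  shows "shuf u w (\<lambda>v. lie_extension g f (v # X)) = 0"
proof -
  define K where "K a b c = slices X (\<lambda>x Y z. sign (lie_deg a + lie_deg x * (lie_deg b - 1 + lie_deg c) + gdeg Y * lie_deg c) *
     shuf a x (\<lambda>x'. shuf c z (\<lambda>z'. f (x' @ g (b # Y) # z'))))" for a b c
  have K0: "shuf p q (\<lambda>b. K a b c) = 0" if "p \<noteq> []" "q \<noteq> []" for a c p q
  proof -
    have "shuf p q (\<lambda>b. K a b c) = slices X (\<lambda>x Y z. sign (lie_deg a + lie_deg x * (lie_deg p + lie_deg q - 1 + lie_deg c) + gdeg Y * lie_deg c) *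
       shuf a x (\<lambda>x'. shuf c z (\<lambda>z'. shuf p q (\<lambda>b. f (x' @ g (b # Y) # z')))))"
      unfolding K_def
      apply (subst slices_swap[OF additive_op_shuf])
      apply (rule slices_ext)
      apply (simp add: op_push)
      apply (subst shuf_swap[OF additive_op_shuf, of p q a])
      apply (rule shuf_ext)
      apply (subst shuf_swap[OF additive_op_shuf, of p q c])
      apply (rule refl)
      done
    also have "\<dots> = 0"
      using fg that by (simp add: shuffle_free_def op_zero)
    finally show ?thesis .
  qed
  \<comment> \<open>With the middle piece \<open>u2\<close> in the new letter, the two pieces of
    \<open>w\<close> in front of and behind it add up, by \<open>shuf_marked\<close>, to all
    shuffles of \<open>w\<close> into \<open>p @ g (u2 # Y) # q\<close>. These are killed by
    \<open>f\<close>.\<close>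
  have main: "dec w (\<lambda>w1 w3. sign (lie_deg w1 * (lie_deg u2 + lie_deg u3)) *
      shuf u1 w1 (\<lambda>a. shuf u3 w3 (K a u2))) = 0" if "w \<noteq> []" for w u1 u2 u3
  proof -
    have "dec w (\<lambda>w1 w3. sign (lie_deg w1 * (lie_deg u2 + lie_deg u3)) * shuf u1 w1 (\<lambda>a. shuf u3 w3 (K a u2))) =
      slices X (\<lambda>x Y z. dec w (\<lambda>w1 w3. sign (lie_deg w1 * (lie_deg u2 + lie_deg u3)) *
        shuf u1 w1 (\<lambda>a. shuf u3 w3 (\<lambda>c. 
        sign (lie_deg a + lie_deg x * (lie_deg u2 - 1 + lie_deg c) + gdeg Y * lie_deg c) *
     shuf a x (\<lambda>x'. shuf c z (\<lambda>z'. f (x' @ g (u2 # Y) # z')))))))"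
      unfolding K_def op_push
      apply (subst slices_swap[OF additive_op_shuf])
      apply (subst slices_swap[OF additive_op_shuf])
      apply (subst slices_swap[OF additive_op_dec, where F = "\<lambda>(x, y) a1 a2 a3. _ x y a1 a2 a3", simplified])
      apply (rule refl)
      done
    also have "\<dots> = slices X (\<lambda>x Y z. sign (lie_deg u1 + lie_deg x * (lie_deg u2 - 1 + lie_deg u3) + gdeg Y * lie_deg u3 +
          lie_deg w * (lie_deg u1 + lie_deg u2 + lie_deg u3 + 1)) * dec w (\<lambda>w1 w3. 
        shuf u1 x (\<lambda>p. shuf u3 z (\<lambda>q. sign (lie_deg w3 * (lie_deg p + letter_deg (g (u2 # Y)))) * shuf w1 p (\<lambda>x'. shuf w3 q (\<lambda>z'. f (x' @ g (u2 # Y) # z')))))))"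
      apply (rule slices_ext)
      unfolding op_push
      apply (rule dec_cong_deg[OF refl])
      apply (simp add: g op_simps)
      apply (subst shuf_rotate2)
      apply (simp add: op_simps)
      done
    also have "\<dots> = 0"
    proof -
      have "dec w (\<lambda>w1 w3. shuf u1 x (\<lambda>p. shuf u3 z (\<lambda>q. sign (lie_deg w3 * (lie_deg p + letter_deg (g (u2 # Y)))) *
        shuf w1 p (\<lambda>x'. shuf w3 q (\<lambda>z'. f (x' @ g (u2 # Y) # z')))))) =
        shuf u1 x (\<lambda>p. shuf u3 z (\<lambda>q. shuf w (p @ g (u2 # Y) # q) f))" for x Y z
        unfolding shuf_marked
        apply (subst dec_swap[OF additive_op_shuf])
        apply (subst dec_swap[OF additive_op_shuf])
        apply (rule refl)
        done
      then show ?thesis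
        using f that by (simp add: shuffle_free_def op_zero)
    qed
    finally show ?thesis .
  qed
  have main2: "dec u (\<lambda>u1 u3. sign (lie_deg u3 * (lie_deg w1 + lie_deg w2)) *
      shuf u1 w1 (\<lambda>a. shuf u3 w3 (K a w2))) = 0" if "u \<noteq> []" for u w1 w2 w3
  proof -
    have "dec u (\<lambda>u1 u3. sign (lie_deg u3 * (lie_deg w1 + lie_deg w2)) * shuf u1 w1 (\<lambda>a. shuf u3 w3 (K a w2))) =
       sign (lie_deg u * (lie_deg w1 + lie_deg w2 + lie_deg w3)) * dec u (\<lambda>u1 u3.
        sign (lie_deg u1 * (lie_deg w2 + lie_deg w3)) * shuf w1 u1 (\<lambda>a. shuf w3 u3 (K a w2)))"
      unfolding shuf_commute[of _ w1] shuf_commute[of _ w3]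
      apply (simp only: op_push)
      apply (rule dec_cong_deg[OF refl])
      apply (simp add: op_simps)
      done
    then show ?thesis
      using main[OF that] by simp
  qed
  have "shuf u w (\<lambda>v. lie_extension g f (v # X)) = shuf u w (\<lambda>v. dec3 v K)"
    by (simp add: lie_extension_def K_def)
  also have "\<dots> = 0"
    using main[OF \<open>w \<noteq> []\<close>] main2[OF \<open>u \<noteq> []\<close>] by (simp add: shuf_dec3[OF K0] op_zero)
  finally show ?thesis .
qed

text \<open>The word \<open>x @ g Y # z\<close> is cut inside \<open>x\<close> or inside
  \<open>z\<close>. The letters separated from the new one then come from one original block
  \<open>p @ r\<close>, and the extension acts on the rest of that block.\<close>

lemma lie_extension_dec:
  fixes B :: "'v lword \<Rightarrow> 'v lword \<Rightarrow> 'k::field"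
  assumes "\<And>y. shuffle_free (\<lambda>x. B x y)" "\<And>x. shuffle_free (B x)"
    and "\<And>x y z. block_symmetric (\<lambda>Y. B (x @ g Y # y) z)"
    and "\<And>x y z. block_symmetric (\<lambda>Y. B x (y @ g Y # z))"
  shows "lie_extension g (\<lambda>v. dec v B) X = pick X (\<lambda>w X'. dec w (\<lambda>p r.
     sign (lie_deg p) * lie_extension g (B p) (r # X') + sign (lie_deg r * gdeg X') * lie_extension g (\<lambda>v. B v r) (p # X')))"
proof (cases "X = []")
  case False
  have "lie_extension g (\<lambda>v. dec v B) X =
     slices X (\<lambda>x Y z. dec x (\<lambda>x1 x2. B x1 (x2 @ g Y # z))) +
     slices X (\<lambda>x Y z. dec z (\<lambda>z1 z2. B (x @ g Y # z1) z2))"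
    using False by (simp add: lie_extension_def dec_marked slices_add)
  then show ?thesis
    unfolding slices_dec_left[where H = "\<lambda>p x Y z. B p (x @ g Y # z)", OF assms(1,4)]
      slices_dec_right[where H = "\<lambda>x Y z p. B (x @ g Y # z) p", OF assms(2,3)]
      lie_extension_def
    by (simp add: pick_add dec_add del: slices.simps)
qed (simp add: lie_extension_def)

lemma lie_extension_add: "lie_extension g (\<lambda>v. F v + G v) X = lie_extension g F X + lie_extension g G X"
  by (simp add: lie_extension_def slices_add del: slices.simps)

lemma additive_op_lie_extension: "additive_op (\<lambda>F. lie_extension g (\<lambda>v. F v) X)"
  by (simp add: additive_op_def lie_extension_add)

lemma lie_extension_hom: "additive_fun f \<Longrightarrow> f (lie_extension g F X) = lie_extension g (\<lambda>v. f (F v)) X"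
  by (simp add: lie_extension_def slices_hom additive_fun_0 del: slices.simps)

lemma lie_extension_push: "(c::'k::field) * lie_extension g F X = lie_extension g (\<lambda>v. c * F v) X"
  by (rule lie_extension_hom) (simp add: additive_fun_def algebra_simps)

lemma lie_extension_minus: "lie_extension g (\<lambda>v. - F v) X = - lie_extension g F X"
  by (simp add: lie_extension_hom[OF additive_fun_uminus])

lemma lie_extension_diff: "lie_extension g (\<lambda>v. F v - G v) X = lie_extension g F X - lie_extension g G X"
  by (simp add: lie_extension_add lie_extension_minus diff_conv_add_uminus del: add_uminus_conv_diff)

lemma lie_extension_zero: "lie_extension g (\<lambda>v. 0) X = 0"
  by (simp add: additive_op_0[OF additive_op_lie_extension])

lemma extension_add: "extension g (\<lambda>v. F v + G v) X = extension g F X + extension g G X"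
  by (simp add: extension_def lie_extension_add split_blocks_add del: split_blocks.simps)

lemma additive_op_extension: "additive_op (\<lambda>F. extension g (\<lambda>v. F v) X)"
  by (simp add: additive_op_def extension_add)

lemma extension_hom: "additive_fun f \<Longrightarrow> f (extension g F X) = extension g (\<lambda>v. f (F v)) X"
  by (simp add: extension_def split_blocks_hom lie_extension_hom del: split_blocks.simps)

text \<open>A coderivation has degree 1, and a one-letter block lies one below its letter:
  \<open>letter_deg (g Y) - 1 = gdeg Y + 1\<close>.\<close>

definition degree_compatible :: "('v bword \<Rightarrow> 'v letter) \<Rightarrow> bool" where
  "degree_compatible g \<longleftrightarrow> (\<forall>Y. letter_deg (g Y) = gdeg Y + 2)"

lemma lie_extension_cong:
  assumes "degree_compatible g"
    and "\<And>v. lie_deg v = gdeg X + 2 \<Longrightarrow> F v = G v"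
  shows "lie_extension g F X = lie_extension g G X"
proof -
  have "slices X (\<lambda>x Y z. F (x @ g Y # z)) = slices X (\<lambda>x Y z. G (x @ g Y # z))"
    by (rule slices_cong_deg[OF refl], rule assms(2))
      (use assms(1) in \<open>simp add: degree_compatible_def\<close>)
  then show ?thesis
    by (simp add: lie_extension_def)
qed

text \<open>Common normal form for both coderivation rules: the new letter is made from blocks in
  \<open>K\<close>, while \<open>I\<close> and \<open>J\<close> go untouched to the left and right
  factor.\<close>

definition split_blocks3 ::
  "'v bword \<Rightarrow> ('v bword \<Rightarrow> 'v bword \<Rightarrow> 'v bword \<Rightarrow> 'k::field) \<Rightarrow> 'k" where
  "split_blocks3 X F = split_blocks X (\<lambda>K R. split_blocks R (F K))"

lemma split_blocks3_left: "split_blocks X (\<lambda>A J. split_blocks A (\<lambda>K I. F K I J)) = split_blocks3 X F"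
  by (simp add: split_blocks3_def split_blocks_assoc)

lemma split_blocks3_right: "split_blocks X (\<lambda>I R. split_blocks R (\<lambda>K J. F K I J)) =
    split_blocks3 X (\<lambda>K I J. sign (gdeg K * gdeg I) * F K I J)"
  unfolding split_blocks3_def split_blocks_assoc
  by (subst (2) split_blocks_commute) (simp add: algebra_simps sign_simps)

lemma split_blocks3_add: "split_blocks3 X (\<lambda>K I J. F K I J + G K I J) = split_blocks3 X F + split_blocks3 X G"
  by (simp add: split_blocks3_def op_add)

lemma split_blocks3_minus: "split_blocks3 X (\<lambda>K I J. - F K I J) = - split_blocks3 X F"
  by (simp add: split_blocks3_def op_minus)

lemma split_blocks3_diff: "split_blocks3 X (\<lambda>K I J. F K I J - G K I J) = split_blocks3 X F - split_blocks3 X G"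
  by (simp add: split_blocks3_def op_diff)

lemma split_blocks3_push: "(c::'k::field) * split_blocks3 X F = split_blocks3 X (\<lambda>K I J. c * F K I J)"
  by (simp add: split_blocks3_def op_push)

lemmas split_blocks3_simps = split_blocks3_add split_blocks3_minus split_blocks3_diff split_blocks3_push

lemma split_blocks_lie_extension:
  "lie_extension g (\<lambda>v. split_blocks R (F v)) X = split_blocks R (\<lambda>I J. lie_extension g (\<lambda>v. F v I J) X)"
  by (rule split_blocks_swap[OF additive_op_lie_extension])

text \<open>The merged word belongs to the left or to the right factor, which gives the two terms;
  putting \<open>K\<close> after \<open>I\<close> in the second case produces the Koszul
  sign.\<close>

lemma extension_split_blocks:
  fixes B :: "'v bword \<Rightarrow> 'v bword \<Rightarrow> 'k::field"
  assumes g: "degree_compatible g"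
  shows "extension g (\<lambda>Z. split_blocks Z B) X = split_blocks X (\<lambda>Y Z.
     extension g (\<lambda>Y'. B Y' Z) Y + sign (gdeg Y) * extension g (B Y) Z)"
proof -
  have "lie_extension g (\<lambda>v. split_blocks (v # R) B) K = split_blocks R (\<lambda>I J.
     lie_extension g (\<lambda>v. B (v # I) J) K + sign ((gdeg K + 1) * gdeg I) * lie_extension g (\<lambda>v. B I (v # J)) K)" for K R
  proof -
    have "lie_extension g (\<lambda>v. split_blocks (v # R) B) K = lie_extension g (\<lambda>v. split_blocks R (\<lambda>I J.
      B (v # I) J + sign ((gdeg K + 1) * gdeg I) * B I (v # J))) K"
      by (rule lie_extension_cong[OF g]) (simp add: op_add add.commute)
    then show ?thesis
      by (simp add: split_blocks_lie_extension lie_extension_add lie_extension_push)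
  qed
  then have "extension g (\<lambda>Z. split_blocks Z B) X = split_blocks3 X (\<lambda>K I J. 
     lie_extension g (\<lambda>v. B (v # I) J) K + sign ((gdeg K + 1) * gdeg I) * lie_extension g (\<lambda>v. B I (v # J)) K)"
    by (simp add: extension_def split_blocks3_def)
  moreover have "split_blocks X (\<lambda>Y Z. extension g (\<lambda>Y'. B Y' Z) Y) =
     split_blocks3 X (\<lambda>K I J. lie_extension g (\<lambda>v. B (v # I) J) K)"
    unfolding extension_def by (rule split_blocks3_left)
  moreover have "split_blocks X (\<lambda>Y Z. sign (gdeg Y) * extension g (B Y) Z) =
     split_blocks3 X (\<lambda>K I J. sign (gdeg K * gdeg I) * (sign (gdeg I) * lie_extension g (\<lambda>v. B I (v # J)) K))"
    unfolding extension_def op_push by (rule split_blocks3_right)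
  ultimately show ?thesis
    by (simp add: split_blocks_add split_blocks3_add algebra_simps sign_simps)
qed

text \<open>The first four conditions let \<open>B\<close> descend to pairs of coalgebra elements.
  The last two say that \<open>g\<close> respects graded commutativity of its argument, as far as
  \<open>B\<close> can see.\<close>

definition bilinear_functional ::
  "('v bword \<Rightarrow> 'v letter) \<Rightarrow> ('v bword \<Rightarrow> 'v bword \<Rightarrow> 'k::field) \<Rightarrow> bool" where
  "bilinear_functional g B \<longleftrightarrow>
     (\<forall>Z. block_symmetric (\<lambda>Y. B Y Z)) \<and> (\<forall>Y. block_symmetric (B Y)) \<and>
     (\<forall>R Z. shuffle_free (\<lambda>w. B (w # R) Z)) \<and> (\<forall>Y R. shuffle_free (\<lambda>w. B Y (w # R))) \<and>
     (\<forall>x z R Z. block_symmetric (\<lambda>Y. B ((x @ g Y # z) # R) Z)) \<and>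
     (\<forall>x z R Z. block_symmetric (\<lambda>Y. B Z ((x @ g Y # z) # R)))"

lemma shuffle_free_split_blocks:
  fixes H :: "'v lword \<Rightarrow> 'w bword \<Rightarrow> 'w bword \<Rightarrow> 'k::field"
  assumes "\<And>I J. shuffle_free (\<lambda>x. H x I J)"
  shows "shuffle_free (\<lambda>x. split_blocks R (H x))"
proof -
  have "shuf p q (\<lambda>x. split_blocks R (H x)) = split_blocks R (\<lambda>I J. shuf p q (\<lambda>x. H x I J))" for p q
    by (rule split_blocks_swap[OF additive_op_shuf])
  then show ?thesis
    using assms by (simp add: shuffle_free_def op_zero)
qed

lemma shuffle_free_diff: "shuffle_free f \<Longrightarrow> shuffle_free h \<Longrightarrow> shuffle_free (\<lambda>x. f x - h x)"
  by (simp add: shuffle_free_def op_diff)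

lemma block_symmetric_diff: "block_symmetric f \<Longrightarrow> block_symmetric h \<Longrightarrow> block_symmetric (\<lambda>x. f x - h x)"
  unfolding block_symmetric_def by (metis right_diff_distrib)

lemma block_symmetric_signed: "block_symmetric F \<Longrightarrow> block_symmetric (\<lambda>X. sign (d + e * gdeg X) * F X)"
  unfolding block_symmetric_def
proof (intro allI)
  fix X u w Y
  assume *: "\<forall>X u w Y. F (X @ u # w # Y) = sign ((lie_deg u - 1) * (lie_deg w - 1)) * F (X @ w # u # Y)"
  show "sign (d + e * gdeg (X @ u # w # Y)) * F (X @ u # w # Y) =
    sign ((lie_deg u - 1) * (lie_deg w - 1)) * (sign (d + e * gdeg (X @ w # u # Y)) * F (X @ w # u # Y))"
    by (subst *[rule_format]) (simp add: algebra_simps)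
qed

lemma shuffle_free_signedI:
  assumes "shuffle_free f" "\<And>x. c x = d + e * lie_deg x"
  shows "shuffle_free (\<lambda>x. sign (c x) * f x)"
  unfolding assms(2) by (rule shuffle_free_signed[OF assms(1)])

lemma block_symmetric_signedI:
  assumes "block_symmetric f" "\<And>x. c x = d + e * gdeg x"
  shows "block_symmetric (\<lambda>x. sign (c x) * f x)"
  unfolding assms(2) by (rule block_symmetric_signed[OF assms(1)])

lemma block_symmetric_split_blocks:
  assumes "\<And>I J. block_symmetric (\<lambda>x. H x I J)"
  shows "block_symmetric (\<lambda>x. split_blocks R (H x))"
  unfolding block_symmetric_def
proof (intro allI)
  fix X u w Y
  have e: "H (X @ u # w # Y) = (\<lambda>I J. sign ((lie_deg u - 1) * (lie_deg w - 1)) * H (X @ w # u # Y) I J)"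
    using block_symmetricD[OF assms] by blast
  show "split_blocks R (H (X @ u # w # Y)) =
    sign ((lie_deg u - 1) * (lie_deg w - 1)) * split_blocks R (H (X @ w # u # Y))"
    unfolding e op_push ..
qed

lemma extension_cobracket_sum:
  fixes B :: "'v bword \<Rightarrow> 'v bword \<Rightarrow> 'k::field"
  assumes g: "degree_compatible g" and B: "bilinear_functional g B"
  shows "extension g (\<lambda>Z. cobracket_sum Z B) X = cobracket_sum X (\<lambda>Y Z.
     extension g (\<lambda>Y'. B Y' Z) Y + sign (gdeg Y + 1) * extension g (B Y) Z)"
proof -
  note gd = g[unfolded degree_compatible_def, rule_format]
  have B1: "block_symmetric (\<lambda>Y. B Y Z)" and B2: "block_symmetric (B Y)"
    and B3: "shuffle_free (\<lambda>w. B (w # R) Z)" and B4: "shuffle_free (\<lambda>w. B Y (w # R))"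
    and B5: "block_symmetric (\<lambda>Y. B ((x @ g Y # z) # R) Z)"
    and B6: "block_symmetric (\<lambda>Y. B Z ((x @ g Y # z) # R))" for Y Z R x z
    using B unfolding bilinear_functional_def by blast+
  define T where "T u v R = split_blocks R (\<lambda>I J. sign (gdeg I * lie_deg v) * B (u # I) (v # J) -
     sign (lie_deg u * lie_deg v + gdeg I * lie_deg u) * B (v # I) (u # J))" for u v R
  let ?L = "lie_extension g"
  have T1: "shuffle_free (\<lambda>x. T x y R)" for y R
    unfolding T_def
  proof (intro shuffle_free_split_blocks shuffle_free_diff)
    fix I J
    show "shuffle_free (\<lambda>x. sign (gdeg I * lie_deg y) * B (x # I) (y # J))"
      by (rule shuffle_free_signedI[OF B3, where d = "gdeg I * lie_deg y" and e = 0]) simp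
    show "shuffle_free (\<lambda>x. sign (lie_deg x * lie_deg y + gdeg I * lie_deg x) * B (y # I) (x # J))"
      by (rule shuffle_free_signedI[OF B4, where d = 0 and e = "lie_deg y + gdeg I"]) (simp add: algebra_simps)
  qed
  have T2: "shuffle_free (\<lambda>y. T x y R)" for x R
    unfolding T_def
  proof (intro shuffle_free_split_blocks shuffle_free_diff)
    fix I J
    show "shuffle_free (\<lambda>y. sign (gdeg I * lie_deg y) * B (x # I) (y # J))"
      by (rule shuffle_free_signedI[OF B4, where d = 0 and e = "gdeg I"]) simp
    show "shuffle_free (\<lambda>y. sign (lie_deg x * lie_deg y + gdeg I * lie_deg x) * B (y # I) (x # J))"
      by (rule shuffle_free_signedI[OF B3, where d = "gdeg I * lie_deg x" and e = "lie_deg x"]) (simp add: algebra_simps)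
  qed
  have T3: "block_symmetric (\<lambda>Y. T (x @ g Y # y) z R)" for x y z R
    unfolding T_def
  proof (intro block_symmetric_split_blocks block_symmetric_diff)
    fix I J
    show "block_symmetric (\<lambda>Y. sign (gdeg I * lie_deg z) * B ((x @ g Y # y) # I) (z # J))"
      by (rule block_symmetric_signedI[OF B5, where d = "gdeg I * lie_deg z" and e = 0]) simp
    show "block_symmetric (\<lambda>Y. sign (lie_deg (x @ g Y # y) * lie_deg z + gdeg I * lie_deg (x @ g Y # y)) *
        B (z # I) ((x @ g Y # y) # J))"
      by (rule block_symmetric_signedI[OF B6, where d = "(lie_deg x + lie_deg y + 2) * (lie_deg z + gdeg I)"
            and e = "lie_deg z + gdeg I"]) (simp add: algebra_simps gd)
  qed
  have T4: "block_symmetric (\<lambda>Y. T x (y @ g Y # z) R)" for x y z R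
    unfolding T_def
  proof (intro block_symmetric_split_blocks block_symmetric_diff)
    fix I J
    show "block_symmetric (\<lambda>Y. sign (gdeg I * lie_deg (y @ g Y # z)) * B (x # I) ((y @ g Y # z) # J))"
      by (rule block_symmetric_signedI[OF B6, where d = "gdeg I * (lie_deg y + lie_deg z + 2)" and e = "gdeg I"])
        (simp add: algebra_simps gd)
    show "block_symmetric (\<lambda>Y. sign (lie_deg x * lie_deg (y @ g Y # z) + gdeg I * lie_deg x) *
        B ((y @ g Y # z) # I) (x # J))"
      by (rule block_symmetric_signedI[OF B5, where d = "(lie_deg y + lie_deg z + 2 + gdeg I) * lie_deg x"
            and e = "lie_deg x"]) (simp add: algebra_simps gd)
  qed
  \<comment> \<open>Either the merged word \<open>v\<close> is the one that is cut, or it is another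
    block \<open>w\<close>, which first has to pass \<open>v\<close>.\<close>
  have c: "?L (\<lambda>v. cobracket_sum (v # R) B) K = ?L (\<lambda>v. dec v (\<lambda>p r. T p r R)) K +
    pick R (\<lambda>w R'. ?L (\<lambda>v. sign ((gdeg K + 1) * (lie_deg w - 1)) * dec w (\<lambda>p r. T p r (v # R'))) K)" for R K
  proof -
    have "?L (\<lambda>v. cobracket_sum (v # R) B) K = ?L (\<lambda>v. dec v (\<lambda>p r. T p r R) +
       pick R (\<lambda>w R'. sign ((gdeg K + 1) * (lie_deg w - 1)) * dec w (\<lambda>p r. T p r (v # R')))) K"
      by (rule lie_extension_cong[OF g]) (simp add: cobracket_sum_def T_def add.commute)
    then show ?thesis
      by (simp add: lie_extension_add pick_swap[OF additive_op_lie_extension])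
  qed
  have "extension g (\<lambda>Z. cobracket_sum Z B) X = split_blocks X (\<lambda>K R. ?L (\<lambda>v. dec v (\<lambda>p r. T p r R)) K) +
    split_blocks X (\<lambda>K R. pick R (\<lambda>w R'. ?L (\<lambda>v. sign ((gdeg K + 1) * (lie_deg w - 1)) * dec w (\<lambda>p r. T p r (v # R'))) K))"
    unfolding extension_def c split_blocks_add ..
  also have "split_blocks X (\<lambda>K R. ?L (\<lambda>v. dec v (\<lambda>p r. T p r R)) K) =
     pick X (\<lambda>w X'. dec w (\<lambda>p r. split_blocks X' (\<lambda>K R.
     sign (lie_deg p) * ?L (\<lambda>v. T p v R) (r # K) + sign (lie_deg r * gdeg K) * ?L (\<lambda>v. T v r R) (p # K))))"
    unfolding lie_extension_dec[OF T1 T2 T3 T4]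
      split_blocks_pick_left[where F = "\<lambda>w K R. dec w (\<lambda>p r. sign (lie_deg p) * ?L (\<lambda>v. T p v R) (r # K) +
         sign (lie_deg r * gdeg K) * ?L (\<lambda>v. T v r R) (p # K))"]
    by (subst dec_swap[OF additive_op_split_blocks, where F = "\<lambda>(x, y) a1 a2. _ x y a1 a2", simplified]) (rule refl)
  also have "split_blocks X (\<lambda>K R. pick R (\<lambda>w R'. ?L (\<lambda>v. sign ((gdeg K + 1) * (lie_deg w - 1)) * dec w (\<lambda>p r. T p r (v # R'))) K)) =
     pick X (\<lambda>w X'. dec w (\<lambda>p r. split_blocks X' (\<lambda>K R. sign (lie_deg w - 1) * ?L (\<lambda>v. T p r (v # R)) K)))"
    unfolding split_blocks_pick_right
    apply (rule pick_ext)
    apply (simp only: op_push)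
    apply (subst dec_swap[OF additive_op_lie_extension])
    apply (simp only: op_push lie_extension_push)
    apply (subst dec_swap[OF additive_op_split_blocks, where F = "\<lambda>(x, y) a1 a2. _ x y a1 a2", simplified])
    apply (intro dec_ext split_blocks_ext arg_cong2[where f = "lie_extension g"] refl ext)
    apply (simp add: op_simps)
    done
  also have "pick X (\<lambda>w X'. dec w (\<lambda>p r. split_blocks X' (\<lambda>K R.
     sign (lie_deg p) * ?L (\<lambda>v. T p v R) (r # K) + sign (lie_deg r * gdeg K) * ?L (\<lambda>v. T v r R) (p # K)))) +
     pick X (\<lambda>w X'. dec w (\<lambda>p r. split_blocks X' (\<lambda>K R. sign (lie_deg w - 1) * ?L (\<lambda>v. T p r (v # R)) K))) =
     pick X (\<lambda>w X'. dec w (\<lambda>p r. split_blocks X' (\<lambda>I J.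
     sign (gdeg I * lie_deg r) * (extension g (\<lambda>Y'. B Y' (r # J)) (p # I) + sign (lie_deg p + gdeg I) * extension g (B (p # I)) (r # J)) -
     sign (lie_deg p * lie_deg r + gdeg I * lie_deg p) * (extension g (\<lambda>Y'. B Y' (p # J)) (r # I) + sign (lie_deg r + gdeg I) * extension g (B (r # I)) (p # J)))))"
  proof -
    \<comment> \<open>In \<open>L1\<close> and \<open>L2\<close> the block \<open>p @ r\<close> is
      cut and the new letter lies in the word containing \<open>r\<close> or \<open>p\<close>. In
      \<open>L3\<close> the new letter is in neither piece and its word joins one of the two
      factors. \<open>R1\<close> to \<open>R3\<close> bring the right-hand side into the same sums
      over \<open>K\<close>, \<open>I\<close>, \<open>J\<close>.\<close>
    have L1: "split_blocks X' (\<lambda>K R. sign (lie_deg p) * ?L (\<lambda>v. T p v R) (r # K)) =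
      split_blocks3 X' (\<lambda>K I J. sign (lie_deg p) * 
        (sign (gdeg I * (lie_deg r + gdeg K + 1)) * ?L (\<lambda>v. B (p # I) (v # J)) (r # K) -
         sign (lie_deg p * (lie_deg r + gdeg K + 1) + gdeg I * lie_deg p) * ?L (\<lambda>v. B (v # I) (p # J)) (r # K)))"
      for X' p r
    proof -
      have "?L (\<lambda>v. T p v R) (r # K) = ?L (\<lambda>v. split_blocks R (\<lambda>I J.
        sign (gdeg I * (lie_deg r + gdeg K + 1)) * B (p # I) (v # J) -
        sign (lie_deg p * (lie_deg r + gdeg K + 1) + gdeg I * lie_deg p) * B (v # I) (p # J))) (r # K)" for K R
        by (rule lie_extension_cong[OF g]) (simp add: T_def algebra_simps)
      then show ?thesis
        by (simp add: split_blocks3_def split_blocks_lie_extension lie_extension_diff lie_extension_push op_push)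
    qed
    have L2: "split_blocks X' (\<lambda>K R. sign (lie_deg r * gdeg K) * ?L (\<lambda>v. T v r R) (p # K)) =
      split_blocks3 X' (\<lambda>K I J. sign (lie_deg r * gdeg K) * 
        (sign (gdeg I * lie_deg r) * ?L (\<lambda>v. B (v # I) (r # J)) (p # K) -
         sign ((lie_deg p + gdeg K + 1) * lie_deg r + gdeg I * (lie_deg p + gdeg K + 1)) * ?L (\<lambda>v. B (r # I) (v # J)) (p # K)))"
      for X' p r
    proof -
      have "?L (\<lambda>v. T v r R) (p # K) = ?L (\<lambda>v. split_blocks R (\<lambda>I J.
        sign (gdeg I * lie_deg r) * B (v # I) (r # J) -
        sign ((lie_deg p + gdeg K + 1) * lie_deg r + gdeg I * (lie_deg p + gdeg K + 1)) * B (r # I) (v # J))) (p # K)" for K R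
        by (rule lie_extension_cong[OF g]) (simp add: T_def algebra_simps)
      then show ?thesis
        by (simp add: split_blocks3_def split_blocks_lie_extension lie_extension_diff lie_extension_push op_push)
    qed
    have L3: "split_blocks X' (\<lambda>K R. ?L (\<lambda>v. T p r (v # R)) K) =
      split_blocks3 X' (\<lambda>K I J.
        sign ((gdeg K + 1 + gdeg I) * lie_deg r + (lie_deg p - 1) * (gdeg K + 1)) * ?L (\<lambda>v. B (v # p # I) (r # J)) K -
        sign (lie_deg p * lie_deg r + (gdeg K + 1 + gdeg I) * lie_deg p + (lie_deg r - 1) * (gdeg K + 1)) *
          ?L (\<lambda>v. B (v # r # I) (p # J)) K +
        sign ((gdeg K + 1) * gdeg I) * (
        sign (gdeg I * lie_deg r + (lie_deg r - 1) * (gdeg K + 1)) * ?L (\<lambda>v. B (p # I) (v # r # J)) K -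
        sign (lie_deg p * lie_deg r + gdeg I * lie_deg p + (lie_deg p - 1) * (gdeg K + 1)) *
          ?L (\<lambda>v. B (r # I) (v # p # J)) K))"
      for X' p r
    proof -
      have "?L (\<lambda>v. T p r (v # R)) K = ?L (\<lambda>v. split_blocks R (\<lambda>I J.
        sign ((gdeg K + 1 + gdeg I) * lie_deg r + (lie_deg p - 1) * (gdeg K + 1)) * B (v # p # I) (r # J) -
        sign (lie_deg p * lie_deg r + (gdeg K + 1 + gdeg I) * lie_deg p + (lie_deg r - 1) * (gdeg K + 1)) *
          B (v # r # I) (p # J) +
        sign ((gdeg K + 1) * gdeg I) * (
        sign (gdeg I * lie_deg r + (lie_deg r - 1) * (gdeg K + 1)) * B (p # I) (v # r # J) -
        sign (lie_deg p * lie_deg r + gdeg I * lie_deg p + (lie_deg p - 1) * (gdeg K + 1)) *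
          B (r # I) (v # p # J)))) K" for K R
      proof (rule lie_extension_cong[OF g])
        fix v :: "'v lword"
        assume v: "lie_deg v = gdeg K + 2"
        have e: "B (p # v # I) Z = sign ((lie_deg p - 1) * (lie_deg v - 1)) * B (v # p # I) Z"
          "B (r # v # I) Z = sign ((lie_deg r - 1) * (lie_deg v - 1)) * B (v # r # I) Z"
          "B Z (p # v # I) = sign ((lie_deg p - 1) * (lie_deg v - 1)) * B Z (v # p # I)"
          "B Z (r # v # I) = sign ((lie_deg r - 1) * (lie_deg v - 1)) * B Z (v # r # I)" for I Z
          by (rule block_symmetric_head[OF B1] block_symmetric_head[OF B2])+
        show "T p r (v # R) = split_blocks R (\<lambda>I J.
        sign ((gdeg K + 1 + gdeg I) * lie_deg r + (lie_deg p - 1) * (gdeg K + 1)) * B (v # p # I) (r # J) -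
        sign (lie_deg p * lie_deg r + (gdeg K + 1 + gdeg I) * lie_deg p + (lie_deg r - 1) * (gdeg K + 1)) *
          B (v # r # I) (p # J) +
        sign ((gdeg K + 1) * gdeg I) * (
        sign (gdeg I * lie_deg r + (lie_deg r - 1) * (gdeg K + 1)) * B (p # I) (v # r # J) -
        sign (lie_deg p * lie_deg r + gdeg I * lie_deg p + (lie_deg p - 1) * (gdeg K + 1)) *
          B (r # I) (v # p # J)))"
          unfolding T_def split_blocks.simps op_add(3)[symmetric]
          by (rule split_blocks_ext) (simp add: e v, simp add: op_simps)
      qed
      then show ?thesis
        by (simp add: split_blocks3_def split_blocks_lie_extension lie_extension_diff lie_extension_add lie_extension_push op_push
          right_diff_distrib)
    qed
    have R1: "split_blocks X' (\<lambda>I J. sign (gdeg I * lie_deg r) * extension g (\<lambda>Y'. B Y' (r # J)) (p # I)) =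
      split_blocks3 X' (\<lambda>K I J. sign ((gdeg K + gdeg I) * lie_deg r) *
        (?L (\<lambda>v. B (v # I) (r # J)) (p # K) + sign ((lie_deg p - 1) * gdeg K) * ?L (\<lambda>v. B (v # p # I) (r # J)) K))"
      for X' p r
      unfolding extension_def split_blocks3_left[symmetric]
      by (simp add: op_push op_add distrib_left)
    have R2: "split_blocks X' (\<lambda>I J. sign (gdeg I * lie_deg r) * (sign (lie_deg p + gdeg I) * extension g (B (p # I)) (r # J))) =
      split_blocks3 X' (\<lambda>K I J. sign (gdeg K * gdeg I) * (sign (gdeg I * lie_deg r) * (sign (lie_deg p + gdeg I) *
        (?L (\<lambda>v. B (p # I) (v # J)) (r # K) + sign ((lie_deg r - 1) * gdeg K) * ?L (\<lambda>v. B (p # I) (v # r # J)) K))))"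
      for X' p r
      unfolding extension_def split_blocks3_right[symmetric]
      by (simp add: op_push op_add distrib_left)
    have R3: "split_blocks X' (\<lambda>I J. sign (lie_deg p * lie_deg r + gdeg I * lie_deg p) * (extension g (\<lambda>Y'. B Y' (p # J)) (r # I) +
          sign (lie_deg r + gdeg I) * extension g (B (r # I)) (p # J))) = 
       sign (lie_deg p * lie_deg r) * (split_blocks X' (\<lambda>I J. sign (gdeg I * lie_deg p) * extension g (\<lambda>Y'. B Y' (p # J)) (r # I)) +
       split_blocks X' (\<lambda>I J. sign (gdeg I * lie_deg p) * (sign (lie_deg r + gdeg I) * extension g (B (r # I)) (p # J))))"
       for X' p r
      by (simp add: op_push op_add[symmetric] del: split_blocks.simps) (simp add: algebra_simps sign_simps)
    show ?thesis
      unfolding pick_add[symmetric] dec_add[symmetric]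
      apply (rule pick_ext)
      apply (rule dec_cong_deg[OF refl])
      unfolding op_diff(3) R3
      unfolding split_blocks_add distrib_left R1 R2 L1 L2 split_blocks_push[symmetric] L3
      apply (simp add: split_blocks3_simps lie_extension_push)
      apply (simp add: op_simps split_blocks3_simps lie_extension_push)
      done
  qed
  finally show ?thesis
    by (simp add: cobracket_sum_def)
qed

section \<open>Functionals on chains\<close>

lemma vector_space_field: "vector_space ((*) :: 'k::field \<Rightarrow> 'k \<Rightarrow> 'k)"
  by unfold_locales (simp_all add: algebra_simps)

lemma vector_space_cscale: "vector_space (cscale :: 'k::field \<Rightarrow> ('a \<Rightarrow>\<^sub>0 'k) \<Rightarrow> ('a \<Rightarrow>\<^sub>0 'k))"
  by (rule chain.vector_space_axioms)

context vector_space
begin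

lemma lin_ext_superset:
  assumes "finite A" "Poly_Mapping.keys x \<subseteq> A"
  shows "lin_ext scale F x = (\<Sum>w\<in>A. scale (Poly_Mapping.lookup x w) (F w))"
  unfolding lin_ext_def
  by (rule sum.mono_neutral_left) (use assms in \<open>auto simp: in_keys_iff\<close>)

lemma lin_ext_add: "lin_ext scale F (x + y) = lin_ext scale F x + lin_ext scale F y"
proof -
  let ?A = "Poly_Mapping.keys x \<union> Poly_Mapping.keys y"
  have "Poly_Mapping.keys (x + y) \<subseteq> ?A"
    by (rule Poly_Mapping.keys_add)
  then show ?thesis
    by (simp add: lin_ext_superset[of ?A] lookup_add scale_left_distrib sum.distrib)
qed

lemma lin_ext_cscale: "lin_ext scale F (cscale c x) = scale c (lin_ext scale F x)"
proof -
  have "Poly_Mapping.keys (cscale c x) \<subseteq> Poly_Mapping.keys x"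
    by (auto simp: in_keys_iff lookup_cscale)
  then show ?thesis
    by (simp add: lin_ext_superset[of "Poly_Mapping.keys x"] lookup_cscale scale_sum_right)
qed

lemma lin_ext_single: "lin_ext scale F (Poly_Mapping.single w c) = scale c (F w)"
  by (simp add: lin_ext_superset[of "{w}"])

lemma lin_ext_basis [simp]: "lin_ext scale F (basis w) = F w"
  by (simp add: lin_ext_single)

lemma lin_ext_0 [simp]: "lin_ext scale F 0 = 0"
  by (simp add: lin_ext_def)

lemma additive_fun_lin_ext: "additive_fun (lin_ext scale F)"
  by (simp add: additive_fun_def lin_ext_add)

lemma lin_ext_minus: "lin_ext scale F (- x) = - lin_ext scale F x"
  by (rule additive_fun_minus[OF additive_fun_lin_ext])

lemma lin_ext_diff: "lin_ext scale F (x - y) = lin_ext scale F x - lin_ext scale F y"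
  using lin_ext_add[of F x "- y"] by (simp add: lin_ext_minus)

lemma lin_ext_sum: "lin_ext scale F (\<Sum>i\<in>A. f i) = (\<Sum>i\<in>A. lin_ext scale F (f i))"
  by (induction A rule: infinite_finite_induct) (simp_all add: lin_ext_add)

lemma lin_ext_lin_ext: "lin_ext scale F (lin_ext cscale f x) = lin_ext scale (\<lambda>w. lin_ext scale F (f w)) x"
  by (simp add: lin_ext_def[of cscale] lin_ext_sum lin_ext_cscale)
     (simp add: lin_ext_def)

lemma lin_ext_fun_add: "lin_ext scale (\<lambda>w. F w + G w) x = lin_ext scale F x + lin_ext scale G x"
  by (simp add: lin_ext_def scale_right_distrib sum.distrib)

lemma lin_ext_fun_scale: "lin_ext scale (\<lambda>w. scale c (F w)) x = scale c (lin_ext scale F x)"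
  by (simp add: lin_ext_def scale_sum_right mult.commute)

lemma lin_ext_fun_0: "lin_ext scale (\<lambda>w. 0) x = 0"
  by (simp add: lin_ext_def)

lemma scale_sign: "scale (sign e) x = signed e x"
  by (simp add: sign_def signed_def)

end

lemma lin_ext_cong: "(\<And>w. w \<in> Poly_Mapping.keys x \<Longrightarrow> F w = G w) \<Longrightarrow> lin_ext s F x = lin_ext s G x"
  by (simp add: lin_ext_def)

interpretation field: vector_space "(*) :: 'k::field \<Rightarrow> 'k \<Rightarrow> 'k"
  by (rule vector_space_field)

text \<open>For multiplication as scaling, this simp rule reassociates products to the left and
  would loop with \<open>algebra_simps\<close>.\<close>

declare field.scale_scale [simp del]

lemma cscale_sign: "cscale (sign e) x = signed e x"
  by (rule chain.scale_sign)

section \<open>Agreement of the recursive operations with the index sums defining the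
  coalgebra\<close>

lemma shuffle_eq_shuf: "shuffle u w = shuf u w basis"
proof (induction u w rule: shuf_induct)
  case (Cons a u b w)
  show ?case
    by (simp add: Cons cscale_sign shuf_hom[OF chain.additive_fun_lin_ext] lie_deg_def letter_deg_def split_beta)
qed simp_all

lemma (in vector_space) lin_ext_shuffle: "lin_ext scale F (shuffle u w) = shuf u w F"
  by (simp add: shuffle_eq_shuf shuf_hom[OF additive_fun_lin_ext])

lemma sum_Pow_lessThan_Suc: "(\<Sum>I\<in>Pow {..<Suc n}. f I) =
    (\<Sum>I\<in>Pow {..<n}. f (insert 0 (Suc ` I)) + f (Suc ` I) :: 'u::comm_monoid_add)"
proof -
  have e: "Pow {..<Suc n} = (\<lambda>I. Suc ` I) ` Pow {..<n} \<union> (\<lambda>I. insert 0 (Suc ` I)) ` Pow {..<n}"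
    unfolding lessThan_Suc_eq_insert_0 Pow_insert image_Pow_surj[OF refl, symmetric] image_image ..
  have inj: "inj_on (\<lambda>I. Suc ` I) A" "inj_on (\<lambda>I. insert 0 (Suc ` I)) A" for A
    by (auto simp: inj_on_def inj_image_eq_iff dest: insert_ident[THEN iffD1, rotated 2])
  show ?thesis
    unfolding e by (subst sum.union_disjoint) (auto simp: sum.reindex inj sum.distrib add.commute)
qed

lemma koszul_sign_Suc: "koszul_sign (Suc t) d c =
    (\<Prod>j\<in>{j\<in>{..<t}. c (Suc j) < c 0}. sign (d 0 * d (Suc j))) *
    (koszul_sign t (\<lambda>i. d (Suc i)) (\<lambda>i. c (Suc i)) :: 'k::field)"
proof -
  let ?S = "{(i, j). i < j \<and> j < t \<and> c (Suc j) < c (Suc i)}"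
  have e: "{(i, j). i < j \<and> j < Suc t \<and> c j < c i} =
     (\<lambda>j. (0, Suc j)) ` {j\<in>{..<t}. c (Suc j) < c 0} \<union> (\<lambda>(i, j). (Suc i, Suc j)) ` ?S"
    apply (auto simp: image_iff)
    apply (metis not0_implies_Suc Suc_less_eq gr_implies_not0)+
    done
  have "finite ?S"
    by (rule finite_subset[of _ "{..<t} \<times> {..<t}"]) auto
  then show ?thesis
    unfolding koszul_sign_def e
    by (subst prod.union_disjoint) (auto simp: prod.reindex inj_on_def intro!: prod.cong)
qed

lemma prod_sign: "finite A \<Longrightarrow> (\<Prod>j\<in>A. sign (a * d j)) = (sign (a * (\<Sum>j\<in>A. d j)) :: 'k::field)"
  by (induction A rule: finite_induct) (simp_all add: sign_simps distrib_left)

lemma gdeg_nths: "gdeg (nths X I) = (\<Sum>j\<in>{j\<in>{..<length X}. j \<in> I}. gdeg [X ! j])"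
proof (induction X arbitrary: I)
  case (Cons w X)
  have e: "{j\<in>{..<length (w # X)}. j \<in> I} = (if 0 \<in> I then {0} else {}) \<union> Suc ` {j\<in>{..<length X}. Suc j \<in> I}"
    by (auto simp: image_iff less_Suc_eq_0_disj)
  show ?case
    unfolding e by (subst sum.union_disjoint) (auto simp: Cons.IH nths_Cons sum.reindex)
qed simp

lemma koszul_sign_cong: "(\<And>i. i < t \<Longrightarrow> d i = d' i) \<Longrightarrow> (\<And>i j. i < t \<Longrightarrow> j < t \<Longrightarrow> c i < c j \<longleftrightarrow> c' i < c' j) \<Longrightarrow>
    koszul_sign t d c = koszul_sign t d' c'"
  unfolding koszul_sign_def by (rule prod.cong) auto

text \<open>A subset of the indices contains 0 or not. If not, the first block forms an inversion
  with every block of \<open>I\<close>, which is the sign in the recursion of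
  \<open>split_blocks\<close>.\<close>

lemma split_blocks_eq_sum:
  fixes F :: "'v bword \<Rightarrow> 'v bword \<Rightarrow> 'k::field"
  shows "split_blocks X F = (\<Sum>I\<in>Pow {..<length X}.
    koszul_sign (length X) (\<lambda>i. gdeg [X ! i]) (\<lambda>i. if i \<in> I then 0 else 1) * F (nths X I) (nths X (- I)))"
proof (induction X arbitrary: F)
  case Nil
  show ?case by (simp add: koszul_sign_def)
next
  case (Cons w X)
  have 1: "nths (w # X) (insert 0 (Suc ` I)) = w # nths X I" "nths (w # X) (- insert 0 (Suc ` I)) = nths X (- I)"
    "nths (w # X) (Suc ` I) = nths X I" "nths (w # X) (- (Suc ` I)) = w # nths X (- I)" for I
    by (simp_all add: nths_Cons inj_image_mem_iff Compl_eq)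
  have 2: "koszul_sign (length (w # X)) (\<lambda>i. gdeg [(w # X) ! i]) (\<lambda>i. if i \<in> insert 0 (Suc ` I) then 0 else 1) =
    (koszul_sign (length X) (\<lambda>i. gdeg [X ! i]) (\<lambda>i. if i \<in> I then 0 else 1) :: 'k)" for I
    by (simp add: koszul_sign_Suc inj_image_mem_iff)
  have 3: "koszul_sign (length (w # X)) (\<lambda>i. gdeg [(w # X) ! i]) (\<lambda>i. if i \<in> Suc ` I then 0 else 1) =
    (sign ((lie_deg w - 1) * gdeg (nths X I)) * koszul_sign (length X) (\<lambda>i. gdeg [X ! i]) (\<lambda>i. if i \<in> I then 0 else 1) :: 'k)" for I
    unfolding length_Cons koszul_sign_Suc
    by (subst prod_sign) (auto simp: inj_image_mem_iff gdeg_nths intro!: arg_cong[where f = sign] arg_cong2[where f = "(*)"] sum.cong)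
  define f where "f I = koszul_sign (length (w # X)) (\<lambda>i. gdeg [(w # X) ! i]) (\<lambda>i. if i \<in> I then 0 else 1) *
    F (nths (w # X) I) (nths (w # X) (- I))" for I
  have "split_blocks (w # X) F = (\<Sum>I\<in>Pow {..<length X}. f (insert 0 (Suc ` I)) + f (Suc ` I))"
    unfolding f_def 1 2 3 split_blocks.simps Cons.IH sum.distrib signed_field
    by (rule arg_cong2[where f = "(+)"], rule refl, rule sum.cong, rule refl) (simp only: mult_ac)
  also have "\<dots> = (\<Sum>I\<in>Pow {..<length (w # X)}. f I)"
    unfolding length_Cons sum_Pow_lessThan_Suc ..
  finally show ?case
    unfolding f_def .
qed

text \<open>\<open>coproduct\<close> is reduced while \<open>split_blocks\<close> contains the two
  splittings with an empty part; the hypotheses on \<open>B\<close> remove these.\<close>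

lemma lin_ext_coproduct:
  fixes B :: "'v bword \<Rightarrow> 'v bword \<Rightarrow> 'k::field"
  assumes "\<And>Y. B [] Y = 0" "\<And>Y. B Y [] = 0"
  shows "lin_ext (*) (\<lambda>(Y, Z). B Y Z) (coproduct X) = split_blocks X B"
proof -
  let ?P = "{I. I \<subseteq> {..<length X} \<and> I \<noteq> {} \<and> I \<noteq> {..<length X}}"
  have "nths X (- {..<length X}) = []"
    by (rule length_0_conv[THEN iffD1]) (auto simp: length_nths)
  then have z: "B (nths X I) (nths X (- I)) = 0" if "I \<in> Pow {..<length X} - ?P" for I
    using that assms by auto
  show ?thesis
    unfolding coproduct_def split_blocks_eq_sum
    by (simp add: field.lin_ext_sum field.lin_ext_cscale del: nths_empty)
       (rule sum.mono_neutral_left, use z in auto)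
qed

lemma dec_eq_sum: "dec w F = (\<Sum>r\<le>length w. F (take r w) (drop r w))"
  by (induction w arbitrary: F) (simp_all add: sum.atMost_Suc_shift del: sum.atMost_Suc)

lemma pick_split_blocks_Cons:
  fixes F :: "'v bword \<Rightarrow> 'v lword \<Rightarrow> 'v bword \<Rightarrow> 'k::field"
  shows "pick (w # X) (\<lambda>w X'. split_blocks X' (\<lambda>I J. sign ((lie_deg w - 1) * gdeg I) * F I w J)) =
   split_blocks X (\<lambda>I J. sign ((lie_deg w - 1) * gdeg I) * F I w J) +
    (pick X (\<lambda>w' X'. split_blocks X' (\<lambda>I J. sign ((lie_deg w' - 1) * gdeg I) * F (w # I) w' J)) +
     pick X (\<lambda>w' X'. split_blocks X' (\<lambda>I J. sign ((lie_deg w' - 1) * gdeg I) *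
        (sign ((lie_deg w - 1) * (gdeg I + (lie_deg w' - 1))) * F I w' (w # J)))))"
  unfolding pick.simps pick_add[symmetric]
  apply (rule arg_cong2[where f = "(+)"], rule refl)
  apply (rule pick_ext)
  unfolding split_blocks.simps op_add(3)[symmetric] signed_field op_push
  apply (rule split_blocks_ext)
  by (simp add: algebra_simps sign_simps)

text \<open>The classes 0, 1, 2 sort the blocks as \<open>I\<close>, picked block, \<open>J\<close>.
  \<open>pick\<close> brings the block to the very front, so the sign for moving it back past
  \<open>I\<close> is added.\<close>

lemma pick_split_blocks_eq_sum:
  fixes F :: "'v bword \<Rightarrow> 'v lword \<Rightarrow> 'v bword \<Rightarrow> 'k::field"
  shows "pick X (\<lambda>w X'. split_blocks X' (\<lambda>I J. sign ((lie_deg w - 1) * gdeg I) * F I w J)) =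
    (\<Sum>k<length X. \<Sum>I\<in>Pow ({..<length X} - {k}).
      koszul_sign (length X) (\<lambda>i. gdeg [X ! i]) (\<lambda>i. if i \<in> I then 0 else if i = k then 1 else 2) *
      F (nths X I) (X ! k) (nths X (- insert k I)))"
proof (induction X arbitrary: F)
  case Nil
  show ?case by simp
next
  case (Cons w X)
  let ?k = "\<lambda>k I. koszul_sign (length X) (\<lambda>i. gdeg [X ! i]) (\<lambda>i. if i \<in> I then 0 else if i = k then 1 else 2) :: 'k"
  define f where "f k I = koszul_sign (length (w # X)) (\<lambda>i. gdeg [(w # X) ! i])
      (\<lambda>i. if i \<in> I then 0 else if i = k then 1 else 2) *
    F (nths (w # X) I) ((w # X) ! k) (nths (w # X) (- insert k I))" for I k
  have n1: "nths (w # X) (insert 0 (Suc ` I)) = w # nths X I"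
    "nths (w # X) (- insert (Suc k) (insert 0 (Suc ` I))) = nths X (- insert k I)"
    "nths (w # X) (Suc ` I) = nths X I" "nths (w # X) (- insert 0 (Suc ` I)) = nths X (- I)"
    "nths (w # X) (- insert (Suc k) (Suc ` I)) = w # nths X (- insert k I)" for I k
    by (simp_all add: nths_Cons inj_image_mem_iff Compl_eq)
  have k0: "koszul_sign (length (w # X)) (\<lambda>i. gdeg [(w # X) ! i])
      (\<lambda>i. if i \<in> Suc ` I then 0 else if i = 0 then 1 else 2) =
      (sign ((lie_deg w - 1) * gdeg (nths X I)) *
       koszul_sign (length X) (\<lambda>i. gdeg [X ! i]) (\<lambda>i. if i \<in> I then 0 else 1) :: 'k)" for I
  proof -
    have "koszul_sign (length X) (\<lambda>i. gdeg [X ! i]) (\<lambda>i. if i \<in> I then 0 else if Suc i = 0 then 1 else 2) =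
      (koszul_sign (length X) (\<lambda>i. gdeg [X ! i]) (\<lambda>i. if i \<in> I then 0 else 1) :: 'k)"
      by (rule koszul_sign_cong) auto
    then show ?thesis
      unfolding length_Cons koszul_sign_Suc
      by (subst prod_sign) (auto simp: inj_image_mem_iff gdeg_nths
        intro!: arg_cong[where f = sign] arg_cong2[where f = "(*)"] sum.cong)
  qed
  have k1: "koszul_sign (length (w # X)) (\<lambda>i. gdeg [(w # X) ! i])
      (\<lambda>i. if i \<in> insert 0 (Suc ` I) then 0 else if i = Suc k then 1 else 2) = ?k k I" for k I
    by (simp add: koszul_sign_Suc inj_image_mem_iff cong: if_cong)
  have k2: "koszul_sign (length (w # X)) (\<lambda>i. gdeg [(w # X) ! i])
      (\<lambda>i. if i \<in> Suc ` I then 0 else if i = Suc k then 1 else 2) =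
      sign ((lie_deg w - 1) * (gdeg (nths X I) + (lie_deg (X ! k) - 1))) * ?k k I"
    if "k < length X" "I \<subseteq> {..<length X} - {k}" for k I
  proof -
    have "(\<Sum>j\<in>{j \<in> {..<length X}. j \<in> I \<or> j = k}. gdeg [X ! j]) = gdeg (nths X I) + (lie_deg (X ! k) - 1)"
    proof -
      have e: "{j \<in> {..<length X}. j \<in> I \<or> j = k} = insert k {j \<in> {..<length X}. j \<in> I}"
        using that by auto
      show ?thesis
        unfolding e gdeg_nths using that by (subst sum.insert) auto
    qed
    moreover have "{j \<in> {..<length X}. (if Suc j \<in> Suc ` I then 0 else if Suc j = Suc k then 1 else 2) <
        (if (0::nat) \<in> Suc ` I then 0 else if 0 = Suc k then 1 else (2::nat))} = {j \<in> {..<length X}. j \<in> I \<or> j = k}"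
      by (auto simp: inj_image_mem_iff split: if_splits)
    ultimately show ?thesis
      unfolding length_Cons koszul_sign_Suc
      by (subst prod_sign) (simp_all add: inj_image_mem_iff cong: if_cong)
  qed
  have P: "Pow ({..<length (w # X)} - {0}) = (\<lambda>I. Suc ` I) ` Pow {..<length X}"
  proof -
    have "{..<length (w # X)} - {0} = Suc ` {..<length X}"
      by (auto simp: lessThan_Suc_eq_insert_0)
    then show ?thesis
      by (simp only: image_Pow_surj[OF refl])
  qed
  have P': "(\<Sum>I\<in>Pow ({..<length (w # X)} - {Suc k}). h I) =
      (\<Sum>I\<in>Pow ({..<length X} - {k}). h (insert 0 (Suc ` I)) + h (Suc ` I))" for h :: "nat set \<Rightarrow> 'k" and k
  proof -
    have e0: "{..<length (w # X)} - {Suc k} = insert 0 (Suc ` ({..<length X} - {k}))"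
      unfolding length_Cons lessThan_Suc_eq_insert_0 by auto
    have e: "Pow ({..<length (w # X)} - {Suc k}) =
       (\<lambda>I. Suc ` I) ` Pow ({..<length X} - {k}) \<union> (\<lambda>I. insert 0 (Suc ` I)) ` Pow ({..<length X} - {k})"
      unfolding e0 Pow_insert image_Pow_surj[OF refl, symmetric] image_image ..
    have inj: "inj_on (\<lambda>I. Suc ` I) A" "inj_on (\<lambda>I. insert 0 (Suc ` I)) A" for A
      by (auto simp: inj_on_def inj_image_eq_iff dest: insert_ident[THEN iffD1, rotated 2])
    show ?thesis
      unfolding e by (subst sum.union_disjoint) (auto simp: sum.reindex inj sum.distrib add.commute)
  qed
  have e1: "(\<Sum>k<length (w # X). \<Sum>I\<in>Pow ({..<length (w # X)} - {k}). f k I) =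
     (\<Sum>I\<in>Pow {..<length X}. f 0 (Suc ` I)) +
     (\<Sum>k<length X. \<Sum>I\<in>Pow ({..<length X} - {k}). f (Suc k) (insert 0 (Suc ` I)) + f (Suc k) (Suc ` I))"
  proof -
    have "(\<Sum>I\<in>Pow ({..<length (w # X)} - {0}). f 0 I) = (\<Sum>I\<in>Pow {..<length X}. f 0 (Suc ` I))"
      unfolding P by (subst sum.reindex) (auto simp: inj_on_def inj_image_eq_iff)
    then show ?thesis
      unfolding length_Cons sum.lessThan_Suc_shift
      unfolding length_Cons[symmetric, of X w] P' by simp
  qed
  have e2: "(\<Sum>I\<in>Pow {..<length X}. f 0 (Suc ` I)) =
     split_blocks X (\<lambda>I J. sign ((lie_deg w - 1) * gdeg I) * F I w J)"
    unfolding split_blocks_eq_sum f_def n1 k0 by (intro sum.cong refl) (simp only: mult_ac nth_Cons_0)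
  have e3: "(\<Sum>k<length X. \<Sum>I\<in>Pow ({..<length X} - {k}). f (Suc k) (insert 0 (Suc ` I)) + f (Suc k) (Suc ` I)) =
     pick X (\<lambda>w' X'. split_blocks X' (\<lambda>I J. sign ((lie_deg w' - 1) * gdeg I) * F (w # I) w' J)) +
     pick X (\<lambda>w' X'. split_blocks X' (\<lambda>I J. sign ((lie_deg w' - 1) * gdeg I) *
        (sign ((lie_deg w - 1) * (gdeg I + (lie_deg w' - 1))) * F I w' (w # J))))"
    unfolding Cons.IH sum.distrib f_def n1 k1
    by (intro arg_cong2[where f = "(+)"] sum.cong refl) (simp_all only: k2 mult_ac nth_Cons_Suc lessThan_iff Pow_iff)
  show ?case
    using e1 unfolding e2 e3 pick_split_blocks_Cons[symmetric] unfolding f_def by (rule sym)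
qed

text \<open>Symmetry moves the cut piece from the end of the left factor, where
  \<open>cobracket\<close> puts it, to the front. Vanishing on empty words admits the cuts at both
  ends of a word, which \<open>dec\<close> includes and \<open>cobracket\<close> omits.\<close>

lemma lin_ext_cobracket:
  fixes B :: "'v bword \<Rightarrow> 'v bword \<Rightarrow> 'k::field"
  assumes s: "\<And>Z. block_symmetric (\<lambda>Y. B Y Z)"
    and z: "\<And>Y Z. B ([] # Y) Z = 0" "\<And>Y Z. B Y ([] # Z) = 0"
  shows "lin_ext (*) (\<lambda>(Y, Z). B Y Z) (cobracket X) = cobracket_sum X B"
proof -
  have mv: "B (I @ [u]) Z = sign ((lie_deg u - 1) * gdeg I) * B (u # I) Z" for I u Z
    using block_symmetric_move[OF s, of I u "[]" Z] by simp
  define F where "F I w J = dec w (\<lambda>u v. B (I @ [u]) (v # J) -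
    sign (lie_deg u * lie_deg v) * B (I @ [v]) (u # J))" for I w J
  have F: "(\<Sum>r\<in>{0<..<length w}. B (I @ [take r w]) (drop r w # J) -
      sign (lie_deg (take r w) * lie_deg (drop r w)) * B (I @ [drop r w]) (take r w # J)) = F I w J" for I w J
    unfolding F_def dec_eq_sum
    by (rule sum.mono_neutral_left) (auto simp: mv z)
  have "lin_ext (*) (\<lambda>(Y, Z). B Y Z) (cobracket X) =
     pick X (\<lambda>w X'. split_blocks X' (\<lambda>I J. sign ((lie_deg w - 1) * gdeg I) * F I w J))"
    unfolding pick_split_blocks_eq_sum F[symmetric]
    by (simp add: cobracket_def field.lin_ext_sum field.lin_ext_cscale field.lin_ext_diff Let_def)
  also have "\<dots> = cobracket_sum X B"
    unfolding cobracket_sum_def F_def op_push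
    apply (rule pick_ext)
    apply (subst dec_swap[OF additive_op_split_blocks, where F = "\<lambda>(x, y) a1 a2. _ x y a1 a2", simplified])
    apply (rule dec_cong_deg[OF refl])
    apply (rule split_blocks_ext)
    apply (simp only: mv)
    apply (simp add: op_simps)
    done
  finally show ?thesis .
qed

lemma lin_ext_basis_id: "lin_ext cscale basis x = x"
proof (rule poly_mapping_eqI)
  fix v
  have "(\<Sum>w\<in>Poly_Mapping.keys x. Poly_Mapping.lookup (cscale (Poly_Mapping.lookup x w) (basis w)) v) =
     (\<Sum>w\<in>Poly_Mapping.keys x. if w = v then Poly_Mapping.lookup x v else 0)"
    by (rule sum.cong) (auto simp: lookup_cscale lookup_single when_def)
  then show "Poly_Mapping.lookup (lin_ext cscale basis x) v = Poly_Mapping.lookup x v"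
    by (simp add: lin_ext_def lookup_sum in_keys_iff)
qed

lemma additive_scale_eq_lin_ext:
  fixes g :: "('a \<Rightarrow>\<^sub>0 'k::field) \<Rightarrow> 'k"
  assumes "Vector_Spaces.linear cscale (*) g"
  shows "g x = lin_ext (*) (\<lambda>w. g (basis w)) x"
proof -
  interpret Vector_Spaces.linear cscale "(*)" g by fact
  have "g x = g (lin_ext cscale basis x)"
    by (simp add: lin_ext_basis_id)
  then show ?thesis
    by (simp add: lin_ext_def sum scale)
qed

text \<open>A maximal independent subset of \<open>S\<close> stays independent after inserting
  \<open>y\<close>, so some linear functional is 1 at \<open>y\<close> and 0 on \<open>S\<close>. It
  is given by its values on block words.\<close>

lemma separating_functional:
  fixes y :: "'a \<Rightarrow>\<^sub>0 'k::field"
  assumes "y \<notin> chain.span S"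
  obtains F where "\<And>x. x \<in> S \<Longrightarrow> lin_ext (*) F x = 0" "lin_ext (*) F y \<noteq> 0"
proof -
  interpret vector_space_pair "cscale :: 'k \<Rightarrow> ('a \<Rightarrow>\<^sub>0 'k) \<Rightarrow> _" "(*) :: 'k \<Rightarrow> 'k \<Rightarrow> 'k"
    by (intro vector_space_pair.intro vector_space_cscale vector_space_field)
  obtain B where B: "B \<subseteq> S" "chain.independent B" "S \<subseteq> chain.span B"
    using chain.maximal_independent_subset by blast
  have "y \<notin> chain.span B"
    using assms B(1) chain.span_mono by blast
  then have "chain.independent (insert y B)"
    using B(2) chain.independent_insertI by blast
  then obtain g where g: "Vector_Spaces.linear cscale (*) g" "\<forall>x\<in>insert y B. g x = (if x = y then 1 else 0)"
    using linear_independent_extend[of "insert y B" "\<lambda>x. if x = y then 1 else 0"] by blast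
  have "g x = 0" if "x \<in> S" for x
  proof -
    have "x \<in> chain.span B"
      using that B(3) by blast
    then show ?thesis
      by (rule linear_eq_0_on_span[OF g(1), rotated])
        (use g(2) \<open>y \<notin> chain.span B\<close> chain.span_base in auto)
  qed
  moreover have "g y = 1"
    using g(2) by simp
  moreover have "lin_ext (*) (\<lambda>w. g (basis w)) x = g x" for x
    by (rule additive_scale_eq_lin_ext[OF g(1), symmetric])
  ultimately show ?thesis
    using that[of "\<lambda>w. g (basis w)"] by simp
qed

lemma lin_ext_span_0:
  assumes "x \<in> chain.span S" "\<And>x. x \<in> S \<Longrightarrow> lin_ext (*) F x = 0"
  shows "lin_ext (*) F x = 0"
  using assms(1)
  by (induction rule: chain.span_induct_alt) (simp_all add: field.lin_ext_add field.lin_ext_cscale assms(2))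

lemma lin_ext_chain_tensor:
  "lin_ext (*) F (chain_tensor x y) = lin_ext (*) (\<lambda>a. lin_ext (*) (\<lambda>b. F (a, b)) y) x"
  by (simp add: chain_tensor_def field.lin_ext_lin_ext)

lemma lin_ext_swap:
  "lin_ext (*) (\<lambda>a. lin_ext (*) (F a) y) x = lin_ext (*) (\<lambda>b. lin_ext (*) (\<lambda>a. F a b :: 'k::field) x) y"
  unfolding lin_ext_def sum_distrib_left
  by (subst sum.swap) (simp add: mult.left_commute)

lemma bwords_iff: "X \<in> bwords E \<longleftrightarrow> X \<noteq> [] \<and> (\<forall>w\<in>set X. w \<noteq> [] \<and> set w \<subseteq> letters E)"
  by (auto simp: bwords_def)

lemma keys_chainsD: "x \<in> chains E \<Longrightarrow> X \<in> Poly_Mapping.keys x \<Longrightarrow> X \<in> bwords E"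
  by (auto simp: chains_def)

lemma basis_chains: "X \<in> bwords E \<Longrightarrow> basis X \<in> chains E"
  by (simp add: chains_def)

lemma chains_add: "x \<in> chains E \<Longrightarrow> y \<in> chains E \<Longrightarrow> x + y \<in> chains E"
  using Poly_Mapping.keys_add[of x y] by (auto simp: chains_def)

lemma chains_cscale: "x \<in> chains E \<Longrightarrow> cscale c x \<in> chains E"
  by (auto simp: chains_def in_keys_iff lookup_cscale subset_iff)

lemma chains_subspace: "chain.subspace (chains E)"
proof (rule chain.subspaceI)
  show "0 \<in> chains E"
    by (simp add: chains_def)
qed (rule chains_add chains_cscale; assumption)+

lemma chains_sum: "(\<And>i. i \<in> A \<Longrightarrow> f i \<in> chains E) \<Longrightarrow> (\<Sum>i\<in>A. f i) \<in> chains E"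
  by (rule chain.subspace_sum[OF chains_subspace])

lemma chains_lin_ext: "(\<And>w. w \<in> Poly_Mapping.keys x \<Longrightarrow> f w \<in> chains E) \<Longrightarrow> lin_ext cscale f x \<in> chains E"
  unfolding lin_ext_def by (intro chains_sum chains_cscale)

text \<open>The operations only add and change signs, so this closure suffices to bound the support
  of their values.\<close>

definition additive_subgroup :: "'u::ab_group_add set \<Rightarrow> bool" where
  "additive_subgroup S \<longleftrightarrow> 0 \<in> S \<and> (\<forall>x\<in>S. \<forall>y\<in>S. x + y \<in> S) \<and> (\<forall>x\<in>S. - x \<in> S)"

lemma additive_subgroupD:
  assumes "additive_subgroup S"
  shows "0 \<in> S" "x \<in> S \<Longrightarrow> y \<in> S \<Longrightarrow> x + y \<in> S" "x \<in> S \<Longrightarrow> signed e x \<in> S"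
  using assms by (auto simp: additive_subgroup_def signed_def)

lemma additive_subgroup_keys: "additive_subgroup {y :: 'a \<Rightarrow>\<^sub>0 'k::field. Poly_Mapping.keys y \<subseteq> A}"
  unfolding additive_subgroup_def
proof (intro conjI ballI)
  fix x y :: "'a \<Rightarrow>\<^sub>0 'k"
  assume xy: "x \<in> {y. Poly_Mapping.keys y \<subseteq> A}" "y \<in> {y. Poly_Mapping.keys y \<subseteq> A}"
  show "x + y \<in> {y. Poly_Mapping.keys y \<subseteq> A}"
    using Poly_Mapping.keys_add[of x y] xy by auto
qed simp_all

lemma shuf_closed:
  assumes S: "additive_subgroup S" and "\<And>x. mset x = mset u + mset w \<Longrightarrow> f x \<in> S"
  shows "shuf u w f \<in> S"
  using assms(2)
proof (induction u w arbitrary: f rule: shuf_induct)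
  case (Cons a u b w)
  show ?case
    unfolding shuf.simps
    by (intro additive_subgroupD[OF S] Cons.IH) (auto intro: Cons.prems)
qed simp_all

lemma dec_closed:
  assumes S: "additive_subgroup S" and "\<And>x y. x @ y = w \<Longrightarrow> f x y \<in> S"
  shows "dec w f \<in> S"
  using assms(2)
proof (induction w arbitrary: f)
  case (Cons a w)
  show ?case
    unfolding dec.simps
    by (intro additive_subgroupD[OF S] Cons.IH) (auto intro: Cons.prems)
qed simp

lemma dec3_closed:
  assumes S: "additive_subgroup S" and "\<And>a b c. a @ b @ c = w \<Longrightarrow> b \<noteq> [] \<Longrightarrow> f a b c \<in> S"
  shows "dec3 w f \<in> S"
  unfolding dec3_def
  by (intro dec_closed[OF S]) (auto intro: assms(2) additive_subgroupD[OF S])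

lemma split_blocks_closed:
  assumes S: "additive_subgroup S" and "\<And>I J. mset X = mset I + mset J \<Longrightarrow> f I J \<in> S"
  shows "split_blocks X f \<in> S"
  using assms(2)
proof (induction X arbitrary: f)
  case (Cons w X)
  show ?case
    unfolding split_blocks.simps
    by (intro additive_subgroupD[OF S] Cons.IH) (auto intro!: additive_subgroupD[OF S] Cons.prems)
qed simp

lemma slices_closed:
  assumes S: "additive_subgroup S"
    and "\<And>x Y z. mset (concat X) = mset x + mset (concat Y) + mset z \<Longrightarrow>
     length Y = length X \<Longrightarrow> [] \<notin> set Y \<Longrightarrow> f x Y z \<in> S"
  shows "slices X f \<in> S"
  using assms(2)
proof (induction X arbitrary: f)
  case (Cons w X)
  show ?case
    unfolding slices.simps
    by (auto intro!: dec3_closed[OF S] Cons.IH additive_subgroupD[OF S] shuf_closed[OF S] Cons.prems)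
qed simp

text \<open>
  Functionals on the coalgebra are the \<open>cochain\<close>s below; relations are detected by them, so all
  identities modulo \<open>relations\<close> are reduced to identities between scalar functions.
\<close>

locale graded_space = vector_space scale
  for scale :: "'k::field_char_0 \<Rightarrow> 'v::ab_group_add \<Rightarrow> 'v" +
  fixes E :: "nat \<Rightarrow> int \<Rightarrow> 'v set"
  assumes subspace_E: "subspace (E s n)"
begin

section \<open>Cochains, and the detection of relations by them\<close>

definition multilinear :: "('v lword \<Rightarrow> 'k) \<Rightarrow> bool" where
  "multilinear f \<longleftrightarrow> (\<forall>p q s n c a b. a \<in> E s n \<longrightarrow> b \<in> E s n \<longrightarrow>
     f (p @ (s, n, scale c a + b) # q) = c * f (p @ (s, n, a) # q) + f (p @ (s, n, b) # q))"

text \<open>The conditions inside a word are imposed on the first block only; block symmetry carries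
  them over to all blocks.\<close>

definition cochain :: "('v bword \<Rightarrow> 'k) \<Rightarrow> bool" where
  "cochain F \<longleftrightarrow> block_symmetric F \<and> (\<forall>R. shuffle_free (\<lambda>w. F (w # R)) \<and> multilinear (\<lambda>w. F (w # R)))"

definition supported :: "('v bword \<Rightarrow> 'k) \<Rightarrow> bool" where
  "supported F \<longleftrightarrow> (\<forall>X. X \<notin> bwords E \<longrightarrow> F X = 0)"

lemma multilinearD: "multilinear f \<Longrightarrow> a \<in> E s n \<Longrightarrow> b \<in> E s n \<Longrightarrow>
    f (p @ (s, n, scale c a + b) # q) = c * f (p @ (s, n, a) # q) + f (p @ (s, n, b) # q)"
  by (simp add: multilinear_def)

lemma zero_E: "0 \<in> E s n"
  using subspace_E subspace_0 by blast

lemma multilinear_0: "multilinear f \<Longrightarrow> f (p @ (s, n, 0) # q) = 0"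
  using multilinearD[of f 0 s n 0 p "-1" q] zero_E by simp

lemma multilinear_add: "multilinear f \<Longrightarrow> a \<in> E s n \<Longrightarrow> b \<in> E s n \<Longrightarrow>
    f (p @ (s, n, a + b) # q) = f (p @ (s, n, a) # q) + f (p @ (s, n, b) # q)"
  using multilinearD[of f a s n b p 1 q] by simp

lemma multilinear_scale: "multilinear f \<Longrightarrow> a \<in> E s n \<Longrightarrow>
    f (p @ (s, n, scale c a) # q) = c * f (p @ (s, n, a) # q)"
  using multilinearD[of f a s n 0 p c q] zero_E by (simp add: multilinear_0)

lemma lin_ext_shuffle_context:
  "lin_ext (*) F (lin_ext cscale (\<lambda>x. basis (f x)) (shuffle u w)) = shuf u w (\<lambda>x. F (f x))"
  for F :: "'b \<Rightarrow> 'k"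
  by (simp add: field.lin_ext_lin_ext field.lin_ext_shuffle)

lemma cochain_coalgebra_rel:
  assumes F: "cochain F" and x: "x \<in> coalgebra_rel scale E"
  shows "lin_ext (*) F x = 0"
proof -
  have s: "block_symmetric F" and sf: "shuffle_free (\<lambda>w. F (w # R))" and ml: "multilinear (\<lambda>w. F (w # R))" for R
    using F by (auto simp: cochain_def)
  have mv: "F (X @ w # Y) = sign ((lie_deg w - 1) * gdeg X) * F (w # X @ Y)" for X w Y
    by (rule block_symmetric_move[OF s])
  from x show ?thesis
  proof cases
    case (additive X p s n a q Y b)
    have "a \<in> E s n" "b \<in> E s n"
      using additive by (auto simp: bwords_iff letters_def)
    then show ?thesis
      using multilinear_add[OF ml, of a s n b p q "X @ Y"]
      by (simp add: additive(1) field.lin_ext_diff mv) (simp add: algebra_simps)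
  next
    case (homogeneous X p s n a q Y c)
    have "a \<in> E s n"
      using homogeneous by (auto simp: bwords_iff letters_def)
    then show ?thesis
      using multilinear_scale[OF ml, of a s n p c q "X @ Y"]
      by (simp add: homogeneous(1) field.lin_ext_diff field.lin_ext_cscale mv)
  next
    case (shuffle X u w Y)
    have "shuf u w (\<lambda>v. F (X @ v # Y)) = sign ((lie_deg u + lie_deg w - 1) * gdeg X) * shuf u w (\<lambda>v. F (v # X @ Y))"
      by (simp add: mv op_push)
    also have "\<dots> = 0"
      using sf[of "X @ Y"] shuffle by (auto simp: shuffle_free_def bwords_iff)
    finally show ?thesis
      by (simp add: shuffle(1) lin_ext_shuffle_context)
  next
    case (commute X u w Y)
    show ?thesis
      using block_symmetricD[OF s, of X u w Y]
      by (simp add: commute(1) field.lin_ext_diff field.lin_ext_cscale)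
  qed
qed

lemma cochain_relations: "cochain F \<Longrightarrow> x \<in> relations scale E \<Longrightarrow> lin_ext (*) F x = 0"
  unfolding relations_def by (rule lin_ext_span_0) (auto intro: cochain_coalgebra_rel)

text \<open>The converse of \<open>cochain_coalgebra_rel\<close>. A cochain is a function on all
  block words, so a functional known only on \<open>chains E\<close> is cut off to 0 elsewhere; the
  cases of the proof check that the relations never mix the two domains.\<close>

lemma cochain_restrict:
  assumes F: "\<And>x. x \<in> coalgebra_rel scale E \<Longrightarrow> lin_ext (*) F x = 0"
  shows "cochain (\<lambda>X. if X \<in> bwords E then F X else 0)" (is "cochain ?F")
proof -
  have "block_symmetric ?F"
    unfolding block_symmetric_def
  proof (intro allI)
    fix X u w Y
    have e: "X @ u # w # Y \<in> bwords E \<longleftrightarrow> X @ w # u # Y \<in> bwords E"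
      by (auto simp: bwords_iff)
    show "?F (X @ u # w # Y) = sign ((lie_deg u - 1) * (lie_deg w - 1)) * ?F (X @ w # u # Y)"
      using F[OF coalgebra_rel.commute[of X u w Y E]]
      by (simp add: e field.lin_ext_diff field.lin_ext_cscale)
  qed
  moreover have "shuffle_free (\<lambda>w. ?F (w # R))" for R
    unfolding shuffle_free_def
  proof (intro conjI allI impI)
    show "?F ([] # R) = 0"
      by (simp add: bwords_iff)
    fix u w :: "'v lword"
    assume uw: "u \<noteq> []" "w \<noteq> []"
    have "shuf u w (\<lambda>v. ?F (v # R)) = shuf u w (\<lambda>v. if [u, w] @ R \<in> bwords E then F (v # R) else 0)"
    proof (rule shuf_cong)
      fix v
      assume v: "mset v = mset u + mset w"
      then have "set v = set u \<union> set w" "v \<noteq> []"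
        using uw by (metis set_mset_mset set_mset_union, auto)
      then show "?F (v # R) = (if [u, w] @ R \<in> bwords E then F (v # R) else 0)"
        using uw by (auto simp: bwords_iff)
    qed
    also have "\<dots> = 0"
      using F[OF coalgebra_rel.shuffle[of "[]" u w R E]]
      by (cases "[u, w] @ R \<in> bwords E") (simp_all add: lin_ext_shuffle_context op_zero)
    finally show "shuf u w (\<lambda>v. ?F (v # R)) = 0" .
  qed
  moreover have "multilinear (\<lambda>w. ?F (w # R))" for R
    unfolding multilinear_def
  proof (intro allI impI)
    fix p q s n c a b
    assume ab: "a \<in> E s n" "b \<in> E s n"
    have ca: "scale c a \<in> E s n" "scale c a + b \<in> E s n"
      using ab subspace_E by (simp_all add: subspace_scale subspace_add)
    have e: "(p @ (s, n, v) # q) # R \<in> bwords E \<longleftrightarrow> (p @ (s, n, a) # q) # R \<in> bwords E" if "v \<in> E s n" for v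
      using that ab by (auto simp: bwords_iff letters_def)
    show "?F ((p @ (s, n, scale c a + b) # q) # R) =
      c * ?F ((p @ (s, n, a) # q) # R) + ?F ((p @ (s, n, b) # q) # R)"
    proof (cases "(p @ (s, n, a) # q) # R \<in> bwords E")
      case True
      then show ?thesis
        using F[OF coalgebra_rel.additive[of "[]" p s n "scale c a" q R E b]]
          F[OF coalgebra_rel.homogeneous[of "[]" p s n a q R E scale c]]
          e[OF ab(2)] e[OF ca(1)] e[OF ca(2)]
        by (simp add: field.lin_ext_diff field.lin_ext_add field.lin_ext_cscale algebra_simps)
    next
      case False
      then show ?thesis
        using e[OF ab(2)] e[OF ca(2)] by simp
    qed
  qed
  ultimately show ?thesis
    by (simp add: cochain_def)
qed

lemma coalgebra_rel_chains: "x \<in> coalgebra_rel scale E \<Longrightarrow> x \<in> chains E"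
proof (induction rule: coalgebra_rel.induct)
  case (additive X p s n a q Y b)
  have "X @ [p @ [(s, n, a + b)] @ q] @ Y \<in> bwords E"
    using additive subspace_add[OF subspace_E] by (auto simp: bwords_iff letters_def)
  then show ?case
    using additive by (intro chain.subspace_diff[OF chains_subspace] basis_chains)
next
  case (homogeneous X p s n a q Y c)
  have "X @ [p @ [(s, n, scale c a)] @ q] @ Y \<in> bwords E"
    using homogeneous subspace_scale[OF subspace_E] by (auto simp: bwords_iff letters_def)
  then show ?case
    using homogeneous by (intro chain.subspace_diff[OF chains_subspace] chains_cscale basis_chains)
next
  case (shuffle X u w Y)
  have "shuf u w (\<lambda>x. basis (X @ [x] @ Y)) \<in> {y :: _ \<Rightarrow>\<^sub>0 'k. Poly_Mapping.keys y \<subseteq> bwords E}"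
  proof (rule shuf_closed[OF additive_subgroup_keys])
    fix x
    assume "mset x = mset u + mset w"
    then have "set x = set u \<union> set w" "length x = length u + length w"
      by (metis set_mset_mset set_mset_union) (metis \<open>mset x = _\<close> size_mset size_union)
    then have "X @ [x] @ Y \<in> bwords E"
      using shuffle by (auto simp: bwords_iff)
    then show "basis (X @ [x] @ Y) \<in> {y :: _ \<Rightarrow>\<^sub>0 'k. Poly_Mapping.keys y \<subseteq> bwords E}"
      by simp
  qed
  then show ?case
    by (simp add: chain.lin_ext_shuffle chains_def)
next
  case (commute X u w Y)
  then have "X @ [w, u] @ Y \<in> bwords E"
    by (auto simp: bwords_iff)
  then show ?case
    using commute by (intro chain.subspace_diff[OF chains_subspace] chains_cscale basis_chains)
qed

lemma relations_chains: "x \<in> relations scale E \<Longrightarrow> x \<in> chains E"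
  using chain.span_minimal[OF _ chains_subspace, of "coalgebra_rel scale E" E] coalgebra_rel_chains
  by (auto simp: relations_def)

text \<open>A chain outside the span of the relations is separated from it by a functional, and the
  cut-off of that functional is a supported cochain.\<close>

lemma in_relationsI:
  assumes "y \<in> chains E" "\<And>F. cochain F \<Longrightarrow> supported F \<Longrightarrow> lin_ext (*) F y = 0"
  shows "y \<in> relations scale E"
proof (rule ccontr)
  assume "y \<notin> relations scale E"
  then obtain F where F: "\<And>x. x \<in> coalgebra_rel scale E \<Longrightarrow> lin_ext (*) F x = 0" "lin_ext (*) F y \<noteq> 0"
    unfolding relations_def by (rule separating_functional) blast
  have "lin_ext (*) (\<lambda>X. if X \<in> bwords E then F X else 0) y = lin_ext (*) F y"
    by (rule lin_ext_cong) (use assms(1) in \<open>auto dest: keys_chainsD\<close>)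
  then show False
    using assms(2)[OF cochain_restrict[OF F(1)]] F(2) by (simp add: supported_def)
qed

definition bicochain :: "('v bword \<Rightarrow> 'v bword \<Rightarrow> 'k) \<Rightarrow> bool" where
  "bicochain B \<longleftrightarrow> (\<forall>Z. cochain (\<lambda>Y. B Y Z) \<and> supported (\<lambda>Y. B Y Z)) \<and> (\<forall>Y. cochain (B Y) \<and> supported (B Y))"

text \<open>As in \<open>in_relationsI\<close>. Fixing one factor of the separating functional at a
  block word gives a functional of the other factor that vanishes on all relations.\<close>

lemma in_relations2I:
  assumes y: "Poly_Mapping.keys y \<subseteq> bwords E \<times> bwords E"
    and B: "\<And>B. bicochain B \<Longrightarrow> lin_ext (*) (\<lambda>(Y, Z). B Y Z) y = 0"
  shows "y \<in> relations2 scale E"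
proof (rule ccontr)
  assume "y \<notin> relations2 scale E"
  then obtain F where F: "\<And>x. x \<in> {chain_tensor x y | x y. x \<in> relations scale E \<and> y \<in> chains E} \<union>
      {chain_tensor x y | x y. x \<in> chains E \<and> y \<in> relations scale E} \<Longrightarrow> lin_ext (*) F x = 0" "lin_ext (*) F y \<noteq> 0"
    unfolding relations2_def by (rule separating_functional) blast
  define B where "B Y Z = (if Y \<in> bwords E \<and> Z \<in> bwords E then F (Y, Z) else 0)" for Y Z
  have c0: "cochain (\<lambda>Y. 0)"
    by (simp add: cochain_def block_symmetric_def shuffle_free_def multilinear_def op_zero)
  have "lin_ext (*) (\<lambda>Y. F (Y, Z)) x = 0" if "x \<in> coalgebra_rel scale E" "Z \<in> bwords E" for x Z
  proof -
    have "x \<in> relations scale E" "basis Z \<in> chains E"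
      using that by (auto simp: relations_def intro: basis_chains chain.span_base)
    then have "lin_ext (*) F (chain_tensor x (basis Z)) = 0"
      by (intro F(1)) blast
    then show ?thesis
      by (simp add: lin_ext_chain_tensor)
  qed
  from cochain_restrict[OF this] have 1: "cochain (\<lambda>Y. B Y Z)" for Z
    by (cases "Z \<in> bwords E") (simp_all add: B_def c0)
  have "lin_ext (*) (\<lambda>Z. F (Y, Z)) x = 0" if "x \<in> coalgebra_rel scale E" "Y \<in> bwords E" for x Y
  proof -
    have "x \<in> relations scale E" "basis Y \<in> chains E"
      using that by (auto simp: relations_def intro: basis_chains chain.span_base)
    then have "lin_ext (*) F (chain_tensor (basis Y) x) = 0"
      by (intro F(1)) blast
    then show ?thesis
      by (simp add: lin_ext_chain_tensor)
  qed
  from cochain_restrict[OF this] have 2: "cochain (B Y)" for Y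
    by (cases "Y \<in> bwords E") (simp_all add: B_def[abs_def] c0)
  have "bicochain B"
    unfolding bicochain_def supported_def using 1 2 by (simp add: B_def)
  moreover have "lin_ext (*) (\<lambda>(Y, Z). B Y Z) y = lin_ext (*) F y"
    by (rule lin_ext_cong) (use y in \<open>auto simp: B_def\<close>)
  ultimately show False
    using B F(2) by simp
qed

lemma bicochain_relations2:
  assumes B: "bicochain B" and x: "x \<in> relations2 scale E"
  shows "lin_ext (*) (\<lambda>(Y, Z). B Y Z) x = 0"
  using x unfolding relations2_def
proof (rule lin_ext_span_0)
  fix t
  assume "t \<in> {chain_tensor x y | x y. x \<in> relations scale E \<and> y \<in> chains E} \<union>
      {chain_tensor x y | x y. x \<in> chains E \<and> y \<in> relations scale E}"
  then consider x y where "t = chain_tensor x y" "x \<in> relations scale E"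
    | x y where "t = chain_tensor x y" "y \<in> relations scale E"
    by blast
  then show "lin_ext (*) (\<lambda>(Y, Z). B Y Z) t = 0"
  proof cases
    case 1
    have "lin_ext (*) (\<lambda>Y. B Y Z) x = 0" for Z
      by (rule cochain_relations[OF _ 1(2)]) (use B in \<open>simp add: bicochain_def\<close>)
    then show ?thesis
      unfolding 1(1) lin_ext_chain_tensor by (subst lin_ext_swap) (simp add: field.lin_ext_fun_0)
  next
    case 2
    have "lin_ext (*) (B Y) y = 0" for Y
      by (rule cochain_relations[OF _ 2(2)]) (use B in \<open>simp add: bicochain_def\<close>)
    then show ?thesis
      by (simp add: 2(1) lin_ext_chain_tensor field.lin_ext_fun_0)
  qed
qed

end

lemma shuffle_free_add: "shuffle_free f \<Longrightarrow> shuffle_free h \<Longrightarrow> shuffle_free (\<lambda>x. f x + h x)"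
  by (simp add: shuffle_free_def op_add)

lemma shuffle_free_lie_extension:
  fixes H :: "'v lword \<Rightarrow> 'w lword \<Rightarrow> 'k::field"
  assumes "\<And>v. shuffle_free (\<lambda>x. H x v)"
  shows "shuffle_free (\<lambda>x. lie_extension g (H x) X)"
proof -
  have "shuf p q (\<lambda>x. lie_extension g (H x) X) = lie_extension g (\<lambda>v. shuf p q (\<lambda>x. H x v)) X" for p q
    unfolding lie_extension_def by (simp add: slices_swap[OF additive_op_shuf] op_zero)
  moreover have "H [] = (\<lambda>v. 0)"
    using assms by (auto simp: shuffle_free_def)
  ultimately show ?thesis
    using assms by (simp add: shuffle_free_def lie_extension_zero)
qed

lemma block_symmetric_lie_extension:
  assumes "\<And>x z. block_symmetric (\<lambda>Y. f (x @ g Y # z))"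
  shows "block_symmetric (lie_extension g f)"
  unfolding block_symmetric_def
proof (intro allI)
  fix X u w Y
  show "lie_extension g f (X @ u # w # Y) =
    sign ((lie_deg u - 1) * (lie_deg w - 1)) * lie_extension g f (X @ w # u # Y)"
    unfolding lie_extension_def
    by (subst block_symmetricD[OF slices_symmetric[of "\<lambda>x Y z. f (x @ g Y # z)", OF assms], of X u w Y]) simp
qed

lemma block_symmetric_lie_extension_fun:
  assumes "\<And>v. block_symmetric (\<lambda>R. F R v)"
  shows "block_symmetric (\<lambda>R. lie_extension g (F R) X)"
  unfolding block_symmetric_def
proof (intro allI)
  fix P u w Y
  have e: "F (P @ u # w # Y) = (\<lambda>v. sign ((lie_deg u - 1) * (lie_deg w - 1)) * F (P @ w # u # Y) v)"
    using block_symmetricD[OF assms] by blast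
  show "lie_extension g (F (P @ u # w # Y)) X =
    sign ((lie_deg u - 1) * (lie_deg w - 1)) * lie_extension g (F (P @ w # u # Y)) X"
    unfolding e lie_extension_push ..
qed

lemma block_symmetric_split:
  assumes "\<And>R. block_symmetric (\<lambda>I. B I R)" "\<And>I. block_symmetric (B I)"
  shows "block_symmetric (\<lambda>X. split_blocks X B)"
proof -
  have "split_blocks (P @ u # w # Y) B = sign ((lie_deg u - 1) * (lie_deg w - 1)) * split_blocks (P @ w # u # Y) B"
    for P u w Y
    using assms
  proof (induction P arbitrary: B)
    case Nil
    have e: "B (u # w # I) J = sign ((lie_deg u - 1) * (lie_deg w - 1)) * B (w # u # I) J"
      "B I (u # w # J) = sign ((lie_deg u - 1) * (lie_deg w - 1)) * B I (w # u # J)" for I J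
      by (rule block_symmetric_head[OF Nil(1)], rule block_symmetric_head[OF Nil(2)])
    show ?case
      unfolding append_Nil split_blocks.simps e
      by (simp add: op_simps)
  next
    case (Cons p P)
    have 1: "split_blocks (P @ u # w # Y) (\<lambda>I J. B (p # I) J) =
      sign ((lie_deg u - 1) * (lie_deg w - 1)) * split_blocks (P @ w # u # Y) (\<lambda>I J. B (p # I) J)"
      by (rule Cons.IH) (intro block_symmetric_Cons[OF Cons.prems(1)], rule Cons.prems(2))
    have 2: "split_blocks (P @ u # w # Y) (\<lambda>I J. sign ((lie_deg p - 1) * gdeg I) * B I (p # J)) =
      sign ((lie_deg u - 1) * (lie_deg w - 1)) * split_blocks (P @ w # u # Y) (\<lambda>I J. sign ((lie_deg p - 1) * gdeg I) * B I (p # J))"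
    proof (rule Cons.IH)
      show "block_symmetric (\<lambda>I. sign ((lie_deg p - 1) * gdeg I) * B I (p # R))" for R
        by (rule block_symmetric_signedI[OF Cons.prems(1), where d = 0 and e = "lie_deg p - 1"]) simp
      show "block_symmetric (\<lambda>J. sign ((lie_deg p - 1) * gdeg I) * B I (p # J))" for I
        by (rule block_symmetric_signedI[OF block_symmetric_Cons[OF Cons.prems(2)], where e = 0 and d = "(lie_deg p - 1) * gdeg I"]) simp
    qed
    show ?case
      using 1 2 by (simp only: append_Cons split_blocks.simps signed_field distrib_left)
  qed
  then show ?thesis
    unfolding block_symmetric_def by blast
qed

text \<open>Multilinearity for one fixed triple of letters. In this form it passes through all
  operations by \<open>dec_marked\<close> and \<open>shuf_marked\<close>, which see a marked letter
  only through its degree.\<close>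

definition linear_relation ::
  "'k::field \<Rightarrow> 'v letter \<Rightarrow> 'v letter \<Rightarrow> 'v letter \<Rightarrow> ('v lword \<Rightarrow> 'k) \<Rightarrow> bool" where
  "linear_relation c l0 l1 l2 f \<longleftrightarrow> (\<forall>p q. f (p @ l0 # q) = c * f (p @ l1 # q) + f (p @ l2 # q))"

context
  fixes c :: "'k::field" and l0 l1 l2 :: "'v letter"
  assumes deg: "letter_deg l1 = letter_deg l0" "letter_deg l2 = letter_deg l0"
begin

lemma linear_relation_shuf2: "linear_relation c l0 l1 l2 f \<Longrightarrow> linear_relation c l0 l1 l2 (\<lambda>u. shuf w u f)"
  by (simp add: linear_relation_def shuf_marked deg op_add distrib_left op_push mult.left_commute)

lemma linear_relation_signed:
  "linear_relation c l0 l1 l2 f \<Longrightarrow> (\<And>x. e x = a + b * lie_deg x) \<Longrightarrow>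
    linear_relation c l0 l1 l2 (\<lambda>x. sign (e x) * f x)"
  by (simp add: linear_relation_def deg distrib_left)

lemma linear_relation_shuf1: "linear_relation c l0 l1 l2 f \<Longrightarrow> linear_relation c l0 l1 l2 (\<lambda>u. shuf u w f)"
  by (subst shuf_commute) (rule linear_relation_signed[OF linear_relation_shuf2, where a = 0 and b = "lie_deg w"], simp_all)

lemma linear_relation_dec:
  "(\<And>y. linear_relation c l0 l1 l2 (\<lambda>x. F x y)) \<Longrightarrow> (\<And>x. linear_relation c l0 l1 l2 (F x)) \<Longrightarrow>
    linear_relation c l0 l1 l2 (\<lambda>w. dec w F)"
  by (simp add: linear_relation_def dec_marked op_add distrib_left op_push)

lemma linear_relation_fun_op:
  assumes "\<And>t. linear_relation c l0 l1 l2 (\<lambda>x. F x t)" "additive_op T" "\<And>f. T (\<lambda>t. c * f t) = c * T f"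
  shows "linear_relation c l0 l1 l2 (\<lambda>x. T (F x))"
  unfolding linear_relation_def
proof (intro allI)
  fix p q
  have "F (p @ l0 # q) = (\<lambda>t. c * F (p @ l1 # q) t + F (p @ l2 # q) t)"
    using assms(1) by (auto simp: linear_relation_def)
  then show "T (F (p @ l0 # q)) = c * T (F (p @ l1 # q)) + T (F (p @ l2 # q))"
    using additive_opD[OF assms(2)] assms(3) by simp
qed

lemma linear_relation_fun_dec:
  "(\<And>t s. linear_relation c l0 l1 l2 (\<lambda>x. F x t s)) \<Longrightarrow> linear_relation c l0 l1 l2 (\<lambda>x. dec w (F x))"
  using linear_relation_fun_op[where F = "\<lambda>x (t, s). F x t s" and T = "\<lambda>G. dec w (\<lambda>t s. G (t, s))", OF _ additive_op_dec]
  by (simp add: split_beta op_push)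

lemma linear_relation_fun_shuf:
  "(\<And>t. linear_relation c l0 l1 l2 (\<lambda>x. F x t)) \<Longrightarrow> linear_relation c l0 l1 l2 (\<lambda>x. shuf u w (F x))"
  by (rule linear_relation_fun_op[OF _ additive_op_shuf]) (simp_all add: op_push)

lemma linear_relation_fun_slices:
  "(\<And>t s r. linear_relation c l0 l1 l2 (\<lambda>x. F x t s r)) \<Longrightarrow> linear_relation c l0 l1 l2 (\<lambda>x. slices X (F x))"
  using linear_relation_fun_op[where F = "\<lambda>x (t, s, r). F x t s r" and T = "\<lambda>G. slices X (\<lambda>t s r. G (t, s, r))", OF _ additive_op_slices]
  by (simp add: split_beta op_push)

lemma linear_relation_fun_split_blocks:
  "(\<And>t s. linear_relation c l0 l1 l2 (\<lambda>x. F x t s)) \<Longrightarrow> linear_relation c l0 l1 l2 (\<lambda>x. split_blocks X (F x))"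
  using linear_relation_fun_op[where F = "\<lambda>x (t, s). F x t s" and T = "\<lambda>G. split_blocks X (\<lambda>t s. G (t, s))", OF _ additive_op_split_blocks]
  by (simp add: split_beta op_push)

lemma linear_relation_fun_lie_extension:
  "(\<And>t. linear_relation c l0 l1 l2 (\<lambda>x. F x t)) \<Longrightarrow> linear_relation c l0 l1 l2 (\<lambda>x. lie_extension g (F x) X)"
  by (rule linear_relation_fun_op[OF _ additive_op_lie_extension]) (simp_all add: lie_extension_push)

lemma linear_relation_add:
  "linear_relation c l0 l1 l2 f \<Longrightarrow> linear_relation c l0 l1 l2 h \<Longrightarrow> linear_relation c l0 l1 l2 (\<lambda>x. f x + h x)"
  by (simp add: linear_relation_def distrib_left)

lemma linear_relation_dec3:
  assumes "\<And>b d. linear_relation c l0 l1 l2 (\<lambda>a. K a b d)" "\<And>a d. linear_relation c l0 l1 l2 (\<lambda>b. K a b d)"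
    "\<And>a b. linear_relation c l0 l1 l2 (K a b)"
  shows "linear_relation c l0 l1 l2 (\<lambda>w. dec3 w K)"
  unfolding dec3_def
proof (intro linear_relation_dec linear_relation_fun_dec)
  show "linear_relation c l0 l1 l2 (\<lambda>x. if t = [] then 0 else K x t s)" for t s
    using assms(1) by (simp add: linear_relation_def)
  show "linear_relation c l0 l1 l2 (\<lambda>b. if b = [] then 0 else K a b d)" for a d
    using assms(2) by (simp add: linear_relation_def)
  show "linear_relation c l0 l1 l2 (\<lambda>d. if b = [] then 0 else K a b d)" for a b
    using assms(3) by (simp add: linear_relation_def)
qed

lemma linear_relation_slices:
  assumes "\<And>Y z. linear_relation c l0 l1 l2 (\<lambda>x. G x Y z)" "\<And>x Y z. linear_relation c l0 l1 l2 (\<lambda>b. G x (b # Y) z)"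
    "\<And>x Y. linear_relation c l0 l1 l2 (G x Y)"
  shows "linear_relation c l0 l1 l2 (\<lambda>w. slices (w # X) G)"
  unfolding slices.simps signed_field
proof (rule linear_relation_dec3; rule linear_relation_fun_slices)
  fix a b d x z :: "'v lword" and Y
  show "linear_relation c l0 l1 l2 (\<lambda>a. sign (lie_deg a + lie_deg x * (lie_deg b - 1 + lie_deg d) + gdeg Y * lie_deg d) *
      shuf a x (\<lambda>x'. shuf d z (\<lambda>z'. G x' (b # Y) z')))"
    by (rule linear_relation_signed[where b = 1 and a = "lie_deg x * (lie_deg b - 1 + lie_deg d) + gdeg Y * lie_deg d"],
      intro linear_relation_shuf1 linear_relation_fun_shuf assms) simp
  show "linear_relation c l0 l1 l2 (\<lambda>b. sign (lie_deg a + lie_deg x * (lie_deg b - 1 + lie_deg d) + gdeg Y * lie_deg d) *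
      shuf a x (\<lambda>x'. shuf d z (\<lambda>z'. G x' (b # Y) z')))"
    by (rule linear_relation_signed[where b = "lie_deg x" and a = "lie_deg a + lie_deg x * (lie_deg d - 1) + gdeg Y * lie_deg d"],
      intro linear_relation_fun_shuf assms) (simp add: algebra_simps)
  show "linear_relation c l0 l1 l2 (\<lambda>d. sign (lie_deg a + lie_deg x * (lie_deg b - 1 + lie_deg d) + gdeg Y * lie_deg d) *
      shuf a x (\<lambda>x'. shuf d z (\<lambda>z'. G x' (b # Y) z')))"
    by (rule linear_relation_signed[where b = "lie_deg x + gdeg Y" and a = "lie_deg a + lie_deg x * (lie_deg b - 1)"],
      intro linear_relation_fun_shuf linear_relation_shuf1 assms) (simp add: algebra_simps)
qed

end

context graded_space
begin

lemma multilinear_iff: "multilinear f \<longleftrightarrow> (\<forall>s n c a b. a \<in> E s n \<longrightarrow> b \<in> E s n \<longrightarrow>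
    linear_relation c (s, n, scale c a + b) (s, n, a) (s, n, b) f)"
  by (auto simp: multilinear_def linear_relation_def)

text \<open>
  Outside \<open>bwords E\<close> the values of \<open>\<gamma>\<close> are unconstrained and are replaced by 0.
\<close>

definition coletter :: "('v bword \<Rightarrow> 'v) \<Rightarrow> 'v bword \<Rightarrow> 'v letter" where
  "coletter \<gamma> Y = (cdeg Y, gdeg Y + 3, if Y \<in> bwords E then \<gamma> Y else 0)"

lemma degree_compatible_coletter: "degree_compatible (coletter \<gamma>)"
  by (simp add: degree_compatible_def coletter_def)

text \<open>All terms of one generating relation share their degrees, length and number of blocks.
  This is why a map may be defined separately for each length and conformal degree and still respect
  the relations.\<close>

lemma coalgebra_rel_homogeneous:
  assumes "x \<in> coalgebra_rel scale E"
  obtains s n l t where "\<And>Y. Y \<in> Poly_Mapping.keys x \<Longrightarrow>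
    Y \<in> bwords E \<and> cdeg Y = s \<and> gdeg Y = n \<and> blen Y = l \<and> length Y = t"
proof -
  let ?P = "\<lambda>s n l t Y. cdeg Y = s \<and> gdeg Y = n \<and> blen Y = l \<and> length Y = t"
  have diff: "Y \<in> Poly_Mapping.keys (basis A - cscale c (basis B)) \<Longrightarrow> Y = A \<or> Y = B" for Y A B and c :: 'k
    by (auto simp: in_keys_iff lookup_minus lookup_cscale lookup_single when_def split: if_splits)
  have diff2: "Y \<in> Poly_Mapping.keys (basis A - basis B - basis C :: _ \<Rightarrow>\<^sub>0 'k) \<Longrightarrow> Y = A \<or> Y = B \<or> Y = C" for Y A B C
    by (auto simp: in_keys_iff lookup_minus lookup_single when_def split: if_splits)
  have "\<exists>s n l t. \<forall>Y\<in>Poly_Mapping.keys x. ?P s n l t Y"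
    using assms
  proof cases
    case (additive X p s n a q Y b)
    let ?X = "X @ [p @ [(s, n, a)] @ q] @ Y"
    have "\<forall>Z\<in>Poly_Mapping.keys x. ?P (cdeg ?X) (gdeg ?X) (blen ?X) (length ?X) Z"
      unfolding additive(1) by (auto dest!: diff2 simp: cdeg_def blen_def)
    then show ?thesis by blast
  next
    case (homogeneous X p s n a q Y c)
    let ?X = "X @ [p @ [(s, n, a)] @ q] @ Y"
    have "\<forall>Z\<in>Poly_Mapping.keys x. ?P (cdeg ?X) (gdeg ?X) (blen ?X) (length ?X) Z"
      unfolding homogeneous(1) by (auto dest!: diff simp: cdeg_def blen_def)
    then show ?thesis by blast
  next
    case (shuffle X u w Y)
    let ?X = "X @ [u @ w] @ Y"
    have "shuf u w (\<lambda>x. basis (X @ [x] @ Y)) \<in> {y :: _ \<Rightarrow>\<^sub>0 'k. Poly_Mapping.keys y \<subseteq>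
        {Z. ?P (cdeg ?X) (gdeg ?X) (blen ?X) (length ?X) Z}}"
    proof (rule shuf_closed[OF additive_subgroup_keys])
      fix v
      assume m: "mset v = mset u + mset w"
      then have l: "length v = length u + length w"
        by (metis size_mset size_union)
      have c: "sum_list (map fst v) = sum_list (map fst u) + sum_list (map fst w)"
        using m by (metis mset_map sum_mset_sum_list sum_list_append map_append mset_append)
      show "basis (X @ [v] @ Y) \<in> {y :: _ \<Rightarrow>\<^sub>0 'k. Poly_Mapping.keys y \<subseteq>
        {Z. ?P (cdeg ?X) (gdeg ?X) (blen ?X) (length ?X) Z}}"
        using m l c by (simp add: cdeg_def blen_def lie_deg_mset)
    qed
    then have "\<forall>Z\<in>Poly_Mapping.keys x. ?P (cdeg ?X) (gdeg ?X) (blen ?X) (length ?X) Z"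
      unfolding shuffle(1) chain.lin_ext_shuffle by blast
    then show ?thesis by blast
  next
    case (commute X u w Y)
    let ?X = "X @ [u, w] @ Y"
    have "\<forall>Z\<in>Poly_Mapping.keys x. ?P (cdeg ?X) (gdeg ?X) (blen ?X) (length ?X) Z"
      unfolding commute(1) by (auto dest!: diff simp: cdeg_def blen_def)
    then show ?thesis by blast
  qed
  then show ?thesis
    using that coalgebra_rel_chains[OF assms] keys_chainsD by metis
qed

definition letter_linear :: "('v letter \<Rightarrow> 'k) \<Rightarrow> bool" where
  "letter_linear f \<longleftrightarrow> (\<forall>s n c a b. a \<in> E s n \<longrightarrow> b \<in> E s n \<longrightarrow> f (s, n, scale c a + b) = c * f (s, n, a) + f (s, n, b))"

lemma letter_linear_0: "letter_linear f \<Longrightarrow> f (s, n, 0) = 0"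
proof -
  assume "letter_linear f"
  then have "f (s, n, scale (- 1) 0 + 0) = - 1 * f (s, n, 0) + f (s, n, 0)"
    unfolding letter_linear_def using zero_E by blast
  then show ?thesis
    by simp
qed

lemma letter_linear_lin_ext:
  assumes f: "letter_linear f" and g: "\<And>w. w \<in> Poly_Mapping.keys x \<Longrightarrow> g w \<in> E s n"
  shows "f (s, n, lin_ext scale g x) = lin_ext (*) (\<lambda>w. f (s, n, g w)) x"
proof -
  have "A \<subseteq> Poly_Mapping.keys x \<Longrightarrow> finite A \<Longrightarrow> (\<Sum>w\<in>A. scale (Poly_Mapping.lookup x w) (g w)) \<in> E s n \<and>
     f (s, n, \<Sum>w\<in>A. scale (Poly_Mapping.lookup x w) (g w)) = (\<Sum>w\<in>A. Poly_Mapping.lookup x w * f (s, n, g w))" for A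
    by (rotate_tac 1, induction A rule: finite_induct)
      (use f g in \<open>simp_all add: zero_E letter_linear_0 letter_linear_def subspace_add subspace_scale subspace_E\<close>)
  from this[OF order.refl] show ?thesis
    by (simp add: lin_ext_def)
qed

text \<open>On a homogeneous relation all letters \<open>coletter \<gamma> Y\<close> carry the same
  bidegree, so \<open>f\<close> is linear in the vector and the vanishing of \<gamma> on relations
  applies.\<close>

lemma cochain_coletter:
  assumes \<gamma>: "cogenerator_map scale E \<gamma>" and f: "letter_linear f"
  shows "cochain (\<lambda>Y. f (coletter \<gamma> Y))"
proof -
  have "lin_ext (*) (\<lambda>Y. f (cdeg Y, gdeg Y + 3, \<gamma> Y)) x = 0" if x: "x \<in> coalgebra_rel scale E" for x
  proof -
    obtain s n where k: "\<And>Y. Y \<in> Poly_Mapping.keys x \<Longrightarrow> Y \<in> bwords E \<and> cdeg Y = s \<and> gdeg Y = n"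
      using coalgebra_rel_homogeneous[OF x] by metis
    have "lin_ext (*) (\<lambda>Y. f (cdeg Y, gdeg Y + 3, \<gamma> Y)) x = lin_ext (*) (\<lambda>Y. f (s, n + 3, \<gamma> Y)) x"
      by (rule lin_ext_cong) (simp add: k)
    also have "\<dots> = f (s, n + 3, lin_ext scale \<gamma> x)"
      by (rule letter_linear_lin_ext[OF f, symmetric]) (use \<gamma> k in \<open>auto simp: cogenerator_map_def\<close>)
    also have "lin_ext scale \<gamma> x = 0"
      using \<gamma> x chain.span_base by (auto simp: cogenerator_map_def relations_def)
    finally show ?thesis
      by (simp add: letter_linear_0[OF f])
  qed
  from cochain_restrict[OF this]
  have "cochain (\<lambda>X. if X \<in> bwords E then f (cdeg X, gdeg X + 3, \<gamma> X) else 0)"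
    by simp
  moreover have "(\<lambda>X. if X \<in> bwords E then f (cdeg X, gdeg X + 3, \<gamma> X) else 0) = (\<lambda>Y. f (coletter \<gamma> Y))"
    by (auto simp: coletter_def letter_linear_0[OF f])
  ultimately show ?thesis
    by simp
qed

end

section \<open>Supports of chains, coproducts and cobrackets\<close>

lemma keys_subspace: "chain.subspace {y :: 'a \<Rightarrow>\<^sub>0 'k::field. Poly_Mapping.keys y \<subseteq> A}"
proof (rule chain.subspaceI)
  fix x y :: "'a \<Rightarrow>\<^sub>0 'k" and c
  assume x: "x \<in> {y. Poly_Mapping.keys y \<subseteq> A}"
  show "cscale c x \<in> {y. Poly_Mapping.keys y \<subseteq> A}"
    using x by (auto simp: in_keys_iff lookup_cscale subset_iff)
  assume y: "y \<in> {y. Poly_Mapping.keys y \<subseteq> A}"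
  show "x + y \<in> {y. Poly_Mapping.keys y \<subseteq> A}"
    using Poly_Mapping.keys_add[of x y] x y by auto
qed simp

lemma keys_lin_ext:
  assumes "\<And>w. w \<in> Poly_Mapping.keys x \<Longrightarrow> Poly_Mapping.keys (f w) \<subseteq> A"
  shows "Poly_Mapping.keys (lin_ext cscale f x) \<subseteq> A"
proof -
  have "lin_ext cscale f x \<in> {y. Poly_Mapping.keys y \<subseteq> A}"
    unfolding lin_ext_def
    by (intro chain.subspace_sum[OF keys_subspace] chain.subspace_scale[OF keys_subspace]) (simp add: assms)
  then show ?thesis
    by simp
qed

lemma keys_cscale: "Poly_Mapping.keys x \<subseteq> A \<Longrightarrow> Poly_Mapping.keys (cscale c x) \<subseteq> A"
  using chain.subspace_scale[OF keys_subspace[of A], of x c] by simp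

lemma keys_plus: "Poly_Mapping.keys (x :: 'a \<Rightarrow>\<^sub>0 'k::field) \<subseteq> A \<Longrightarrow> Poly_Mapping.keys y \<subseteq> A \<Longrightarrow> Poly_Mapping.keys (x + y) \<subseteq> A"
  using chain.subspace_add[OF keys_subspace[of A], of x y] by simp

lemma keys_minus: "Poly_Mapping.keys (x :: 'a \<Rightarrow>\<^sub>0 'k::field) \<subseteq> A \<Longrightarrow> Poly_Mapping.keys y \<subseteq> A \<Longrightarrow> Poly_Mapping.keys (x - y) \<subseteq> A"
  using chain.subspace_diff[OF keys_subspace[of A], of x y] by simp

lemma keys_sum: "(\<And>i. i \<in> S \<Longrightarrow> Poly_Mapping.keys (f i :: 'a \<Rightarrow>\<^sub>0 'k::field) \<subseteq> A) \<Longrightarrow> Poly_Mapping.keys (\<Sum>i\<in>S. f i) \<subseteq> A"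
  using chain.subspace_sum[OF keys_subspace[of A], of S f] by simp

lemma keys_chain_tensor:
  assumes "Poly_Mapping.keys x \<subseteq> A" "Poly_Mapping.keys y \<subseteq> B"
  shows "Poly_Mapping.keys (chain_tensor x y) \<subseteq> A \<times> B"
  unfolding chain_tensor_def by (intro keys_lin_ext) (use assms in auto)

lemma nths_bwords: "X \<in> bwords E \<Longrightarrow> nths X I \<noteq> [] \<Longrightarrow> nths X I \<in> bwords E"
  using set_nths_subset[of X I] by (auto simp: bwords_iff)

lemma keys_coproduct:
  assumes "X \<in> bwords E"
  shows "Poly_Mapping.keys (coproduct X) \<subseteq> bwords E \<times> bwords E"
  unfolding coproduct_def
proof (intro keys_sum keys_cscale)
  fix I
  assume I: "I \<in> {I. I \<subseteq> {..<length X} \<and> I \<noteq> {} \<and> I \<noteq> {..<length X}}"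
  then have "nths X I \<noteq> []" "nths X (- I) \<noteq> []"
    by (auto simp: length_0_conv[symmetric] length_nths card_eq_0_iff simp del: length_0_conv)
  then show "Poly_Mapping.keys (basis (nths X I, nths X (- I))) \<subseteq> bwords E \<times> bwords E"
    using nths_bwords[OF assms] by simp
qed

lemma keys_cobracket:
  assumes "X \<in> bwords E"
  shows "Poly_Mapping.keys (cobracket X) \<subseteq> bwords E \<times> bwords E"
  unfolding cobracket_def Let_def
proof (intro keys_sum keys_cscale keys_minus)
  fix k I r
  assume kr: "k \<in> {..<length X}" "r \<in> {0<..<length (X ! k)}"
  have n: "set (nths X J) \<subseteq> set X" for J
    by (rule set_nths_subset)
  have k: "X ! k \<in> set X"
    using kr by simp
  have l: "set (X ! k) \<subseteq> letters E"
    using assms k by (simp add: bwords_iff)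
  have s: "set (take r (X ! k)) \<subseteq> letters E" "set (drop r (X ! k)) \<subseteq> letters E"
    using l set_take_subset[of r "X ! k"] set_drop_subset[of r "X ! k"] by blast+
  have ne: "take r (X ! k) \<noteq> []" "drop r (X ! k) \<noteq> []"
    using kr by auto
  have b: "P @ [u] \<in> bwords E" "[u] @ P \<in> bwords E"
    if "set P \<subseteq> set X" "set u \<subseteq> letters E" "u \<noteq> []" for P u
    using assms that by (auto simp: bwords_iff)
  show "Poly_Mapping.keys (basis (nths X I @ [take r (X ! k)], [drop r (X ! k)] @ nths X (- insert k I))) \<subseteq> bwords E \<times> bwords E"
    "Poly_Mapping.keys (basis (nths X I @ [drop r (X ! k)], [take r (X ! k)] @ nths X (- insert k I))) \<subseteq> bwords E \<times> bwords E"
    using b[OF n s(1) ne(1)] b[OF n s(2) ne(2)] by simp_all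
qed

lemma block_symmetric_add: "block_symmetric f \<Longrightarrow> block_symmetric h \<Longrightarrow> block_symmetric (\<lambda>x. f x + h x)"
  unfolding block_symmetric_def by (metis distrib_left)

lemma extension_Nil: "extension g F [] = 0"
  by (simp add: extension_def lie_extension_def)

context graded_space
begin

text \<open>The dual form of the compatibility of the coextension with \<open>relations\<close>. A
  block that is merged is treated by \<open>lie_extension_shuffle\<close> and
  \<open>linear_relation_slices\<close>; a block that is left alone stands behind the merged word
  and is moved to the front by symmetry.\<close>

lemma cochain_extension:
  assumes \<gamma>: "cogenerator_map scale E \<gamma>" and F: "cochain F"
  shows "cochain (extension (coletter \<gamma>) F)"
proof -
  let ?g = "coletter \<gamma>"
  have s: "block_symmetric F" and sf: "shuffle_free (\<lambda>w. F (w # R))" and ml: "multilinear (\<lambda>w. F (w # R))" for R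
    using F by (auto simp: cochain_def)
  have "letter_linear (\<lambda>l. F ((x @ l # z) # R))" for x z R
    using ml[of R] by (auto simp: letter_linear_def multilinear_def)
  from cochain_coletter[OF \<gamma> this] have
    g1: "block_symmetric (\<lambda>Y. F ((x @ ?g Y # z) # R))" and
    g2: "shuffle_free (\<lambda>w. F ((x @ ?g (w # Y) # z) # R))" and
    g3: "multilinear (\<lambda>w. F ((x @ ?g (w # Y) # z) # R))" for x z R Y
    by (auto simp: cochain_def)
  have "block_symmetric (extension ?g F)"
    unfolding extension_def
    by (intro block_symmetric_split block_symmetric_lie_extension block_symmetric_lie_extension_fun
        g1 block_symmetric_Cons s)
  moreover have "shuffle_free (\<lambda>w. extension ?g F (w # R))" for R
    unfolding extension_def split_blocks.simps signed_field
  proof (intro shuffle_free_add shuffle_free_split_blocks)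
    fix I J
    show "shuffle_free (\<lambda>w. lie_extension ?g (\<lambda>v. F (v # J)) (w # I))"
      unfolding shuffle_free_def
    proof (intro conjI allI impI)
      show "lie_extension ?g (\<lambda>v. F (v # J)) ([] # I) = 0"
        by (simp add: lie_extension_def dec3_def)
      show "shuf u w (\<lambda>w. lie_extension ?g (\<lambda>v. F (v # J)) (w # I)) = 0" if "u \<noteq> []" "w \<noteq> []" for u w
        using degree_compatible_coletter[of \<gamma>] sf g2 that
        by (intro lie_extension_shuffle) (auto simp: degree_compatible_def)
    qed
    have "shuffle_free (\<lambda>w. F (v # w # J))" for v
      unfolding block_symmetric_head[OF s, of v]
      by (rule shuffle_free_signedI[OF sf, where d = "- (lie_deg v - 1)" and e = "lie_deg v - 1"]) (simp add: algebra_simps)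
    then show "shuffle_free (\<lambda>w. sign ((lie_deg w - 1) * gdeg I) * lie_extension ?g (\<lambda>v. F (v # w # J)) I)"
      by (intro shuffle_free_signedI[OF shuffle_free_lie_extension, where d = "- gdeg I" and e = "gdeg I"])
        (simp_all add: algebra_simps)
  qed
  moreover have "multilinear (\<lambda>w. extension ?g F (w # R))" for R
    unfolding multilinear_iff
  proof (intro allI impI)
    fix s n c a b
    assume ab: "a \<in> E s n" "b \<in> E s n"
    let ?lr = "linear_relation c (s, n, scale c a + b) (s, n, a) (s, n, b)"
    have F1: "?lr (\<lambda>w. F (w # R))" for R
      using ml ab unfolding multilinear_iff by blast
    have F2: "?lr (\<lambda>w. F ((x @ ?g (w # Y) # z) # R))" for x Y z R
      using g3 ab unfolding multilinear_iff by blast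
    have x1: "?lr (\<lambda>x. F ((x @ ?g Y # z) # R))" for Y z R
      unfolding linear_relation_def append_assoc append_Cons
      using F1[of R] unfolding linear_relation_def by blast
    have z1: "?lr (\<lambda>z. F ((x @ ?g Y # z) # R))" for Y x R
      unfolding linear_relation_def append_assoc append_Cons
    proof (intro allI)
      fix p q
      show "F ((x @ ?g Y # p @ (s, n, scale c a + b) # q) # R) =
         c * F ((x @ ?g Y # p @ (s, n, a) # q) # R) + F ((x @ ?g Y # p @ (s, n, b) # q) # R)"
        using F1[of R, unfolded linear_relation_def, rule_format, of "x @ ?g Y # p" q] by simp
    qed
    have 1: "?lr (\<lambda>w. lie_extension ?g (\<lambda>v. F (v # J)) (w # I))" for I J
    proof -
      have "?lr (\<lambda>w. slices (w # I) (\<lambda>x Y z. F ((x @ ?g Y # z) # J)))"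
        by (intro linear_relation_slices x1 z1 F2) simp_all
      then show ?thesis
        by (simp add: lie_extension_def del: slices.simps)
    qed
    have "?lr (\<lambda>w. F (v # w # J))" for v J
      unfolding block_symmetric_head[OF s, of v]
      by (rule linear_relation_signed[OF _ _ F1, where a = "- (lie_deg v - 1)" and b = "lie_deg v - 1"])
        (simp_all add: algebra_simps)
    then have 2: "?lr (\<lambda>w. sign ((lie_deg w - 1) * gdeg I) * lie_extension ?g (\<lambda>v. F (v # w # J)) I)" for I J
      by (intro linear_relation_signed[OF _ _ linear_relation_fun_lie_extension, where a = "- gdeg I" and b = "gdeg I"])
        (simp_all add: algebra_simps)
    show "?lr (\<lambda>w. extension ?g F (w # R))"
      unfolding extension_def split_blocks.simps signed_field
      by (intro linear_relation_add linear_relation_fun_split_blocks 1 2) simp_all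
  qed
  ultimately show ?thesis
    by (simp add: cochain_def)
qed

definition bilinear_cochain :: "('v bword \<Rightarrow> 'v bword \<Rightarrow> 'k) \<Rightarrow> bool" where
  "bilinear_cochain B \<longleftrightarrow> (\<forall>Z. cochain (\<lambda>Y. B Y Z)) \<and> (\<forall>Y. cochain (B Y))"

lemma cochain_letter_linear: "cochain F \<Longrightarrow> letter_linear (\<lambda>l. F ((x @ l # z) # R))"
  by (auto simp: cochain_def letter_linear_def multilinear_def)

lemma bilinear_functional_bilinear_cochain:
  assumes \<gamma>: "cogenerator_map scale E \<gamma>" and B: "bilinear_cochain B"
  shows "bilinear_functional (coletter \<gamma>) B"
proof -
  have c: "cochain (\<lambda>Y. B Y Z)" "cochain (B Y)" for Y Z
    using B by (auto simp: bilinear_cochain_def)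
  have "block_symmetric (\<lambda>Y. B ((x @ coletter \<gamma> Y # z) # R) Z)" "block_symmetric (\<lambda>Y. B Z ((x @ coletter \<gamma> Y # z) # R))" for x z R Z
    using cochain_coletter[OF \<gamma> cochain_letter_linear[OF c(1)]]
      cochain_coletter[OF \<gamma> cochain_letter_linear[OF c(2)]] by (auto simp: cochain_def)
  then show ?thesis
    using c unfolding bilinear_functional_def cochain_def by blast
qed

lemma bicochain_bilinear_cochain: "bicochain B \<Longrightarrow> bilinear_cochain B"
  by (simp add: bicochain_def bilinear_cochain_def)

text \<open>With basis vectors as continuation, the operation on functionals becomes the
  coderivation itself; \<open>lin_ext_coext\<close> recovers the former.\<close>

definition coext :: "('v bword \<Rightarrow> 'v) \<Rightarrow> 'v bword \<Rightarrow> ('v bword \<Rightarrow>\<^sub>0 'k)" where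
  "coext \<gamma> X = extension (coletter \<gamma>) basis X"

lemma lin_ext_coext: "lin_ext (*) F (coext \<gamma> X) = extension (coletter \<gamma>) F X" for F :: "'v bword \<Rightarrow> 'k"
  by (simp add: coext_def extension_hom[OF field.additive_fun_lin_ext])

lemma lin_ext_coext_vector: "lin_ext scale F (coext \<gamma> X) = extension (coletter \<gamma>) F X"
  by (simp add: coext_def extension_hom[OF additive_fun_lin_ext])

lemma coletter_letters:
  assumes "cogenerator_map scale E \<gamma>"
  shows "coletter \<gamma> Y \<in> letters E"
  using assms by (auto simp: coletter_def letters_def cogenerator_map_def zero_E)

lemma cdeg_concat: "cdeg X = sum_mset (image_mset fst (mset (concat X)))"
  by (simp add: cdeg_def sum_mset_sum_list[symmetric])

lemma keys_coext:
  assumes \<gamma>: "cogenerator_map scale E \<gamma>" and X: "X \<in> bwords E"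
  shows "Poly_Mapping.keys (coext \<gamma> X) \<subseteq>
    {Y \<in> bwords E. gdeg Y = gdeg X + 1 \<and> cdeg Y = cdeg X \<and> blen Y \<le> blen X}"
proof -
  let ?g = "coletter \<gamma>"
  let ?A = "{Y \<in> bwords E. gdeg Y = gdeg X + 1 \<and> cdeg Y = cdeg X \<and> blen Y \<le> blen X}"
  have "split_blocks X (\<lambda>K R. lie_extension ?g (\<lambda>v. basis (v # R)) K) \<in> {y :: _ \<Rightarrow>\<^sub>0 'k. Poly_Mapping.keys y \<subseteq> ?A}"
  proof (rule split_blocks_closed[OF additive_subgroup_keys])
    fix K R
    assume KR: "mset X = mset K + mset R"
    have sX: "set X = set K \<union> set R"
      using KR by (metis set_mset_mset set_mset_union)
    have cX: "mset (concat X) = mset (concat K) + mset (concat R)"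
      using arg_cong[OF KR, of "\<lambda>M. sum_mset (image_mset mset M)"] by (simp add: mset_concat sum_mset_sum_list[symmetric] flip: mset_map)
    have lX: "length X = length K + length R"
      using KR by (metis size_mset size_union)
    have gX: "gdeg X = gdeg K + gdeg R"
      using KR by (simp add: gdeg_mset)
    show "lie_extension ?g (\<lambda>v. basis (v # R)) K \<in> {y :: _ \<Rightarrow>\<^sub>0 'k. Poly_Mapping.keys y \<subseteq> ?A}"
    proof (cases "K = []")
      case False
      have "slices K (\<lambda>x Y z. basis ((x @ ?g Y # z) # R)) \<in> {y :: _ \<Rightarrow>\<^sub>0 'k. Poly_Mapping.keys y \<subseteq> ?A}"
      proof (rule slices_closed[OF additive_subgroup_keys])
        fix x Y z
        assume m: "mset (concat K) = mset x + mset (concat Y) + mset z" and l: "length Y = length K" and ne: "[] \<notin> set Y"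
        have st: "set (concat K) = set x \<union> set (concat Y) \<union> set z"
          using m by (metis set_mset_mset set_mset_union)
        have g: "?g Y \<in> letters E"
          by (rule coletter_letters[OF \<gamma>])
        have xz: "set x \<subseteq> letters E" "set z \<subseteq> letters E"
          using X st sX by (auto simp: bwords_iff)
        have "(x @ ?g Y # z) # R \<in> bwords E"
          using X sX g xz by (auto simp: bwords_iff)
        moreover have "gdeg ((x @ ?g Y # z) # R) = gdeg X + 1"
        proof -
          have "lie_deg (concat K) = lie_deg x + lie_deg (concat Y) + lie_deg z"
            using m by (simp add: lie_deg_mset del: mset_concat)
          then show ?thesis
            using degree_compatible_coletter[of \<gamma>] l gX
            by (simp add: degree_compatible_def gdeg_eq_concat)
        qed
        moreover have "cdeg ((x @ ?g Y # z) # R) = cdeg X"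
        proof -
          have "cdeg ((x @ ?g Y # z) # R) = sum_list (map fst x) + cdeg Y + sum_list (map fst z) + cdeg R"
            by (simp add: cdeg_def coletter_def)
          also have "\<dots> = cdeg X"
            unfolding cdeg_concat cX m by (simp add: sum_mset_sum_list[symmetric] del: mset_concat)
          finally show ?thesis .
        qed
        moreover have "blen ((x @ ?g Y # z) # R) \<le> blen X"
        proof -
          have "size (mset (concat X)) = length x + length (concat Y) + length z + length (concat R)"
            unfolding cX m by simp
          \<comment> \<open>The new letter replaces at least one old letter, since each middle piece
            is nonempty. Hence the length does not grow.\<close>
          moreover have "length (concat Y) \<ge> 1"
            using l ne False by (cases Y) (auto simp: Suc_le_eq)
          ultimately show ?thesis
            by (simp add: blen_def)
        qed
        ultimately show "basis ((x @ ?g Y # z) # R) \<in> {y :: _ \<Rightarrow>\<^sub>0 'k. Poly_Mapping.keys y \<subseteq> ?A}"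
          by simp
      qed
      then show ?thesis
        using False by (simp add: lie_extension_def)
    qed (simp add: lie_extension_def)
  qed
  then show ?thesis
    by (simp add: coext_def extension_def)
qed

lemma coext_relations:
  assumes \<gamma>: "cogenerator_map scale E \<gamma>" and x: "x \<in> relations scale E"
  shows "lin_ext cscale (coext \<gamma>) x \<in> relations scale E"
proof (rule in_relationsI)
  show "lin_ext cscale (coext \<gamma>) x \<in> chains E"
    using keys_coext[OF \<gamma>] relations_chains[OF x] by (intro chains_lin_ext) (force simp: chains_def)
  fix F
  assume "cochain F"
  from cochain_relations[OF cochain_extension[OF \<gamma> this] x]
  show "lin_ext (*) F (lin_ext cscale (coext \<gamma>) x) = 0"
    by (simp add: field.lin_ext_lin_ext lin_ext_coext)
qed

text \<open>Evaluated on bicochains, the two rules become \<open>extension_split_blocks\<close> and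
  \<open>extension_cobracket_sum\<close>.\<close>

lemma coderivation_coext:
  assumes \<gamma>: "cogenerator_map scale E \<gamma>"
  shows "coderivation scale E (coext \<gamma>)"
proof -
  let ?e = "extension (coletter \<gamma>)"
  let ?T = "\<lambda>c. \<lambda>(Y, Z). chain_tensor (coext \<gamma> Y) (basis Z) + cscale (c (gdeg Y)) (chain_tensor (basis Y) (coext \<gamma> Z))"
  have kT: "Poly_Mapping.keys (?T c p) \<subseteq> bwords E \<times> bwords E" if pE: "p \<in> bwords E \<times> bwords E" for p and c :: "int \<Rightarrow> 'k"
  proof -
    obtain Y Z where p: "p = (Y, Z)" "Y \<in> bwords E" "Z \<in> bwords E"
      using pE by blast
    have k: "Poly_Mapping.keys (coext \<gamma> Y) \<subseteq> bwords E" "Poly_Mapping.keys (coext \<gamma> Z) \<subseteq> bwords E"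
      using keys_coext[OF \<gamma> p(2)] keys_coext[OF \<gamma> p(3)] by blast+
    show ?thesis
      unfolding p(1) prod.case
      by (intro keys_plus keys_cscale keys_chain_tensor k) (simp_all add: p)
  qed
  have eT: "lin_ext (*) (\<lambda>(Y, Z). B Y Z) (?T c p) = (\<lambda>(Y, Z). ?e (\<lambda>Y'. B Y' Z) Y + c (gdeg Y) * ?e (B Y) Z) p"
    for p and c :: "int \<Rightarrow> 'k" and B
    by (simp add: split_beta field.lin_ext_add field.lin_ext_cscale lin_ext_chain_tensor lin_ext_coext)
  have eT2: "lin_ext (*) (\<lambda>(Y, Z). B Y Z) (?T (\<lambda>n. sign (n + 1)) p) =
      (\<lambda>(Y, Z). ?e (\<lambda>Y'. B Y' Z) Y + sign (gdeg Y + 1) * ?e (B Y) Z) p" for p B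
    by (rule eT)
  have z: "supported F \<Longrightarrow> F [] = 0" "supported F \<Longrightarrow> F ([] # X) = 0" for F X
    by (simp_all add: supported_def bwords_iff)
  show ?thesis
    unfolding coderivation_def
  proof (intro conjI ballI)
    fix X assume X: "X \<in> bwords E"
    note k = keys_coext[OF \<gamma> X]
    show "coext \<gamma> X \<in> chains E"
      using k by (auto simp: chains_def)
    fix Y assume "Y \<in> Poly_Mapping.keys (coext \<gamma> X)"
    then show "gdeg Y = gdeg X + 1" "cdeg Y = cdeg X"
      using k by auto
  next
    show "lin_ext cscale (coext \<gamma>) x \<in> relations scale E" if "x \<in> relations scale E" for x
      by (rule coext_relations[OF \<gamma> that])
  next
    fix X assume X: "X \<in> bwords E"
    note k = keys_coext[OF \<gamma> X]
    show "lin_ext cscale coproduct (coext \<gamma> X) - lin_ext cscale (?T sign) (coproduct X) \<in> relations2 scale E"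
    proof (rule in_relations2I)
      show "Poly_Mapping.keys (lin_ext cscale coproduct (coext \<gamma> X) - lin_ext cscale (?T sign) (coproduct X)) \<subseteq> bwords E \<times> bwords E"
        using k keys_coproduct[OF X] by (intro keys_minus keys_lin_ext kT keys_coproduct) auto
      fix B assume B: "bicochain B"
      have B0: "B [] Y = 0" "B Y [] = 0" for Y
        using B z unfolding bicochain_def by blast+
      have "lin_ext (*) (\<lambda>(Y, Z). B Y Z) (lin_ext cscale coproduct (coext \<gamma> X)) = ?e (\<lambda>Z. split_blocks Z B) X"
        by (simp add: field.lin_ext_lin_ext lin_ext_coproduct[of B, OF B0] lin_ext_coext)
      moreover have "lin_ext (*) (\<lambda>(Y, Z). B Y Z) (lin_ext cscale (?T sign) (coproduct X)) =
          split_blocks X (\<lambda>Y Z. ?e (\<lambda>Y'. B Y' Z) Y + sign (gdeg Y) * ?e (B Y) Z)"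
      proof -
        have 0: "?e (\<lambda>Y'. B Y' []) Y = 0" "?e (B []) Y = 0" for Y
          using additive_op_0[OF additive_op_extension] by (simp_all add: B0 B0[abs_def])
        show ?thesis
          unfolding field.lin_ext_lin_ext eT
          by (rule lin_ext_coproduct) (simp_all add: extension_Nil 0)
      qed
      ultimately show "lin_ext (*) (\<lambda>(Y, Z). B Y Z) (lin_ext cscale coproduct (coext \<gamma> X) - lin_ext cscale (?T sign) (coproduct X)) = 0"
        by (simp add: field.lin_ext_diff extension_split_blocks[OF degree_compatible_coletter])
    qed
  next
    fix X assume X: "X \<in> bwords E"
    note k = keys_coext[OF \<gamma> X]
    show "lin_ext cscale cobracket (coext \<gamma> X) - lin_ext cscale (?T (\<lambda>n. sign (n + 1))) (cobracket X) \<in> relations2 scale E"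
    proof (rule in_relations2I)
      show "Poly_Mapping.keys (lin_ext cscale cobracket (coext \<gamma> X) - lin_ext cscale (?T (\<lambda>n. sign (n + 1))) (cobracket X)) \<subseteq> bwords E \<times> bwords E"
        using k keys_cobracket[OF X] by (intro keys_minus keys_lin_ext kT keys_cobracket) auto
      fix B assume B: "bicochain B"
      have B0: "B ([] # Y) Z = 0" "B Y ([] # Z) = 0" for Y Z
        using B z unfolding bicochain_def by blast+
      have c: "cochain (\<lambda>Y. B Y Z)" "cochain (B Y)" for Y Z
        using B by (auto simp: bicochain_def)
      have s: "block_symmetric (\<lambda>Y. B Y Z)" for Z
        using c by (simp add: cochain_def)
      have "lin_ext (*) (\<lambda>(Y, Z). B Y Z) (lin_ext cscale cobracket (coext \<gamma> X)) = ?e (\<lambda>Z. cobracket_sum Z B) X"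
        by (simp add: field.lin_ext_lin_ext lin_ext_cobracket[of B, OF s B0] lin_ext_coext)
      moreover have "lin_ext (*) (\<lambda>(Y, Z). B Y Z) (lin_ext cscale (?T (\<lambda>n. sign (n + 1))) (cobracket X)) =
          cobracket_sum X (\<lambda>Y Z. ?e (\<lambda>Y'. B Y' Z) Y + sign (gdeg Y + 1) * ?e (B Y) Z)"
      proof -
        have ce: "cochain (?e (\<lambda>Y'. B Y' Z))" "cochain (?e (B Y))" for Y Z
          by (intro cochain_extension[OF \<gamma>] c)+
        have 0: "?e (\<lambda>Y'. B Y' ([] # Z)) Y = 0" "?e (B ([] # Z)) Y = 0" for Y Z
          using additive_op_0[OF additive_op_extension] by (simp_all add: B0 B0[abs_def])
        have 1: "cochain F \<Longrightarrow> F ([] # Y) = 0" for F Y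
          unfolding cochain_def using shuffle_free_Nil by blast
        have "block_symmetric (\<lambda>Y. ?e (\<lambda>Y'. B Y' Z) Y + sign (gdeg Y + 1) * ?e (B Y) Z)" for Z
        proof -
          have "block_symmetric (\<lambda>Y. ?e (B Y) Z)"
            unfolding extension_def
            by (intro block_symmetric_split_blocks block_symmetric_lie_extension_fun s)
          from block_symmetric_signedI[OF this, of "\<lambda>Y. gdeg Y + 1" 1 1]
          have "block_symmetric (\<lambda>Y. sign (gdeg Y + 1) * ?e (B Y) Z)"
            by (simp add: add.commute)
          moreover have "block_symmetric (?e (\<lambda>Y'. B Y' Z))"
            using ce by (simp add: cochain_def)
          ultimately show ?thesis
            by (rule block_symmetric_add[rotated])
        qed
        then show ?thesis
          unfolding field.lin_ext_lin_ext eT2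
          by (rule lin_ext_cobracket) (simp_all add: 0 1[OF ce(1)] 1[OF ce(2)])
      qed
      ultimately show "lin_ext (*) (\<lambda>(Y, Z). B Y Z) (lin_ext cscale cobracket (coext \<gamma> X) - lin_ext cscale (?T (\<lambda>n. sign (n + 1))) (cobracket X)) = 0"
        by (simp add: field.lin_ext_diff extension_cobracket_sum[OF degree_compatible_coletter bilinear_functional_bilinear_cochain[OF \<gamma> bicochain_bilinear_cochain[OF B]]])
    qed
  qed
qed

end

section \<open>Primitive elements\<close>

text \<open>
  The dual of the Dynkin operator \<open>a\<^sub>1 \<cdots> a\<^sub>n \<mapsto> [a\<^sub>1, [a\<^sub>2, \<dots>]]\<close>, which is multiplication by \<open>n\<close> on
  Lie elements.
\<close>

lemma shuf_snoc:
  "shuf (u @ [c]) (w @ [d]) F =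
    (sign (letter_deg c * (lie_deg w + letter_deg d)) * shuf u (w @ [d]) (\<lambda>x. F (x @ [c])) +
     shuf (u @ [c]) w (\<lambda>x. F (x @ [d])) :: 'k::field)"
proof (induction "length u + length w" arbitrary: u w F rule: less_induct)
  case less
  have 1: "shuf [c] (w @ [d]) F = sign (letter_deg c * (lie_deg w + letter_deg d)) * F (w @ [d, c]) +
     shuf [c] w (\<lambda>x. F (x @ [d]))" for w and F :: "_ \<Rightarrow> 'k"
    by (induction w arbitrary: F) (simp_all add: op_simps)
  have 2: "shuf (u @ [c]) [d] F = sign (letter_deg c * letter_deg d) * shuf u [d] (\<lambda>x. F (x @ [c])) +
     F (u @ [c, d])" for u and F :: "_ \<Rightarrow> 'k"
    by (induction u arbitrary: F) (simp_all add: op_simps)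
  show ?case
  proof (cases "u = [] \<or> w = []")
    case True
    then show ?thesis
      using 1 2 by auto
  next
    case False
    then obtain a u' b w' where e: "u = a # u'" "w = b # w'"
      by (metis list.exhaust)
    have i1: "shuf (u' @ [c]) (b # w' @ [d]) G = sign (letter_deg c * (letter_deg b + lie_deg w' + letter_deg d)) * shuf u' (b # w' @ [d]) (\<lambda>x. G (x @ [c])) +
     shuf (u' @ [c]) (b # w') (\<lambda>x. G (x @ [d]))" for G :: "_ \<Rightarrow> 'k"
      using less[of u' w G] by (simp add: e)
    have i2: "shuf (a # u' @ [c]) (w' @ [d]) G = sign (letter_deg c * (lie_deg w' + letter_deg d)) * shuf (a # u') (w' @ [d]) (\<lambda>x. G (x @ [c])) +
     shuf (a # u' @ [c]) w' (\<lambda>x. G (x @ [d]))" for G :: "_ \<Rightarrow> 'k"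
      using less[of u w' G] by (simp add: e)
    show ?thesis
      by (simp add: e i1 i2) (simp add: op_simps)
  qed
qed

text \<open>A word occurring in \<open>[a, y] = a y - (sign) y a\<close> has the outermost letter
  \<open>a\<close> as its first or as its last letter; the two terms of the recursion correspond to
  these cases.\<close>

function dynkin :: "'v lword \<Rightarrow> ('v lword \<Rightarrow> 'k::field) \<Rightarrow> 'k" where
  "dynkin w f = (if w = [] then 0 else if tl w = [] then f w else
     dynkin (tl w) (\<lambda>x. f (hd w # x)) -
     sign (lie_deg (butlast w) * letter_deg (last w)) * dynkin (butlast w) (\<lambda>x. f (last w # x)))"
  by auto
termination
  by (relation "measure (\<lambda>(w, f). length w)") auto

declare dynkin.simps [simp del]

lemma dynkin_Nil [simp]: "dynkin [] f = 0"
  by (simp add: dynkin.simps)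

lemma dynkin_single [simp]: "dynkin [a] f = f [a]"
  by (simp add: dynkin.simps)

lemma dynkin_rec: "length w \<ge> 2 \<Longrightarrow> dynkin w f = dynkin (tl w) (\<lambda>x. f (hd w # x)) -
     sign (lie_deg (butlast w) * letter_deg (last w)) * dynkin (butlast w) (\<lambda>x. f (last w # x))"
  by (subst dynkin.simps) (cases w; auto)

text \<open>This holds for every \<open>f\<close>. The first and the last letter of a shuffle come
  from the ends of \<open>u\<close> or \<open>w\<close>; removing one leaves a shorter shuffle, zero
  by induction unless a factor has become empty. That happens for a one-letter factor, and then the
  front and the back term cancel.\<close>

lemma dynkin_shuffle:
  fixes f :: "'v lword \<Rightarrow> 'k::field"
  shows "u \<noteq> [] \<Longrightarrow> w \<noteq> [] \<Longrightarrow> shuf u w (\<lambda>x. dynkin x f) = 0"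
proof (induction "length u + length w" arbitrary: u w f rule: less_induct)
  case less
  obtain a u' b w' where e: "u = a # u'" "w = b # w'"
    using less.prems by (metis list.exhaust)
  obtain c u'' d w'' where e': "u = u'' @ [c]" "w = w'' @ [d]"
    using less.prems by (metis rev_exhaust)
  have n: "length u'' = length u'" "length w'' = length w'"
    using e e' by (metis length_Cons length_append_singleton nat.inject)+
  have IH: "shuf p q (\<lambda>x. dynkin x h) = (if p = [] then dynkin q h else if q = [] then dynkin p h else 0)"
    if "length p + length q < length u + length w" for p q and h :: "'v lword \<Rightarrow> 'k"
    using less.hyps[OF that] by simp
  have "shuf u w (\<lambda>x. dynkin x f) = shuf u w (\<lambda>x. dynkin (tl x) (\<lambda>y. f (hd x # y)) -
     sign (lie_deg (butlast x) * letter_deg (last x)) * dynkin (butlast x) (\<lambda>y. f (last x # y)))"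
  proof (rule shuf_cong)
    fix x
    assume "mset x = mset u + mset w"
    then have "length x = length u + length w"
      by (metis size_mset size_union)
    then show "dynkin x f = dynkin (tl x) (\<lambda>y. f (hd x # y)) -
     sign (lie_deg (butlast x) * letter_deg (last x)) * dynkin (butlast x) (\<lambda>y. f (last x # y))"
      by (intro dynkin_rec) (simp add: e)
  qed
  also have "\<dots> = shuf u w (\<lambda>x. dynkin (tl x) (\<lambda>y. f (hd x # y))) -
     shuf u w (\<lambda>x. sign (lie_deg (butlast x) * letter_deg (last x)) * dynkin (butlast x) (\<lambda>y. f (last x # y)))"
    by (rule op_diff)
  also have "shuf u w (\<lambda>x. dynkin (tl x) (\<lambda>y. f (hd x # y))) =
     shuf u' w (\<lambda>x. dynkin x (\<lambda>y. f (a # y))) + sign (lie_deg u * letter_deg b) * shuf u w' (\<lambda>x. dynkin x (\<lambda>y. f (b # y)))"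
    by (simp add: e)
  also have "shuf u w (\<lambda>x. sign (lie_deg (butlast x) * letter_deg (last x)) * dynkin (butlast x) (\<lambda>y. f (last x # y))) =
     sign (letter_deg c * lie_deg w) * (sign ((lie_deg u'' + lie_deg w) * letter_deg c) * shuf u'' w (\<lambda>x. dynkin x (\<lambda>y. f (c # y)))) +
     sign ((lie_deg u + lie_deg w'') * letter_deg d) * shuf u w'' (\<lambda>x. dynkin x (\<lambda>y. f (d # y)))"
    unfolding e' shuf_snoc by (simp add: op_push)
  also have "shuf u' w (\<lambda>x. dynkin x (\<lambda>y. f (a # y))) = (if u' = [] then dynkin w (\<lambda>y. f (a # y)) else 0)"
    using less.prems by (subst IH) (auto simp: e)
  also have "shuf u w' (\<lambda>x. dynkin x (\<lambda>y. f (b # y))) = (if w' = [] then dynkin u (\<lambda>y. f (b # y)) else 0)"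
    using less.prems by (subst IH) (auto simp: e)
  also have "shuf u'' w (\<lambda>x. dynkin x (\<lambda>y. f (c # y))) = (if u' = [] then dynkin w (\<lambda>y. f (c # y)) else 0)"
    using less.prems n by (subst IH) (auto simp: e)
  also have "shuf u w'' (\<lambda>x. dynkin x (\<lambda>y. f (d # y))) = (if w' = [] then dynkin u (\<lambda>y. f (d # y)) else 0)"
    using less.prems n by (subst IH) (auto simp: e)
  finally have "shuf u w (\<lambda>x. dynkin x f) = (if u' = [] then dynkin w (\<lambda>y. f (a # y)) else 0) +
      sign (lie_deg u * letter_deg b) * (if w' = [] then dynkin u (\<lambda>y. f (b # y)) else 0) -
      (sign (letter_deg c * lie_deg w) * (sign ((lie_deg u'' + lie_deg w) * letter_deg c) * (if u' = [] then dynkin w (\<lambda>y. f (c # y)) else 0)) +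
     sign ((lie_deg u + lie_deg w'') * letter_deg d) * (if w' = [] then dynkin u (\<lambda>y. f (d # y)) else 0))" .
  moreover have "u' = [] \<Longrightarrow> u'' = [] \<and> c = a" "w' = [] \<Longrightarrow> w'' = [] \<and> d = b"
    using e e' n by auto
  ultimately show ?case
    by (cases "u' = []"; cases "w' = []") (simp_all add: op_simps)
qed

text \<open>The sign of the antipode of the shuffle Hopf algebra: the Koszul sign of reversing the
  word, times -1 for each letter.\<close>

fun rev_sign :: "'v lword \<Rightarrow> 'k::field" where
  "rev_sign [] = 1"
| "rev_sign (c # z) = - sign (letter_deg c * lie_deg z) * rev_sign z"

lemma rev_sign_snoc: "rev_sign (z @ [c]) = (- sign (lie_deg z * letter_deg c) * rev_sign z :: 'k::field)"
  by (induction z) (simp_all add: op_simps)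

lemma dec_snoc: "dec (w @ [c]) F = dec w (\<lambda>x y. F x (y @ [c])) + F (w @ [c]) []"
  by (induction w arbitrary: F) (simp_all add: add_ac)

lemma shuf_rev_front:
  assumes "u \<noteq> [] \<or> v \<noteq> []"
  shows "shuf u (rev v) f = (if u = [] then 0 else shuf (tl u) (rev v) (\<lambda>x. f (hd u # x))) +
    (if v = [] then 0 else sign (lie_deg u * letter_deg (last v)) * shuf u (rev (butlast v)) (\<lambda>x. f (last v # x) :: 'k::field))"
proof (cases v rule: rev_cases)
  case Nil
  then show ?thesis
    using assms by (cases u) simp_all
next
  case (snoc v' c)
  then show ?thesis
    by (cases u) (simp_all add: sign_simps)
qed

text \<open>A shuffle of \<open>v1\<close> with the reversed \<open>v2\<close> starts with the first
  or the last letter of \<open>v\<close>. Collecting the terms by that letter gives the same sum for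
  \<open>v\<close> without it, zero by induction; for a single letter the two terms cancel.\<close>

lemma antipode: "v \<noteq> [] \<Longrightarrow> dec v (\<lambda>v1 v2. rev_sign v2 * shuf v1 (rev v2) f) = (0::'k::field)"
proof (induction "length v" arbitrary: v f rule: less_induct)
  case less
  obtain a v' where v': "v = a # v'"
    using less.prems by (metis list.exhaust)
  obtain c v'' where v'': "v = v'' @ [c]"
    using less.prems by (metis rev_exhaust)
  have n: "length v'' = length v'"
    using v' v'' by (metis length_Cons length_append_singleton nat.inject)
  have 1: "dec v (\<lambda>v1 v2. if v1 = [] then 0 else rev_sign v2 * shuf (tl v1) (rev v2) (\<lambda>x. f (hd v1 # x))) =
      dec v' (\<lambda>v1 v2. rev_sign v2 * shuf v1 (rev v2) (\<lambda>x. f (a # x)))"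
    by (simp add: v')
  have 2: "dec v (\<lambda>v1 v2. if v2 = [] then 0 else rev_sign v2 *
        (sign (lie_deg v1 * letter_deg (last v2)) * shuf v1 (rev (butlast v2)) (\<lambda>x. f (last v2 # x)))) =
      - sign (lie_deg v'' * letter_deg c) * dec v'' (\<lambda>v1 v2. rev_sign v2 * shuf v1 (rev v2) (\<lambda>x. f (c # x)))"
    by (simp add: v'' dec_snoc rev_sign_snoc) (simp add: op_simps)
  have "dec v (\<lambda>v1 v2. rev_sign v2 * shuf v1 (rev v2) f) =
    dec v (\<lambda>v1 v2. (if v1 = [] then 0 else rev_sign v2 * shuf (tl v1) (rev v2) (\<lambda>x. f (hd v1 # x))) +
     (if v2 = [] then 0 else rev_sign v2 *
        (sign (lie_deg v1 * letter_deg (last v2)) * shuf v1 (rev (butlast v2)) (\<lambda>x. f (last v2 # x)))))"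
  proof (rule dec_cong)
    fix v1 v2
    assume "v1 @ v2 = v"
    then have "v1 \<noteq> [] \<or> v2 \<noteq> []"
      using less.prems by auto
    from shuf_rev_front[OF this, of f]
    show "rev_sign v2 * shuf v1 (rev v2) f = (if v1 = [] then 0 else rev_sign v2 * shuf (tl v1) (rev v2) (\<lambda>x. f (hd v1 # x))) +
     (if v2 = [] then 0 else rev_sign v2 *
        (sign (lie_deg v1 * letter_deg (last v2)) * shuf v1 (rev (butlast v2)) (\<lambda>x. f (last v2 # x))))"
      by (simp add: distrib_left)
  qed
  also have "\<dots> = dec v' (\<lambda>v1 v2. rev_sign v2 * shuf v1 (rev v2) (\<lambda>x. f (a # x))) +
      - sign (lie_deg v'' * letter_deg c) * dec v'' (\<lambda>v1 v2. rev_sign v2 * shuf v1 (rev v2) (\<lambda>x. f (c # x)))"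
    unfolding dec_add 1 2 ..
  also have "\<dots> = 0"
  proof (cases "v' = []")
    case True
    then have "v'' = []" "c = a"
      using v' v'' n by auto
    then show ?thesis
      using True by (simp add: sign_simps)
  next
    case False
    then have "v'' \<noteq> []"
      using n by auto
    then show ?thesis
      using less.hyps[of v'] less.hyps[of v''] False n by (simp add: v')
  qed
  finally show ?case .
qed

text \<open>The summand for \<open>w = p @ b # z\<close> in the closed formula of the dual Dynkin
  operator: \<open>b\<close> is the innermost letter of the iterated bracket, and the letters of
  \<open>p\<close> and of the reversed \<open>z\<close> are the outer ones, in any shuffled
  order.\<close>

definition dynkin_term :: "('v lword \<Rightarrow> 'k::field) \<Rightarrow> 'v lword \<Rightarrow> 'v lword \<Rightarrow> 'k" where
  "dynkin_term f p r = (if r = [] then 0 else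
     rev_sign (tl r) * sign (letter_deg (hd r) * lie_deg (tl r)) * shuf p (rev (tl r)) (\<lambda>x. f (x @ [hd r])))"

lemma dynkin_eq_dec: "dynkin w f = (dec w (dynkin_term f) :: 'k::field)"
proof (induction "length w" arbitrary: w f rule: less_induct)
  case less
  consider "w = []" | a where "w = [a]" | "length w \<ge> 2"
    by (cases w rule: remdups_adj.cases) auto
  then show ?case
  proof cases
    case 3
    obtain a w' where w': "w = a # w'"
      using 3 by (cases w) auto
    obtain c w'' where w'': "w = w'' @ [c]"
      using 3 by (cases w rule: rev_cases) auto
    define t1 where "t1 p r = (if p = [] then 0 else dynkin_term (\<lambda>x. f (hd p # x)) (tl p) r)" for p r
    define t2 where "t2 p r = (if r = [] \<or> tl r = [] then 0 else
      - sign (letter_deg (last r) * (lie_deg p + lie_deg (butlast r))) * dynkin_term (\<lambda>x. f (last r # x)) p (butlast r))" for p r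
    have "dec w (dynkin_term f) = dec w (\<lambda>p r. t1 p r + t2 p r)"
    proof (rule dec_cong)
      fix p r
      assume pr: "p @ r = w"
      show "dynkin_term f p r = t1 p r + t2 p r"
      proof (cases r)
        case Nil
        then show ?thesis by (simp add: dynkin_term_def t1_def t2_def)
      next
        case (Cons b z)
        have "p \<noteq> [] \<or> z \<noteq> []"
          using pr Cons 3 by auto
        from shuf_rev_front[OF this, of "\<lambda>x. f (x @ [b])"] Cons
        show ?thesis
          by (cases z rule: rev_cases; cases p) (simp_all add: dynkin_term_def t1_def t2_def rev_sign_snoc butlast_append op_simps)
      qed
    qed
    also have "\<dots> = dec w t1 + dec w t2"
      by (rule dec_add)
    also have "dec w t1 = dec w' (dynkin_term (\<lambda>x. f (a # x)))"
      by (simp add: w' t1_def)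
    also have "dec w t2 = - sign (lie_deg w'' * letter_deg c) * dec w'' (dynkin_term (\<lambda>x. f (c # x)))"
    proof -
      have "t2 p (y @ [c]) = - sign (letter_deg c * (lie_deg p + lie_deg y)) * dynkin_term (\<lambda>x. f (c # x)) p y" for p y
        by (cases y) (simp_all add: t2_def dynkin_term_def)
      then show ?thesis
        by (simp add: w'' dec_snoc t2_def[of _ "[]"]) (simp add: op_simps)
    qed
    also have "dec w' (dynkin_term (\<lambda>x. f (a # x))) = dynkin w' (\<lambda>x. f (a # x))"
      by (rule less.hyps[symmetric]) (simp add: w')
    also have "dec w'' (dynkin_term (\<lambda>x. f (c # x))) = dynkin w'' (\<lambda>x. f (c # x))"
      by (rule less.hyps[symmetric]) (simp add: w'')
    finally have "dec w (dynkin_term f) = dynkin w' (\<lambda>x. f (a # x)) +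
      - sign (lie_deg w'' * letter_deg c) * dynkin w'' (\<lambda>x. f (c # x))" .
    moreover have "tl w = w'" "hd w = a" "butlast w = w''" "last w = c"
      using arg_cong[OF w', of tl] arg_cong[OF w', of hd] arg_cong[OF w'', of butlast] arg_cong[OF w'', of last]
      by simp_all
    ultimately show ?thesis
      using dynkin_rec[OF 3, of f] by simp
  qed (simp_all add: dynkin_term_def sign_simps)
qed

lemma lie_deg_rev [simp]: "lie_deg (rev w) = lie_deg w"
  by (simp add: lie_deg_mset)

text \<open>Modulo shuffles, any letter \<open>b\<close> of a word can be moved to the end. Expand
  the vanishing shuffle of \<open>z\<close> with \<open>x @ [b]\<close> by
  \<open>shuf_marked\<close>. By induction all terms with \<open>z1\<close> nonempty may be replaced
  by \<open>dynkin_term\<close>, and the full sum of \<open>dynkin_term\<close>s is zero by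
  \<open>antipode\<close>; so the terms with \<open>z1\<close> empty agree as well.\<close>

lemma dynkin_term_shuffle_free:
  assumes f: "shuffle_free f"
  shows "dynkin_term f x (b # z) = (f (x @ b # z) :: 'k::field)"
proof (induction "length z" arbitrary: x z rule: less_induct)
  case less
  show ?case
  proof (cases "z = []")
    case False
    let ?D = "\<lambda>z1 z2. sign (lie_deg z2 * (lie_deg x + letter_deg b)) * shuf z1 x (\<lambda>t. dynkin_term f t (b # z2))"
    have "dec z ?D = dec z (\<lambda>z1 z2. rev_sign z2 * shuf z1 (rev z2) (\<lambda>t. shuf t x (\<lambda>y. f (y @ [b]))))"
    proof (rule dec_ext)
      fix z1 z2
      have "shuf z1 x (\<lambda>t. shuf t (rev z2) g) = sign (lie_deg x * lie_deg z2) * shuf z1 (rev z2) (\<lambda>t. shuf t x g)" for g :: "_ \<Rightarrow> 'k"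
        unfolding shuf_assoc by (subst shuf_commute) simp
      then show "?D z1 z2 = rev_sign z2 * shuf z1 (rev z2) (\<lambda>t. shuf t x (\<lambda>y. f (y @ [b])))"
        by (simp add: dynkin_term_def shuf_push[symmetric]) (simp add: algebra_simps sign_simps)
    qed
    also have "\<dots> = 0"
      by (simp add: antipode[OF False])
    finally have D0: "dec z ?D = 0" .
    have "0 = shuf z (x @ [b]) f"
      using f False by (simp add: shuffle_free_def)
    also have "\<dots> = dec z (\<lambda>z1 z2. sign (lie_deg z2 * (lie_deg x + letter_deg b)) * shuf z1 x (\<lambda>t. f (t @ b # z2)))"
      by (simp add: shuf_marked)
    also have "\<dots> = dec z (\<lambda>z1 z2. ?D z1 z2 + (if z1 = [] then
        sign (lie_deg z2 * (lie_deg x + letter_deg b)) * (f (x @ b # z2) - dynkin_term f x (b # z2)) else 0))"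
    proof (rule dec_cong)
      fix z1 z2
      assume z: "z1 @ z2 = z"
      show "sign (lie_deg z2 * (lie_deg x + letter_deg b)) * shuf z1 x (\<lambda>t. f (t @ b # z2)) =
        ?D z1 z2 + (if z1 = [] then
        sign (lie_deg z2 * (lie_deg x + letter_deg b)) * (f (x @ b # z2) - dynkin_term f x (b # z2)) else 0)"
      proof (cases "z1 = []")
        case False
        then have "length z2 < length z"
          using z by auto
        then show ?thesis
          using less[of z2] False by simp
      qed (simp add: algebra_simps)
    qed
    also have "\<dots> = sign (lie_deg z * (lie_deg x + letter_deg b)) * (f (x @ b # z) - dynkin_term f x (b # z))"
      unfolding dec_add D0 by (simp add: dec_first)
    finally show ?thesis
      by (simp add: sign_def split: if_splits)
  qed (simp add: dynkin_term_def sign_simps)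
qed

lemma dec_count: "dec w (\<lambda>p r. if r = [] then 0 else c) = (of_nat (length w) * c :: 'k::field)"
  by (induction w) (simp_all add: algebra_simps)

text \<open>The Dynkin-Specht-Wever identity in dual form: each choice of the innermost letter
  contributes \<open>f w\<close> once.\<close>

lemma dynkin_shuffle_free:
  assumes "shuffle_free f"
  shows "dynkin w f = (of_nat (length w) * f w :: 'k::field)"
proof -
  have "dynkin w f = dec w (\<lambda>p r. if r = [] then 0 else f w)"
    unfolding dynkin_eq_dec
  proof (rule dec_cong)
    fix p r
    assume "p @ r = w"
    then show "dynkin_term f p r = (if r = [] then 0 else f w)"
      using dynkin_term_shuffle_free[OF assms] by (cases r) (auto simp: dynkin_term_def)
  qed
  then show ?thesis
    by (simp add: dec_count)
qed

lemma dynkin_cong: "(\<And>x. mset x = mset w \<Longrightarrow> f x = g x) \<Longrightarrow> dynkin w f = (dynkin w g :: 'k::field)"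
proof (induction "length w" arbitrary: w f g rule: less_induct)
  case less
  consider "w = []" | a where "w = [a]" | "length w \<ge> 2"
    by (cases w rule: remdups_adj.cases) auto
  then show ?case
  proof cases
    case 3
    then have "w \<noteq> []" by auto
    have m: "mset w = add_mset (hd w) (mset (tl w))" "mset w = add_mset (last w) (mset (butlast w))"
      using \<open>w \<noteq> []\<close> by (metis list.collapse mset.simps(2))
        (metis \<open>w \<noteq> []\<close> append_butlast_last_id add_mset_add_single mset_append mset_single_iff_right mset.simps)
    have "dynkin (tl w) (\<lambda>x. f (hd w # x)) = dynkin (tl w) (\<lambda>x. g (hd w # x))"
      by (rule less.hyps) (use \<open>w \<noteq> []\<close> m(1) in \<open>auto intro!: less.prems\<close>)
    moreover have "dynkin (butlast w) (\<lambda>x. f (last w # x)) = dynkin (butlast w) (\<lambda>x. g (last w # x))"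
      by (rule less.hyps) (use \<open>w \<noteq> []\<close> m(2) in \<open>auto intro!: less.prems\<close>)
    ultimately show ?thesis
      using 3 by (simp add: dynkin_rec)
  qed (use less.prems in auto)
qed

lemma dynkin_linear: "dynkin w (\<lambda>x. c * f x + g x) = (c * dynkin w f + dynkin w g :: 'k::field)"
proof (induction "length w" arbitrary: w f g rule: less_induct)
  case less
  consider "w = []" | a where "w = [a]" | "length w \<ge> 2"
    by (cases w rule: remdups_adj.cases) auto
  then show ?case
  proof cases
    case 3
    then have "length (tl w) < length w" "length (butlast w) < length w"
      by auto
    then show ?thesis
      using 3 by (simp add: dynkin_rec less.hyps) (simp add: algebra_simps)
  qed auto
qed

lemma dynkin_zero: "dynkin w (\<lambda>x. 0) = (0 :: 'k::field)"
  using dynkin_linear[of w "-1" "\<lambda>x. 0" "\<lambda>x. 0"] by simp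

lemma linear_relation_dynkin:
  fixes c :: "'k::field" and l0 l1 l2 :: "'v letter"
  assumes deg: "letter_deg l1 = letter_deg l0" "letter_deg l2 = letter_deg l0"
    and f: "linear_relation c l0 l1 l2 f"
  shows "linear_relation c l0 l1 l2 (\<lambda>w. dynkin w f)"
proof -
  have "dynkin (p @ l0 # q) f = c * dynkin (p @ l1 # q) f + dynkin (p @ l2 # q) f" for p q
    using f
  proof (induction "length p + length q" arbitrary: p q f rule: less_induct)
    case less
    have fl: "f (p @ l0 # q) = c * f (p @ l1 # q) + f (p @ l2 # q)" for p q
      using less.prems by (simp add: linear_relation_def)
    have lc: "linear_relation c l0 l1 l2 (\<lambda>x. f (a # x))" for a
      using less.prems unfolding linear_relation_def by (metis append_Cons)
    show ?case
    proof (cases "p = [] \<and> q = []")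
      case True
      then show ?thesis
        using fl[of "[]" "[]"] by simp
    next
      case False
      have len: "length (p @ l # q) \<ge> 2" for l :: "'v letter"
        using False by (cases p; cases q) auto
      have 1: "dynkin (tl (p @ l0 # q)) (\<lambda>x. f (hd (p @ l0 # q) # x)) =
        c * dynkin (tl (p @ l1 # q)) (\<lambda>x. f (hd (p @ l1 # q) # x)) + dynkin (tl (p @ l2 # q)) (\<lambda>x. f (hd (p @ l2 # q) # x))"
      proof (cases p)
        case Nil
        then show ?thesis
          using fl[of "[]"] by (simp add: dynkin_linear)
      next
        case (Cons a p')
        then show ?thesis
          using less.hyps[of p' q "\<lambda>x. f (a # x)", OF _ lc] by simp
      qed
      have 2: "dynkin (butlast (p @ l0 # q)) (\<lambda>x. f (last (p @ l0 # q) # x)) =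
        c * dynkin (butlast (p @ l1 # q)) (\<lambda>x. f (last (p @ l1 # q) # x)) + dynkin (butlast (p @ l2 # q)) (\<lambda>x. f (last (p @ l2 # q) # x))"
      proof (cases q rule: rev_cases)
        case Nil
        then show ?thesis
          using fl[of "[]"] by (simp add: dynkin_linear butlast_append)
      next
        case (snoc q' a)
        then show ?thesis
          using less.hyps[of p q' "\<lambda>x. f (a # x)", OF _ lc] by (simp add: butlast_append)
      qed
      have 3: "sign (lie_deg (butlast (p @ l # q)) * letter_deg (last (p @ l # q))) =
        (sign (lie_deg (butlast (p @ l0 # q)) * letter_deg (last (p @ l0 # q))) :: 'k)"
        if "letter_deg l = letter_deg l0" for l
        using that by (cases q rule: rev_cases) (simp_all add: butlast_append)
      show ?thesis
        unfolding dynkin_rec[OF len] 1 2 3[OF deg(1)] 3[OF deg(2)] by (simp add: algebra_simps)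
    qed
  qed
  then show ?thesis
    by (simp add: linear_relation_def)
qed

section \<open>Functionals that factor through the coproduct or the cobracket\<close>

lemma split_blocks_first: "F [] = 0 \<Longrightarrow> split_blocks X (\<lambda>I J. if I = [] then F J else 0) = (F X :: 'k::field)"
proof (induction X arbitrary: F)
  case (Cons w X)
  have "split_blocks X (\<lambda>I J. sign ((lie_deg w - 1) * gdeg I) * (if I = [] then F (w # J) else 0)) =
     split_blocks X (\<lambda>I J. if I = [] then F (w # J) else 0)"
    by (rule split_blocks_ext) (simp add: sign_simps)
  moreover have "split_blocks X (\<lambda>I J. if I = [] then G J else 0) = (G X :: 'k)" for G X
    by (induction X arbitrary: G) (simp_all add: op_zero sign_simps if_distrib[where f = "(*) _"] cong: if_cong)
  ultimately show ?case
    by (simp add: op_zero)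
qed simp

lemma split_blocks_last:
  fixes F :: "'v bword \<Rightarrow> 'u::ab_group_add"
  shows "split_blocks X (\<lambda>I J. if J = [] then F I else 0) = F X"
  by (induction X arbitrary: F) (simp_all add: op_zero)

lemma split_blocks_append:
  assumes "block_symmetric F"
  shows "split_blocks X (\<lambda>I J. F (I @ J)) = (2 ^ length X * F X :: 'k::field)"
  using assms
proof (induction X arbitrary: F)
  case (Cons w X)
  have "split_blocks X (\<lambda>I J. sign ((lie_deg w - 1) * gdeg I) * F (I @ w # J)) = split_blocks X (\<lambda>I J. F (w # I @ J))"
    by (rule split_blocks_ext) (simp add: block_symmetric_move[OF Cons.prems] sign_simps)
  then show ?case
    using Cons.IH[OF block_symmetric_Cons[OF Cons.prems, of w]] by simp
qed simp

lemma dec_single_left: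
  "dec w (\<lambda>u v. if length u = 1 then K (hd u) v else 0) = (if w = [] then 0 else K (hd w) (tl w) :: 'k::field)"
  by (cases w) (simp_all add: dec_first)

lemma dec_single_right:
  "dec w (\<lambda>u v. if length v = 1 then K (hd v) u else 0) = (if w = [] then 0 else K (last w) (butlast w) :: 'k::field)"
proof (cases w rule: rev_cases)
  case (snoc w' c)
  then show ?thesis
    using dec_last[of w' "\<lambda>x y. K c x"] by (simp add: dec_snoc)
       (smt (verit) dec_ext hd_append2 list.sel(1) self_append_conv2)
qed simp

context graded_space
begin

text \<open>
  There are \<open>2 ^ t - 2\<close> ways to split \<open>t\<close> blocks into two nonempty parts.  So on two or more blocks
  every cochain factors through the coproduct, and likewise, by the Dynkin operator, through the
  cobracket on a single word of two or more letters.
\<close>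

definition append_functional :: "('v bword \<Rightarrow> 'k) \<Rightarrow> 'v bword \<Rightarrow> 'v bword \<Rightarrow> 'k" where
  "append_functional F I J = (if I = [] \<or> J = [] then 0 else F (I @ J) / (2 ^ (length I + length J) - 2))"

lemma cochain_move: "cochain F \<Longrightarrow> F (X @ w # Y) = sign ((lie_deg w - 1) * gdeg X) * F (w # X @ Y)"
  unfolding cochain_def by (blast intro: block_symmetric_move)

lemma cochain_zero: "cochain (\<lambda>Y. 0)"
  by (simp add: cochain_def block_symmetric_def shuffle_free_def multilinear_def op_zero)

lemma multilinear_signed: "multilinear f \<Longrightarrow> (\<And>x. e x = a + b * lie_deg x) \<Longrightarrow> multilinear (\<lambda>x. sign (e x) * f x)"
  unfolding multilinear_iff by (intro allI impI linear_relation_signed) simp_all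

lemma multilinear_scaled: "multilinear f \<Longrightarrow> multilinear (\<lambda>x. c * f x)"
  by (simp add: multilinear_def algebra_simps)

lemma shuffle_free_scaled: "shuffle_free f \<Longrightarrow> shuffle_free (\<lambda>x. c * f x :: 'k)"
  unfolding shuffle_free_def by (simp add: shuf_push[symmetric])

lemma bicochain_append_functional:
  assumes F: "cochain F" "supported F"
  shows "bicochain (append_functional F)"
proof -
  have s: "block_symmetric F" and sf: "shuffle_free (\<lambda>w. F (w # R))" and ml: "multilinear (\<lambda>w. F (w # R))" for R
    using F by (auto simp: cochain_def)
  let ?d = "\<lambda>n::nat. inverse (2 ^ n - 2 :: 'k)"
  have "cochain (\<lambda>Y. append_functional F Y Z)" for Z
  proof (cases "Z = []")
    case False
    have "block_symmetric (\<lambda>Y. append_functional F Y Z)"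
      unfolding block_symmetric_def
    proof (intro allI)
      fix X u w Y
      show "append_functional F (X @ u # w # Y) Z =
        sign ((lie_deg u - 1) * (lie_deg w - 1)) * append_functional F (X @ w # u # Y) Z"
        using block_symmetricD[OF s, of X u w "Y @ Z"] by (simp add: append_functional_def)
    qed
    moreover have "(\<lambda>w. append_functional F (w # R) Z) = (\<lambda>w. ?d (Suc (length R) + length Z) * F (w # R @ Z))" for R
      using False by (simp add: append_functional_def divide_inverse mult.commute)
    ultimately show ?thesis
      unfolding cochain_def using shuffle_free_scaled[OF sf] multilinear_scaled[OF ml] by simp
  qed (simp add: append_functional_def cochain_zero)
  moreover have "cochain (append_functional F Y)" for Y
  proof (cases "Y = []")
    case False
    have "block_symmetric (append_functional F Y)"
      unfolding block_symmetric_def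
    proof (intro allI)
      fix X u w Z
      show "append_functional F Y (X @ u # w # Z) =
        sign ((lie_deg u - 1) * (lie_deg w - 1)) * append_functional F Y (X @ w # u # Z)"
        using block_symmetricD[OF s, of "Y @ X" u w Z] by (simp add: append_functional_def)
    qed
    moreover have "(\<lambda>w. append_functional F Y (w # R)) =
        (\<lambda>w. ?d (length Y + Suc (length R)) * (sign ((lie_deg w - 1) * gdeg Y) * F (w # Y @ R)))" for R
      using False cochain_move[OF F(1), of Y] by (simp add: append_functional_def divide_inverse mult.commute)
    moreover have sm: "shuffle_free (\<lambda>w. sign ((lie_deg w - 1) * gdeg Y) * F (w # Y @ R))"
      "multilinear (\<lambda>w. sign ((lie_deg w - 1) * gdeg Y) * F (w # Y @ R))" for R
      by (rule shuffle_free_signedI[OF sf, where d = "- gdeg Y" and e = "gdeg Y"]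
          multilinear_signed[OF ml, where a = "- gdeg Y" and b = "gdeg Y"]; simp add: algebra_simps)+
    ultimately show ?thesis
      unfolding cochain_def using shuffle_free_scaled[OF sm(1)] multilinear_scaled[OF sm(2)] by simp
  next
    case True
    then show ?thesis
      by (simp add: append_functional_def[abs_def] cochain_zero)
  qed
  moreover have "append_functional F Y Z = 0" if "Y \<notin> bwords E \<or> Z \<notin> bwords E" for Y Z
  proof (cases "Y = [] \<or> Z = []")
    case False
    then have "Y @ Z \<notin> bwords E"
      using that by (auto simp: bwords_iff)
    then show ?thesis
      using F(2) by (simp add: append_functional_def supported_def)
  qed (simp add: append_functional_def)
  ultimately show ?thesis
    by (simp add: bicochain_def supported_def)
qed

lemma two_power_ne: "t \<ge> 2 \<Longrightarrow> (2 ^ t - 2 :: 'k) \<noteq> 0"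
proof -
  assume "t \<ge> 2"
  then have "(2::nat) ^ t > 2 ^ 1"
    by (intro power_strict_increasing) auto
  then have "(of_nat (2 ^ t) :: 'k) \<noteq> of_nat 2"
    unfolding of_nat_eq_iff by simp
  then show ?thesis
    by simp
qed

lemma split_blocks_append_functional:
  assumes F: "cochain F" "supported F"
  shows "split_blocks X (append_functional F) = (if length X \<ge> 2 then F X else 0)"
proof (cases "X = []")
  case False
  have F0: "F [] = 0"
    using F(2) by (simp add: supported_def bwords_iff)
  let ?d = "inverse (2 ^ length X - 2 :: 'k)"
  \<comment> \<open>All \<open>2 ^ t\<close> splittings give \<open>F X\<close> by symmetry; the two
    with an empty part are subtracted.\<close>
  have "split_blocks X (append_functional F) = split_blocks X (\<lambda>I J. ?d * (F (I @ J) -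
      (if I = [] then F J else 0) - (if J = [] then F I else 0)))"
  proof (rule split_blocks_cong)
    fix I J
    assume "mset X = mset I + mset J"
    then have "length X = length I + length J"
      by (metis size_mset size_union)
    then show "append_functional F I J = ?d * (F (I @ J) -
      (if I = [] then F J else 0) - (if J = [] then F I else 0))"
      by (auto simp: append_functional_def F0 divide_inverse)
  qed
  also have "\<dots> = ?d * (2 ^ length X * F X - F X - F X)"
    using F(1) by (simp add: op_push[symmetric] op_diff split_blocks_append cochain_def split_blocks_last split_blocks_first[of F, OF F0])
  also have "\<dots> = ?d * (2 ^ length X - 2) * F X"
    by (simp add: algebra_simps)
  also have "\<dots> = (if length X \<ge> 2 then F X else 0)"
  proof (cases "length X \<ge> 2")
    case True
    then show ?thesis using two_power_ne by simp
  next
    case False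
    then have "length X = 1"
      using \<open>X \<noteq> []\<close> by (cases X) (auto simp: Suc_le_eq)
    then show ?thesis by simp
  qed
  finally show ?thesis .
qed (simp add: append_functional_def)

text \<open>A one-letter left factor is the outer letter of a right-normed bracket. The denominator
  is the length of the whole word, the eigenvalue of the Dynkin operator.\<close>

definition bracket_functional :: "('v bword \<Rightarrow> 'k) \<Rightarrow> 'v bword \<Rightarrow> 'v bword \<Rightarrow> 'k" where
  "bracket_functional F Y Z = (if length Y = 1 \<and> length Z = 1 \<and> length (hd Y) = 1 then
     dynkin (hd Z) (\<lambda>x. F [hd (hd Y) # x]) / of_nat (Suc (length (hd Z))) else 0)"

lemma bicochain_bracket_functional:
  assumes F: "cochain F" "supported F"
  shows "bicochain (bracket_functional F)"
proof -
  have sf: "shuffle_free (\<lambda>w. F (w # R))" and ml: "multilinear (\<lambda>w. F (w # R))" for R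
    using F by (auto simp: cochain_def)
  have b0: "bracket_functional F (X @ u # w # Y) Z = 0" "bracket_functional F Z (X @ u # w # Y) = 0" for X u w Y Z
    by (simp_all add: bracket_functional_def)
  have lm: "linear_relation c (s, n, scale c a + b) (s, n, a) (s, n, b) (\<lambda>w. F [w])" if "a \<in> E s n" "b \<in> E s n" for s n c a b
    using ml[of "[]"] that by (simp add: multilinear_iff)
  have "cochain (\<lambda>Y. bracket_functional F Y Z)" for Z
    unfolding cochain_def
  proof (intro conjI allI)
    show "block_symmetric (\<lambda>Y. bracket_functional F Y Z)"
      by (simp add: block_symmetric_def b0)
    fix R
    show "shuffle_free (\<lambda>w. bracket_functional F (w # R) Z)"
      unfolding shuffle_free_def
    proof (intro conjI allI impI)
      fix u w :: "'v lword" assume uw: "u \<noteq> []" "w \<noteq> []"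
      have "shuf u w (\<lambda>w. bracket_functional F (w # R) Z) = shuf u w (\<lambda>w. 0)"
      proof (rule shuf_cong)
        fix x assume "mset x = mset u + mset w"
        then have "length x = length u + length w"
          by (metis size_mset size_union)
        then have "length x \<noteq> 1"
          using uw by (cases u; cases w) auto
        then show "bracket_functional F (x # R) Z = 0"
          by (simp add: bracket_functional_def)
      qed
      then show "shuf u w (\<lambda>w. bracket_functional F (w # R) Z) = 0"
        by (simp add: op_zero)
    qed (simp add: bracket_functional_def)
    show "multilinear (\<lambda>w. bracket_functional F (w # R) Z)"
      unfolding multilinear_iff linear_relation_def
    proof (intro allI impI)
      fix s n c a b p q
      assume ab: "a \<in> E s n" "b \<in> E s n"
      show "bracket_functional F ((p @ (s, n, scale c a + b) # q) # R) Z =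
         c * bracket_functional F ((p @ (s, n, a) # q) # R) Z + bracket_functional F ((p @ (s, n, b) # q) # R) Z"
      proof (cases "p = [] \<and> q = []")
        case True
        have "F [(s, n, scale c a + b) # x] = c * F [(s, n, a) # x] + F [(s, n, b) # x]" for x
          using lm[OF ab, of c] unfolding linear_relation_def by (metis append_Nil)
        then show ?thesis
          using True by (simp add: bracket_functional_def dynkin_linear add_divide_distrib)
      qed (auto simp: bracket_functional_def)
    qed
  qed
  moreover have "cochain (bracket_functional F Y)" for Y
    unfolding cochain_def
  proof (intro conjI allI)
    show "block_symmetric (bracket_functional F Y)"
      by (simp add: block_symmetric_def b0)
    fix R
    let ?f = "\<lambda>x. F [hd (hd Y) # x]"
    show "shuffle_free (\<lambda>w. bracket_functional F Y (w # R))"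
      unfolding shuffle_free_def
    proof (intro conjI allI impI)
      fix u w :: "'v lword" assume uw: "u \<noteq> []" "w \<noteq> []"
      have "shuf u w (\<lambda>w. bracket_functional F Y (w # R)) =
        shuf u w (\<lambda>x. (if length Y = 1 \<and> R = [] \<and> length (hd Y) = 1 then inverse (of_nat (Suc (length u + length w))) else 0) * dynkin x ?f)"
      proof (rule shuf_cong)
        fix x assume "mset x = mset u + mset w"
        then have "length x = length u + length w"
          by (metis size_mset size_union)
        then show "bracket_functional F Y (x # R) =
            (if length Y = 1 \<and> R = [] \<and> length (hd Y) = 1 then inverse (of_nat (Suc (length u + length w))) else 0) * dynkin x ?f"
          by (simp add: bracket_functional_def divide_inverse mult.commute)
      qed
      then show "shuf u w (\<lambda>w. bracket_functional F Y (w # R)) = 0"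
        unfolding shuf_push[symmetric] dynkin_shuffle[OF uw] by simp
    qed (simp add: bracket_functional_def)
    show "multilinear (\<lambda>w. bracket_functional F Y (w # R))"
      unfolding multilinear_iff linear_relation_def
    proof (intro allI impI)
      fix s n c a b p q
      assume ab: "a \<in> E s n" "b \<in> E s n"
      have "linear_relation c (s, n, scale c a + b) (s, n, a) (s, n, b) ?f"
        using lm[OF ab, of c] unfolding linear_relation_def by (metis append_Cons)
      then have "linear_relation c (s, n, scale c a + b) (s, n, a) (s, n, b) (\<lambda>w. dynkin w ?f)"
        by (intro linear_relation_dynkin) simp_all
      then show "bracket_functional F Y ((p @ (s, n, scale c a + b) # q) # R) =
         c * bracket_functional F Y ((p @ (s, n, a) # q) # R) + bracket_functional F Y ((p @ (s, n, b) # q) # R)"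
        by (simp add: bracket_functional_def linear_relation_def add_divide_distrib)
    qed
  qed
  moreover have "bracket_functional F Y Z = 0" if "Y \<notin> bwords E \<or> Z \<notin> bwords E" for Y Z
  proof (cases "length Y = 1 \<and> length Z = 1 \<and> length (hd Y) = 1")
    case True
    then obtain a v where YZ: "Y = [[a]]" "Z = [v]"
      by (auto simp: length_Suc_conv)
    have "dynkin v (\<lambda>x. F [a # x]) = dynkin v (\<lambda>x. 0)" if "v \<noteq> []"
    proof (rule dynkin_cong)
      fix x assume "mset x = mset v"
      then have "set x = set v"
        by (metis set_mset_mset)
      then have "[a # x] \<notin> bwords E"
        using \<open>Y \<notin> bwords E \<or> Z \<notin> bwords E\<close> YZ that by (auto simp: bwords_iff)
      then show "F [a # x] = 0"
        using F(2) by (simp add: supported_def)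
    qed
    then show ?thesis
      using YZ by (cases "v = []") (simp_all add: bracket_functional_def dynkin_zero)
  qed (auto simp: bracket_functional_def)
  ultimately show ?thesis
    by (simp add: bicochain_def supported_def)
qed

text \<open>On one word only the cuts after the first and before the last letter survive. They are
  the two terms of \<open>dynkin_rec\<close>, and \<open>dynkin_shuffle_free\<close> evaluates their
  difference. With more blocks, one of the factors has at least two blocks and the functional is
  zero there.\<close>

lemma cobracket_sum_bracket_functional:
  assumes F: "cochain F" and X: "X \<noteq> []"
  shows "cobracket_sum X (bracket_functional F) = (if length X = 1 \<and> length (hd X) \<ge> 2 then F X else 0)"
proof (cases "length X = 1")
  case True
  then obtain w where w: "X = [w]"
    by (auto simp: length_Suc_conv)
  have sf: "shuffle_free (\<lambda>x. F [x])"
    using F by (simp add: cochain_def)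
  define K where "K a v = dynkin v (\<lambda>x. F [a # x]) / of_nat (Suc (length v))" for a v
  have "cobracket_sum X (bracket_functional F) = dec w (\<lambda>u v. (if length u = 1 then K (hd u) v else 0) -
     (if length v = 1 then sign (lie_deg u * letter_deg (hd v)) * K (hd v) u else 0))"
    unfolding w cobracket_sum_def pick.simps split_blocks.simps add_0_right
    by (rule dec_ext) (auto simp: bracket_functional_def K_def length_Suc_conv sign_simps)
  also have "\<dots> = (if w = [] then 0 else K (hd w) (tl w)) - (if w = [] then 0 else sign (lie_deg (butlast w) * letter_deg (last w)) * K (last w) (butlast w))"
    unfolding op_diff(2) dec_single_left dec_single_right[of w "\<lambda>c u. sign (lie_deg u * letter_deg c) * K c u"] ..
  also have "\<dots> = (if length w \<ge> 2 then F [w] else 0)"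
  proof (cases "length w \<ge> 2")
    case True
    then have "Suc (length w - 1) = length w" "w \<noteq> []" "of_nat (length w) \<noteq> (0::'k)"
      by auto
    moreover have "dynkin (tl w) (\<lambda>x. F [hd w # x]) -
        sign (lie_deg (butlast w) * letter_deg (last w)) * dynkin (butlast w) (\<lambda>x. F [last w # x]) =
        of_nat (length w) * F [w]"
      using dynkin_rec[OF True, of "\<lambda>x. F [x]"] dynkin_shuffle_free[OF sf, of w] by simp
    ultimately show ?thesis
      using True by (simp add: K_def diff_divide_distrib[symmetric] times_divide_eq_right)
  next
    case False
    then have "w = [] \<or> tl w = [] \<and> butlast w = []"
      by (cases w) (auto simp: Suc_le_eq)
    then show ?thesis
      using False by (auto simp: K_def)
  qed
  finally show ?thesis
    by (simp add: w)
next
  case False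
  have "cobracket_sum X (bracket_functional F) = pick X (\<lambda>w X'. 0)"
    unfolding cobracket_sum_def
  proof (rule pick_cong)
    fix w X'
    assume m: "mset X = add_mset w (mset X')"
    have "split_blocks X' (\<lambda>I J. sign (gdeg I * lie_deg v) * bracket_functional F (u # I) (v # J) -
      sign (lie_deg u * lie_deg v + gdeg I * lie_deg u) * bracket_functional F (v # I) (u # J)) = split_blocks X' (\<lambda>I J. 0)" for u v
    proof (rule split_blocks_cong)
      fix I J
      assume "mset X' = mset I + mset J"
      then have "size (mset X) = Suc (length I + length J)"
        using m by simp
      then have "I \<noteq> [] \<or> J \<noteq> []"
        using False by auto
      then show "sign (gdeg I * lie_deg v) * bracket_functional F (u # I) (v # J) -
        sign (lie_deg u * lie_deg v + gdeg I * lie_deg u) * bracket_functional F (v # I) (u # J) = 0"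
        by (auto simp: bracket_functional_def)
    qed
    then show "dec w (\<lambda>u v. split_blocks X' (\<lambda>I J. sign (gdeg I * lie_deg v) * bracket_functional F (u # I) (v # J) -
      sign (lie_deg u * lie_deg v + gdeg I * lie_deg u) * bracket_functional F (v # I) (u # J))) = 0"
      by (simp add: op_zero)
  qed
  then show ?thesis
    using False by (auto simp: op_zero)
qed

text \<open>Block words have several blocks, or one word with several letters, or one letter. On the
  first two kinds \<open>F\<close> factors through the coproduct or the cobracket, and these vanish
  on \<open>y\<close>; what is left is the one-letter part. Its fermionic degree is
  \<open>n + 2\<close> because a single letter lies in \<open>V[2]\<close>.\<close>

lemma primitive_corestriction:
  assumes y: "y \<in> chains E"
    and hom: "\<And>X. X \<in> Poly_Mapping.keys y \<Longrightarrow> gdeg X = n \<and> cdeg X = s"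
    and cop: "lin_ext cscale coproduct y \<in> relations2 scale E"
    and cob: "lin_ext cscale cobracket y \<in> relations2 scale E"
    and F: "cochain F" "supported F"
  shows "lin_ext (*) F y = F [[(s, n + 2, lin_ext scale proj1 y)]]"
proof -
  have k: "X \<in> bwords E" if "X \<in> Poly_Mapping.keys y" for X
    using y that by (rule keys_chainsD)
  let ?A = "append_functional F" and ?B = "bracket_functional F"
  have bA: "bicochain ?A" and bB: "bicochain ?B"
    by (rule bicochain_append_functional[OF F] bicochain_bracket_functional[OF F])+
  have A0: "?A [] Y = 0" "?A Y [] = 0" for Y
    by (simp_all add: append_functional_def)
  have B0: "?B ([] # Y) Z = 0" "?B Y ([] # Z) = 0" for Y Z
    by (simp_all add: bracket_functional_def)
  have Bs: "block_symmetric (\<lambda>Y. ?B Y Z)" for Z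
    using bB by (simp add: bicochain_def cochain_def)
  have lin: "letter_linear (\<lambda>l. F [[l]])"
    using F(1) unfolding cochain_def letter_linear_def multilinear_def by (metis append_Nil)
  have 1: "lin_ext (*) (\<lambda>X. if length X \<ge> 2 then F X else 0) y = 0"
    using bicochain_relations2[OF bA cop]
    by (simp add: field.lin_ext_lin_ext lin_ext_coproduct[of ?A, OF A0] split_blocks_append_functional[OF F])
  have 2: "lin_ext (*) (\<lambda>X. if length X = 1 \<and> length (hd X) \<ge> 2 then F X else 0) y = 0"
  proof -
    have "lin_ext (*) (\<lambda>X. cobracket_sum X ?B) y = 0"
      using bicochain_relations2[OF bB cob]
      by (simp add: field.lin_ext_lin_ext lin_ext_cobracket[of ?B, OF Bs B0])
    moreover have "lin_ext (*) (\<lambda>X. cobracket_sum X ?B) y =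
      lin_ext (*) (\<lambda>X. if length X = 1 \<and> length (hd X) \<ge> 2 then F X else 0) y"
      by (rule lin_ext_cong, rule cobracket_sum_bracket_functional[OF F(1)]) (use k in \<open>auto simp: bwords_iff\<close>)
    ultimately show ?thesis
      by simp
  qed
  have "lin_ext (*) F y = lin_ext (*) (\<lambda>X. ((if length X \<ge> 2 then F X else 0) +
     (if length X = 1 \<and> length (hd X) \<ge> 2 then F X else 0)) + F [[(s, n + 2, proj1 X)]]) y"
  proof (rule lin_ext_cong)
    fix X
    assume X: "X \<in> Poly_Mapping.keys y"
    have z: "F [[(s, n + 2, 0)]] = 0"
      by (rule letter_linear_0[OF lin])
    show "F X = ((if length X \<ge> 2 then F X else 0) +
     (if length X = 1 \<and> length (hd X) \<ge> 2 then F X else 0)) + F [[(s, n + 2, proj1 X)]]"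
    proof (cases X rule: proj1.cases)
      case (1 s' n' v)
      then have "s' = s" "n' = n + 2"
        using hom[OF X] by (auto simp: cdeg_def)
      then show ?thesis
        using 1 by simp
    qed (use k[OF X] z in \<open>auto simp: bwords_iff Suc_le_eq\<close>)
  qed
  also have "\<dots> = lin_ext (*) (\<lambda>X. F [[(s, n + 2, proj1 X)]]) y"
    unfolding field.lin_ext_fun_add 1 2 by simp
  also have "\<dots> = F [[(s, n + 2, lin_ext scale proj1 y)]]"
  proof (rule letter_linear_lin_ext[OF lin, symmetric])
    fix X
    assume X: "X \<in> Poly_Mapping.keys y"
    show "proj1 X \<in> E s (n + 2)"
    proof (cases X rule: proj1.cases)
      case (1 s' n' v)
      then have "s' = s" "n' = n + 2" "v \<in> E s' n'"
        using hom[OF X] k[OF X] by (auto simp: cdeg_def bwords_iff letters_def)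
      then show ?thesis
        using 1 by simp
    qed (simp_all add: zero_E)
  qed
  finally show ?thesis .
qed

end

section \<open>Uniqueness of coderivations\<close>

text \<open>Empty outer pieces force every block to be used as a whole.\<close>

lemma slices_unit:
  fixes K :: "'v bword \<Rightarrow> 'u::ab_group_add"
  shows "[] \<notin> set X \<Longrightarrow> slices X (\<lambda>x Y z. if x = [] \<and> z = [] then K Y else 0) = K X"
proof (induction X arbitrary: K)
  case (Cons w X)
  have s: "shuf a x (\<lambda>x'. shuf c z (\<lambda>z'. if x' = [] \<and> z' = [] then k else 0)) =
    (if a = [] \<and> x = [] \<and> c = [] \<and> z = [] then k else (0::'u))" for a x c z :: "'v lword" and k
  proof -
    have "shuf c z (\<lambda>z'. if P \<and> z' = [] then k else 0) = shuf c z (\<lambda>z'. if P \<and> c = [] \<and> z = [] then k else 0)" for P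
      by (rule shuf_cong) auto
    then have "shuf a x (\<lambda>x'. shuf c z (\<lambda>z'. if x' = [] \<and> z' = [] then k else 0)) =
      shuf a x (\<lambda>x'. shuf c z (\<lambda>z'. if a = [] \<and> x = [] \<and> c = [] \<and> z = [] then k else 0))"
      by (intro shuf_cong) auto
    then show ?thesis
      by (auto simp: op_zero)
  qed
  have "slices (w # X) (\<lambda>x Y z. if x = [] \<and> z = [] then K Y else 0) =
    dec3 w (\<lambda>a b c. if a = [] \<and> c = [] then slices X (\<lambda>x Y z. if x = [] \<and> z = [] then K (b # Y) else 0) else 0)"
    unfolding slices.simps s
  proof (rule dec3_ext)
    fix a b c :: "'v lword"
    let ?e = "\<lambda>x Y. lie_deg a + lie_deg x * (lie_deg b - 1 + lie_deg c) + gdeg Y * lie_deg c"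
    have e: "(\<lambda>x Y z. signed (?e x Y) (if a = [] \<and> x = [] \<and> c = [] \<and> z = [] then K (b # Y) else 0)) =
      (\<lambda>x Y z. if a = [] \<and> c = [] then if x = [] \<and> z = [] then K (b # Y) else 0 else 0)"
      by (auto simp: fun_eq_iff signed_def)
    show "slices X (\<lambda>x Y z. signed (?e x Y) (if a = [] \<and> x = [] \<and> c = [] \<and> z = [] then K (b # Y) else 0)) =
      (if a = [] \<and> c = [] then slices X (\<lambda>x Y z. if x = [] \<and> z = [] then K (b # Y) else 0) else 0)"
      unfolding e by (cases "a = []"; cases "c = []") (simp_all add: op_zero)
  qed
  also have "\<dots> = dec3 w (\<lambda>a b c. if a = [] \<and> c = [] then K (b # X) else 0)"
    using Cons.prems by (simp add: Cons.IH[of "\<lambda>Y. K (_ # Y)"] cong: if_cong)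
  also have "\<dots> = dec w (\<lambda>a r. if a = [] then dec r (\<lambda>b c. if c = [] then if b = [] then 0 else K (b # X) else 0) else 0)"
    unfolding dec3_def by (rule dec_ext) (auto simp: op_zero intro!: dec_ext cong: if_cong)
  also have "\<dots> = K (w # X)"
    using Cons.prems by (subst dec_first) (auto simp: dec_last)
  finally show ?case .
qed simp

text \<open>The extension evaluates \<open>g\<close> only on block words made of letters of
  \<open>X\<close>; truncations and restrictions of \<gamma> therefore do not affect short words or
  words over a subspace.\<close>

lemma extension_cong:
  assumes g: "\<And>Y. Y \<noteq> [] \<Longrightarrow> [] \<notin> set Y \<Longrightarrow> set (concat Y) \<subseteq> set (concat X) \<Longrightarrow>
    blen Y \<le> blen X \<Longrightarrow> cdeg Y \<le> cdeg X \<Longrightarrow> g Y = g' Y"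
  shows "extension g F X = extension g' F X"
  unfolding extension_def
proof (rule split_blocks_cong)
  fix K R
  assume KR: "mset X = mset K + mset R"
  have cX: "mset (concat X) = mset (concat K) + mset (concat R)"
    using arg_cong[OF KR, of "\<lambda>M. sum_mset (image_mset mset M)"] by (simp add: mset_concat sum_mset_sum_list[symmetric] flip: mset_map)
  have "slices K (\<lambda>x Y z. F ((x @ g Y # z) # R)) = slices K (\<lambda>x Y z. F ((x @ g' Y # z) # R))" if "K \<noteq> []"
  proof (rule slices_cong)
    fix x Y z
    assume m: "mset (concat K) = mset x + mset (concat Y) + mset z" and l: "length Y = length K" and ne: "[] \<notin> set Y"
    have M: "mset (concat X) = mset x + mset (concat Y) + mset z + mset (concat R)"
      using cX m by simp
    have "set (concat X) = set x \<union> set (concat Y) \<union> set z \<union> set (concat R)"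
      using arg_cong[OF M, of set_mset] by (simp del: set_concat mset_concat)
    moreover have "blen Y \<le> blen X"
      using arg_cong[OF M, of size] by (simp add: blen_def del: mset_concat)
    moreover have "cdeg Y \<le> cdeg X"
      using arg_cong[OF M, of "\<lambda>m. sum_mset (image_mset fst m)"]
      by (simp add: cdeg_def sum_mset_sum_list[symmetric] del: mset_concat)
    ultimately have "g Y = g' Y"
      using l ne that by (intro g) auto
    then show "F ((x @ g Y # z) # R) = F ((x @ g' Y # z) # R)"
      by simp
  qed
  then show "lie_extension g (\<lambda>v. F (v # R)) K = lie_extension g' (\<lambda>v. F (v # R)) K"
    by (simp add: lie_extension_def)
qed

text \<open>The letter \<open>g Y\<close> with \<open>Y\<close> as long as \<open>X\<close> arises
  only if all letters of \<open>X\<close> are consumed, and then the result is a single letter. So a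
  change of \<open>g\<close> in that length contributes one correction term.\<close>

lemma extension_update:
  fixes F :: "'v bword \<Rightarrow> 'u::ab_group_add"
  assumes X: "X \<noteq> []" "[] \<notin> set X"
    and g: "\<And>Y. Y \<noteq> [] \<Longrightarrow> [] \<notin> set Y \<Longrightarrow> set (concat Y) \<subseteq> set (concat X) \<Longrightarrow> blen Y < blen X \<Longrightarrow> g' Y = g Y"
  shows "extension g' F X = extension g F X + (F [[g' X]] - F [[g X]])"
proof -
  have "extension g' F X = split_blocks X (\<lambda>K R. lie_extension g (\<lambda>v. F (v # R)) K +
     (if R = [] then if K = [] then 0 else slices K (\<lambda>x Y z. if x = [] \<and> z = [] then F [[g' Y]] - F [[g Y]] else 0) else 0))"
    unfolding extension_def
  proof (rule split_blocks_cong)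
    fix K R
    assume KR: "mset X = mset K + mset R"
    have cX: "mset (concat X) = mset (concat K) + mset (concat R)"
      using arg_cong[OF KR, of "\<lambda>M. sum_mset (image_mset mset M)"] by (simp add: mset_concat sum_mset_sum_list[symmetric] flip: mset_map)
    have sR: "set R \<subseteq> set X"
      using arg_cong[OF KR, of set_mset] by auto
    have "slices K (\<lambda>x Y z. F ((x @ g' Y # z) # R)) = slices K (\<lambda>x Y z. F ((x @ g Y # z) # R) +
      (if R = [] \<and> x = [] \<and> z = [] then F [[g' Y]] - F [[g Y]] else 0))" if "K \<noteq> []"
    proof (rule slices_cong)
      fix x Y z
      assume m: "mset (concat K) = mset x + mset (concat Y) + mset z" and l: "length Y = length K" and ne: "[] \<notin> set Y"
      have M: "mset (concat X) = mset x + mset (concat Y) + mset z + mset (concat R)"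
        using cX m by simp
      show "F ((x @ g' Y # z) # R) = F ((x @ g Y # z) # R) +
        (if R = [] \<and> x = [] \<and> z = [] then F [[g' Y]] - F [[g Y]] else 0)"
      proof (cases "R = [] \<and> x = [] \<and> z = []")
        case False
        have "concat R = [] \<longleftrightarrow> R = []"
          using sR X(2) by (cases R) auto
        then have "size (mset x + mset z + mset (concat R)) > 0"
          using False by auto
        then have "blen Y < blen X"
          using arg_cong[OF M, of size] by (simp add: blen_def del: mset_concat concat_eq_Nil_conv)
        moreover have "set (concat Y) \<subseteq> set (concat X)"
          using arg_cong[OF M, of set_mset] by (simp del: set_concat mset_concat) blast
        ultimately have "g' Y = g Y"
          using l ne that by (intro g) auto
        then show ?thesis
          using False by auto
      qed auto
    qed
    then show "lie_extension g' (\<lambda>v. F (v # R)) K = lie_extension g (\<lambda>v. F (v # R)) K +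
      (if R = [] then if K = [] then 0 else slices K (\<lambda>x Y z. if x = [] \<and> z = [] then F [[g' Y]] - F [[g Y]] else 0) else 0)"
      by (cases "R = []") (simp_all add: lie_extension_def slices_add op_zero)
  qed
  also have "\<dots> = extension g F X + (if X = [] then 0 else slices X (\<lambda>x Y z. if x = [] \<and> z = [] then F [[g' Y]] - F [[g Y]] else 0))"
    unfolding split_blocks_add extension_def split_blocks_last ..
  also have "\<dots> = extension g F X + (F [[g' X]] - F [[g X]])"
    using X by (simp add: slices_unit)
  finally show ?thesis .
qed

lemma extension_proj1:
  assumes "X \<noteq> []" "[] \<notin> set X"
  shows "extension g proj1 X = snd (snd (g X))"
proof -
  have p: "proj1 [[l]] = snd (snd l)" for l :: "'a letter"
    by (cases l) simp
  have p0: "proj1 ((x @ g Y # z) # R) = (if R = [] then if x = [] \<and> z = [] then snd (snd (g Y)) else 0 else 0)" for x Y z R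
  proof (cases "R = [] \<and> x = [] \<and> z = []")
    case False
    then show ?thesis
      by (cases "(x @ g Y # z) # R" rule: proj1.cases) (auto simp: append_eq_Cons_conv)
  qed (simp add: p)
  have "extension g proj1 X = split_blocks X (\<lambda>K R. if R = [] then if K = [] then 0 else
      slices K (\<lambda>x Y z. if x = [] \<and> z = [] then snd (snd (g Y)) else 0) else 0)"
    unfolding extension_def lie_extension_def p0
    by (rule split_blocks_ext) (auto simp: op_zero)
  then show ?thesis
    unfolding split_blocks_last using assms by (simp add: slices_unit)
qed

section \<open>Squares of coderivations are coderivations\<close>

lemma extension_swap:
  fixes B :: "'v bword \<Rightarrow> 'w bword \<Rightarrow> 'k::field"
  shows "extension g (\<lambda>Y. extension g' (B Y) Z) W = extension g' (\<lambda>Z'. extension g (\<lambda>Y. B Y Z') W) Z"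
proof -
  have 1: "lie_extension g (\<lambda>v. lie_extension g' (B' v) K') K = lie_extension g' (\<lambda>v'. lie_extension g (\<lambda>v. B' v v') K) K'"
    for K K' and B' :: "'v lword \<Rightarrow> 'w lword \<Rightarrow> 'k"
    unfolding lie_extension_def[of g']
    by (simp add: slices_swap[OF additive_op_lie_extension] lie_extension_zero)
  show ?thesis
    unfolding extension_def split_blocks_lie_extension 1
    by (subst split_blocks_swap[OF additive_op_split_blocks, where F = "\<lambda>(x, y) a1 a2. _ x y a1 a2", simplified]) (rule refl)
qed

lemma extension_cong_deg:
  fixes g :: "'v bword \<Rightarrow> 'v letter"
  assumes g: "degree_compatible g" and F: "\<And>Y. gdeg Y = gdeg X + 1 \<Longrightarrow> F Y = G Y"
  shows "extension g F X = extension g G X"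
  unfolding extension_def
proof (rule split_blocks_cong_deg[OF refl], rule lie_extension_cong[OF g])
  fix K R :: "'v bword" and v :: "'v lword"
  assume "gdeg X = gdeg K + gdeg R" "lie_deg v = gdeg K + 2"
  then show "F (v # R) = G (v # R)"
    by (intro F) simp
qed

lemma extension_push: "(c::'k::field) * extension g F X = extension g (\<lambda>v. c * F v) X"
  by (rule extension_hom) (simp add: additive_fun_def algebra_simps)

lemma extension_zero: "extension g (\<lambda>v. 0) X = 0"
  by (simp add: additive_op_0[OF additive_op_extension])

text \<open>The mixed terms, with one application in each factor, occur twice with opposite signs
  because the coderivation has odd degree.\<close>

lemma extension_split_blocks_square:
  fixes B :: "'v bword \<Rightarrow> 'v bword \<Rightarrow> 'k::field"
  assumes g: "degree_compatible g"
  shows "extension g (extension g (\<lambda>Z. split_blocks Z B)) X = split_blocks X (\<lambda>Y Z.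
     extension g (extension g (\<lambda>Y'. B Y' Z)) Y + extension g (extension g (B Y)) Z)"
proof -
  have "extension g (extension g (\<lambda>Z. split_blocks Z B)) X = split_blocks X (\<lambda>Y Z.
     extension g (\<lambda>Y'. extension g (\<lambda>Y''. B Y'' Z) Y' + sign (gdeg Y') * extension g (B Y') Z) Y +
     sign (gdeg Y) * extension g (\<lambda>Z'. extension g (\<lambda>Y''. B Y'' Z') Y + sign (gdeg Y) * extension g (B Y) Z') Z)"
  proof -
    have e: "extension g (\<lambda>Z. split_blocks Z B) = (\<lambda>W. split_blocks W (\<lambda>Y Z.
        extension g (\<lambda>Y'. B Y' Z) Y + sign (gdeg Y) * extension g (B Y) Z))"
      by (rule ext) (rule extension_split_blocks[OF g])
    show ?thesis
      unfolding e by (rule extension_split_blocks[OF g])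
  qed
  also have "\<dots> = split_blocks X (\<lambda>Y Z.
     extension g (extension g (\<lambda>Y'. B Y' Z)) Y + extension g (extension g (B Y)) Z)"
  proof (rule split_blocks_ext)
    fix Y Z
    have "extension g (\<lambda>Y'. sign (gdeg Y') * extension g (B Y') Z) Y =
      extension g (\<lambda>Y'. - sign (gdeg Y) * extension g (B Y') Z) Y"
      by (rule extension_cong_deg[OF g]) (simp add: sign_simps)
    also have "\<dots> = - sign (gdeg Y) * extension g (\<lambda>Z'. extension g (\<lambda>Y'. B Y' Z') Y) Z"
      unfolding extension_push[symmetric] by (subst extension_swap) (rule refl)
    finally show "extension g (\<lambda>Y'. extension g (\<lambda>Y''. B Y'' Z) Y' + sign (gdeg Y') * extension g (B Y') Z) Y +
     sign (gdeg Y) * extension g (\<lambda>Z'. extension g (\<lambda>Y''. B Y'' Z') Y + sign (gdeg Y) * extension g (B Y) Z') Z =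
     extension g (extension g (\<lambda>Y'. B Y' Z)) Y + extension g (extension g (B Y)) Z"
      by (simp add: extension_add extension_push[symmetric] distrib_left) (simp add: op_simps)
  qed
  finally show ?thesis .
qed

text \<open>The sign of the rule is shifted by one in both applications, so the mixed terms again
  cancel. The second application needs the functional produced by the first to be admissible, which
  is the hypothesis \<open>B'\<close>.\<close>

lemma extension_cobracket_sum_square:
  fixes B :: "'v bword \<Rightarrow> 'v bword \<Rightarrow> 'k::field"
  assumes g: "degree_compatible g" and B: "bilinear_functional g B"
    and B': "bilinear_functional g (\<lambda>Y Z. extension g (\<lambda>Y'. B Y' Z) Y + sign (gdeg Y + 1) * extension g (B Y) Z)"
  shows "extension g (extension g (\<lambda>Z. cobracket_sum Z B)) X = cobracket_sum X (\<lambda>Y Z.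
     extension g (extension g (\<lambda>Y'. B Y' Z)) Y + extension g (extension g (B Y)) Z)"
proof -
  have "extension g (extension g (\<lambda>Z. cobracket_sum Z B)) X = cobracket_sum X (\<lambda>Y Z.
     extension g (\<lambda>Y'. extension g (\<lambda>Y''. B Y'' Z) Y' + sign (gdeg Y' + 1) * extension g (B Y') Z) Y +
     sign (gdeg Y + 1) * extension g (\<lambda>Z'. extension g (\<lambda>Y''. B Y'' Z') Y + sign (gdeg Y + 1) * extension g (B Y) Z') Z)"
  proof -
    have e: "extension g (\<lambda>Z. cobracket_sum Z B) = (\<lambda>W. cobracket_sum W (\<lambda>Y Z.
        extension g (\<lambda>Y'. B Y' Z) Y + sign (gdeg Y + 1) * extension g (B Y) Z))"
      by (rule ext) (rule extension_cobracket_sum[OF g B])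
    show ?thesis
      unfolding e by (rule extension_cobracket_sum[OF g B'])
  qed
  moreover have "(\<lambda>Y Z.
     extension g (\<lambda>Y'. extension g (\<lambda>Y''. B Y'' Z) Y' + sign (gdeg Y' + 1) * extension g (B Y') Z) Y +
     sign (gdeg Y + 1) * extension g (\<lambda>Z'. extension g (\<lambda>Y''. B Y'' Z') Y + sign (gdeg Y + 1) * extension g (B Y) Z') Z) =
     (\<lambda>Y Z. extension g (extension g (\<lambda>Y'. B Y' Z)) Y + extension g (extension g (B Y)) Z)"
  proof (intro ext)
    fix Y Z
    have "extension g (\<lambda>Y'. sign (gdeg Y' + 1) * extension g (B Y') Z) Y =
      extension g (\<lambda>Y'. sign (gdeg Y) * extension g (B Y') Z) Y"
      by (rule extension_cong_deg[OF g]) (simp add: sign_def)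
    also have "\<dots> = sign (gdeg Y) * extension g (\<lambda>Z'. extension g (\<lambda>Y'. B Y' Z') Y) Z"
      unfolding extension_push[symmetric] by (subst extension_swap) (rule refl)
    finally show "extension g (\<lambda>Y'. extension g (\<lambda>Y''. B Y'' Z) Y' + sign (gdeg Y' + 1) * extension g (B Y') Z) Y +
     sign (gdeg Y + 1) * extension g (\<lambda>Z'. extension g (\<lambda>Y''. B Y'' Z') Y + sign (gdeg Y + 1) * extension g (B Y) Z') Z =
     extension g (extension g (\<lambda>Y'. B Y' Z)) Y + extension g (extension g (B Y)) Z"
      by (simp add: extension_add extension_push[symmetric] distrib_left) (simp add: op_simps)
  qed
  ultimately show ?thesis
    by simp
qed

text \<open>Both factors are nonempty, so inductions on the length reach them;
  \<open>blen_nths_cobracket\<close> says the same for the other operation.\<close>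

lemma blen_nths_coproduct:
  assumes X: "X \<in> bwords E" and k: "p \<in> Poly_Mapping.keys (coproduct X :: _ \<Rightarrow>\<^sub>0 'k::field)"
  shows "blen (fst p) < blen X" "blen (snd p) < blen X"
proof -
  have c: "blen (fst p) + blen (snd p) = blen X"
  proof -
    have n: "blen (nths X I) + blen (nths X (- I)) = blen X" for I
    proof (induction X arbitrary: I)
      case (Cons w X)
      have "{j. Suc j \<in> - I} = - {j. Suc j \<in> I}" by auto
      then show ?case
        using Cons[of "{j. Suc j \<in> I}"] by (simp add: nths_Cons blen_def)
    qed (simp add: blen_def)
    have "Poly_Mapping.keys (coproduct X :: _ \<Rightarrow>\<^sub>0 'k) \<subseteq> {p. blen (fst p) + blen (snd p) = blen X}"
      unfolding coproduct_def by (intro keys_sum keys_cscale) (simp add: n)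
    then show ?thesis
      using k by blast
  qed
  moreover have "fst p \<in> bwords E" "snd p \<in> bwords E"
    using keys_coproduct[OF X] k by (auto simp: mem_Times_iff)
  then have "blen (fst p) > 0" "blen (snd p) > 0"
    by (auto simp: blen_def bwords_iff neq_Nil_conv)
  ultimately show "blen (fst p) < blen X" "blen (snd p) < blen X"
    by auto
qed

lemma blen_nths_cobracket:
  assumes X: "X \<in> bwords E" and k: "p \<in> Poly_Mapping.keys (cobracket X :: _ \<Rightarrow>\<^sub>0 'k::field)"
  shows "blen (fst p) < blen X" "blen (snd p) < blen X"
proof -
  have c: "blen (fst p) + blen (snd p) = blen X"
  proof -
    have n1: "blen (nths X I) + blen (nths X (- I)) = blen X" for I and X :: "'b bword"
    proof (induction X arbitrary: I)
      case (Cons w X)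
      have "{j. Suc j \<in> - I} = - {j. Suc j \<in> I}" by auto
      then show ?case
        using Cons[of "{j. Suc j \<in> I}"] by (simp add: nths_Cons blen_def)
    qed (simp add: blen_def)
    have n: "blen (nths X I) + length (X ! k) + blen (nths X (- insert k I)) = blen X"
      if "k < length X" "k \<notin> I" for k I and X :: "'b bword"
      using that
    proof (induction X arbitrary: I k)
      case (Cons w X)
      show ?case
      proof (cases k)
        case 0
        have "{j. Suc j \<in> - insert 0 I} = - {j. Suc j \<in> I}" by auto
        then show ?thesis
          using 0 Cons.prems n1[of X "{j. Suc j \<in> I}"] by (simp add: nths_Cons blen_def)
      next
        case (Suc k')
        have "{j. Suc j \<in> - insert (Suc k') I} = - insert k' {j. Suc j \<in> I}" by auto
        then show ?thesis
          using Suc Cons.prems Cons.IH[of k' "{j. Suc j \<in> I}"] by (simp add: nths_Cons blen_def)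
      qed
    qed simp
    have "Poly_Mapping.keys (cobracket X :: _ \<Rightarrow>\<^sub>0 'k) \<subseteq> {p. blen (fst p) + blen (snd p) = blen X}"
      unfolding cobracket_def Let_def
    proof (intro keys_sum keys_cscale keys_minus)
      fix k I r
      assume "k \<in> {..<length X}" "I \<in> Pow ({..<length X} - {k})" "r \<in> {0<..<length (X ! k)}"
      then have "blen (nths X I) + length (X ! k) + blen (nths X (- insert k I)) = blen X" "r < length (X ! k)"
        by (auto intro!: n)
      then show "Poly_Mapping.keys (basis (nths X I @ [take r (X ! k)], [drop r (X ! k)] @ nths X (- insert k I)) :: _ \<Rightarrow>\<^sub>0 'k) \<subseteq> {p. blen (fst p) + blen (snd p) = blen X}"
         "Poly_Mapping.keys (basis (nths X I @ [drop r (X ! k)], [take r (X ! k)] @ nths X (- insert k I)) :: _ \<Rightarrow>\<^sub>0 'k) \<subseteq> {p. blen (fst p) + blen (snd p) = blen X}"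
        by (simp_all add: blen_def)
    qed
    then show ?thesis
      using k by blast
  qed
  moreover have "fst p \<in> bwords E" "snd p \<in> bwords E"
    using keys_cobracket[OF X] k by (auto simp: mem_Times_iff)
  then have "blen (fst p) > 0" "blen (snd p) > 0"
    by (auto simp: blen_def bwords_iff neq_Nil_conv)
  ultimately show "blen (fst p) < blen X" "blen (snd p) < blen X"
    by auto
qed

context graded_space
begin

lemma cochain_add: "cochain F \<Longrightarrow> cochain G \<Longrightarrow> cochain (\<lambda>Y. F Y + G Y)"
  unfolding cochain_def multilinear_iff
  by (auto intro: block_symmetric_add shuffle_free_add linear_relation_add)

lemma cochain_scaled: "cochain F \<Longrightarrow> cochain (\<lambda>Y. t * F Y)"
  unfolding cochain_def
proof (intro conjI allI)
  assume F: "block_symmetric F \<and> (\<forall>R. shuffle_free (\<lambda>w. F (w # R)) \<and> multilinear (\<lambda>w. F (w # R)))"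
  show "block_symmetric (\<lambda>Y. t * F Y)"
    using conjunct1[OF F] unfolding block_symmetric_def by (metis mult.left_commute)
  show "shuffle_free (\<lambda>w. t * F (w # R))" "multilinear (\<lambda>w. t * F (w # R))" for R
    by (intro shuffle_free_scaled multilinear_scaled; use F in blast)+
qed

lemma cochain_Nil: "cochain F \<Longrightarrow> F ([] # R) = 0"
  unfolding cochain_def using shuffle_free_Nil by blast

lemma cochain_signed:
  assumes F: "cochain F"
  shows "cochain (\<lambda>Y. sign (gdeg Y + d) * F Y)"
  unfolding cochain_def
proof (intro conjI allI)
  show "block_symmetric (\<lambda>Y. sign (gdeg Y + d) * F Y)"
    by (rule block_symmetric_signedI[where d = d and e = 1]) (use F in \<open>simp_all add: cochain_def\<close>)
  fix R
  show "shuffle_free (\<lambda>w. sign (gdeg (w # R) + d) * F (w # R))"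
    by (rule shuffle_free_signedI[where d = "gdeg R + d - 1" and e = 1]) (use F in \<open>simp_all add: cochain_def\<close>)
  show "multilinear (\<lambda>w. sign (gdeg (w # R) + d) * F (w # R))"
    by (rule multilinear_signed[where a = "gdeg R + d - 1" and b = 1]) (use F in \<open>simp_all add: cochain_def\<close>)
qed

lemma cochain_extension_fun:
  fixes B :: "'v bword \<Rightarrow> 'v bword \<Rightarrow> 'k"
  assumes B: "\<And>Z. cochain (\<lambda>Y. B Y Z)"
  shows "cochain (\<lambda>Y. extension g (B Y) Z)"
proof -
  have s: "block_symmetric (\<lambda>Y. B Y Z)" and sf: "shuffle_free (\<lambda>w. B (w # R) Z)" and ml: "multilinear (\<lambda>w. B (w # R) Z)" for R Z
    using B by (auto simp: cochain_def)
  have "block_symmetric (\<lambda>Y. extension g (B Y) Z)"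
    unfolding extension_def
    by (intro block_symmetric_split_blocks block_symmetric_lie_extension_fun s)
  moreover have "shuffle_free (\<lambda>w. extension g (B (w # R)) Z)" for R
    unfolding extension_def
    by (intro shuffle_free_split_blocks shuffle_free_lie_extension sf)
  moreover have "multilinear (\<lambda>w. extension g (B (w # R)) Z)" for R
    unfolding multilinear_iff
  proof (intro allI impI)
    fix s n c a b
    assume "a \<in> E s n" "b \<in> E s n"
    then have "linear_relation c (s, n, scale c a + b) (s, n, a) (s, n, b) (\<lambda>w. B (w # R) Z)" for Z
      using ml by (simp add: multilinear_iff)
    then show "linear_relation c (s, n, scale c a + b) (s, n, a) (s, n, b) (\<lambda>w. extension g (B (w # R)) Z)"
      by (intro linear_relation_fun_op[OF _ _ _ additive_op_extension]) (simp_all add: extension_push)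
  qed
  ultimately show ?thesis
    by (simp add: cochain_def)
qed

lemma bilinear_cochain_extension:
  assumes \<gamma>: "cogenerator_map scale E \<gamma>" and B: "bilinear_cochain B"
  shows "bilinear_cochain (\<lambda>Y Z. extension (coletter \<gamma>) (\<lambda>Y'. B Y' Z) Y +
    sign (gdeg Y + d) * extension (coletter \<gamma>) (B Y) Z)"
proof -
  have c: "cochain (\<lambda>Y. B Y Z)" "cochain (B Y)" for Y Z
    using B by (auto simp: bilinear_cochain_def)
  show ?thesis
    unfolding bilinear_cochain_def
    by (intro conjI allI cochain_add cochain_signed cochain_scaled cochain_extension[OF \<gamma>] cochain_extension_fun c)
qed

lemma bicochain_Nil:
  assumes "bicochain B"
  shows "B [] Y = 0" "B Y [] = 0" "B ([] # Y) Z = 0" "B Y ([] # Z) = 0"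
  using assms by (auto simp: bicochain_def supported_def bwords_iff)

lemma coext_chains: "cogenerator_map scale E \<gamma> \<Longrightarrow> X \<in> bwords E \<Longrightarrow> coext \<gamma> X \<in> chains E"
  using keys_coext[of \<gamma> X] by (auto simp: chains_def)

lemma keys_coext_lin_ext:
  assumes \<gamma>: "cogenerator_map scale E \<gamma>" and X: "X \<in> bwords E"
  shows "Poly_Mapping.keys (lin_ext cscale (coext \<gamma>) (coext \<gamma> X)) \<subseteq>
    {Y \<in> bwords E. gdeg Y = gdeg X + 2 \<and> cdeg Y = cdeg X \<and> blen Y \<le> blen X}"
proof (rule keys_lin_ext)
  fix W
  assume "W \<in> Poly_Mapping.keys (coext \<gamma> X)"
  then have W: "W \<in> bwords E" "gdeg W = gdeg X + 1" "cdeg W = cdeg X" "blen W \<le> blen X"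
    using keys_coext[OF \<gamma> X] by auto
  show "Poly_Mapping.keys (coext \<gamma> W) \<subseteq> {Y \<in> bwords E. gdeg Y = gdeg X + 2 \<and> cdeg Y = cdeg X \<and> blen Y \<le> blen X}"
    using keys_coext[OF \<gamma> W(1)] W by auto
qed

lemma extension_coletter_proj1:
  assumes "X \<in> bwords E"
  shows "extension (coletter \<gamma>) proj1 X = \<gamma> X"
  using assms by (subst extension_proj1) (auto simp: bwords_iff coletter_def)

lemma extension_relations_0:
  assumes "cochain F" "lin_ext cscale (coext \<gamma>) (coext \<gamma> Y) \<in> relations scale E"
  shows "extension (coletter \<gamma>) (extension (coletter \<gamma>) F) Y = 0"
  using cochain_relations[OF assms]
  by (simp add: field.lin_ext_lin_ext lin_ext_coext)

text \<open>The 4 is the 3 of a cogenerator map plus the degree 1 of the coderivation.\<close>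

lemma extension_degree:
  assumes \<gamma>: "cogenerator_map scale E \<gamma>" and X: "X \<in> bwords E"
  shows "extension (coletter \<gamma>) \<gamma> X \<in> E (cdeg X) (gdeg X + 4)"
proof -
  have "\<gamma> Y \<in> E (cdeg X) (gdeg X + 4)" if "Y \<in> Poly_Mapping.keys (coext \<gamma> X)" for Y
  proof -
    have "Y \<in> bwords E" and e: "gdeg X + 4 = gdeg Y + 3" "cdeg X = cdeg Y"
      using that keys_coext[OF \<gamma> X] by auto
    then show ?thesis
      unfolding e using \<gamma> by (simp add: cogenerator_map_def)
  qed
  then show ?thesis
    unfolding lin_ext_coext_vector[symmetric] lin_ext_def
    by (intro subspace_sum[OF subspace_E] subspace_scale[OF subspace_E])
qed

text \<open>The square of a coderivation is a coderivation, hence it is determined by its corestriction.\<close>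

lemma coext_square:
  assumes \<gamma>: "cogenerator_map scale E \<gamma>" and X: "X \<in> bwords E"
    and low: "\<And>Y. Y \<in> bwords E \<Longrightarrow> blen Y < blen X \<Longrightarrow> extension (coletter \<gamma>) \<gamma> Y = 0"
  shows "lin_ext cscale (coext \<gamma>) (coext \<gamma> X) -
    basis [[(cdeg X, gdeg X + 4, extension (coletter \<gamma>) \<gamma> X)]] \<in> relations scale E"
  using X low
proof (induction "blen X" arbitrary: X rule: less_induct)
  case less
  let ?g = "coletter \<gamma>" and ?D = "lin_ext cscale (coext \<gamma>)"
  let ?y = "?D (coext \<gamma> X)" and ?O = "extension (coletter \<gamma>) \<gamma> X"
  note X = \<open>X \<in> bwords E\<close>
  note k = keys_coext_lin_ext[OF \<gamma> X]
  have IH: "?D (coext \<gamma> Y) \<in> relations scale E" if Y: "Y \<in> bwords E" "blen Y < blen X" for Y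
  proof -
    have "[[(cdeg Y, gdeg Y + 4, 0)]] \<in> bwords E"
      by (simp add: bwords_iff letters_def zero_E)
    \<comment> \<open>The relation \<open>homogeneous\<close> with scalar 0 turns a word with a zero
      letter into a relation. So for shorter words the one-letter term of the claim may be
      dropped.\<close>
    then have "basis [[(cdeg Y, gdeg Y + 4, 0)]] - cscale 0 (basis [[(cdeg Y, gdeg Y + 4, 0)]]) \<in> coalgebra_rel scale E"
      using coalgebra_rel.homogeneous[of "[]" "[]" "cdeg Y" "gdeg Y + 4" 0 "[]" "[]" E scale 0] by simp
    then have "basis [[(cdeg Y, gdeg Y + 4, 0)]] \<in> relations scale E"
      unfolding relations_def using chain.span_base by fastforce
    moreover have "?D (coext \<gamma> Y) - basis [[(cdeg Y, gdeg Y + 4, 0)]] \<in> relations scale E"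
      using less.hyps[OF Y(2,1)] less.prems(2) Y by simp
    ultimately show ?thesis
      unfolding relations_def using chain.span_add by fastforce
  qed
  have Oe: "?O \<in> E (cdeg X) (gdeg X + 4)"
    by (rule extension_degree[OF \<gamma> X])
  have cop: "lin_ext cscale coproduct ?y \<in> relations2 scale E"
  proof (rule in_relations2I)
    show "Poly_Mapping.keys (lin_ext cscale coproduct ?y) \<subseteq> bwords E \<times> bwords E"
      using k by (intro keys_lin_ext keys_coproduct) auto
    fix B assume B: "bicochain B"
    note B0 = bicochain_Nil[OF B]
    have c: "cochain (\<lambda>Y. B Y Z)" "cochain (B Y)" for Y Z
      using B by (auto simp: bicochain_def)
    have "lin_ext (*) (\<lambda>(Y, Z). B Y Z) (lin_ext cscale coproduct ?y) = extension ?g (extension ?g (\<lambda>Z. split_blocks Z B)) X"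
      by (simp only: field.lin_ext_lin_ext lin_ext_coproduct[of B, OF B0(1,2)] lin_ext_coext)
    also have "\<dots> = lin_ext (*) (\<lambda>(Y, Z). extension ?g (extension ?g (\<lambda>Y'. B Y' Z)) Y + extension ?g (extension ?g (B Y)) Z) (coproduct X)"
      unfolding extension_split_blocks_square[OF degree_compatible_coletter]
    proof (rule lin_ext_coproduct[symmetric])
      have z: "B [] = (\<lambda>Y. 0)" "(\<lambda>Y. B Y []) = (\<lambda>Y. 0)" "extension ?g (\<lambda>Y. 0 :: 'k) = (\<lambda>Y. 0)"
        by (auto simp: B0 extension_zero)
      fix Y
      show "extension ?g (extension ?g (\<lambda>Y'. B Y' Y)) [] + extension ?g (extension ?g (B [])) Y = 0"
        "extension ?g (extension ?g (\<lambda>Y'. B Y' [])) Y + extension ?g (extension ?g (B Y)) [] = 0"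
        unfolding z by (simp_all add: extension_Nil extension_zero)
    qed
    also have "\<dots> = lin_ext (*) (\<lambda>p. 0) (coproduct X)"
    proof (rule lin_ext_cong)
      fix p assume p: "p \<in> Poly_Mapping.keys (coproduct X :: _ \<Rightarrow>\<^sub>0 'k)"
      have "fst p \<in> bwords E" "snd p \<in> bwords E"
        using keys_coproduct[OF X] p by (auto simp: mem_Times_iff)
      then show "(\<lambda>(Y, Z). extension ?g (extension ?g (\<lambda>Y'. B Y' Z)) Y + extension ?g (extension ?g (B Y)) Z) p = 0"
        using blen_nths_coproduct[OF X p] by (simp add: split_beta extension_relations_0[OF c(1) IH] extension_relations_0[OF c(2) IH])
    qed
    finally show "lin_ext (*) (\<lambda>(Y, Z). B Y Z) (lin_ext cscale coproduct ?y) = 0"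
      by (simp add: field.lin_ext_fun_0)
  qed
  have cob: "lin_ext cscale cobracket ?y \<in> relations2 scale E"
  proof (rule in_relations2I)
    show "Poly_Mapping.keys (lin_ext cscale cobracket ?y) \<subseteq> bwords E \<times> bwords E"
      using k by (intro keys_lin_ext keys_cobracket) auto
    fix B assume B: "bicochain B"
    note B0 = bicochain_Nil[OF B] and bc = bicochain_bilinear_cochain[OF B]
    have c: "cochain (\<lambda>Y. B Y Z)" "cochain (B Y)" for Y Z
      using B by (auto simp: bicochain_def)
    have s: "block_symmetric (\<lambda>Y. B Y Z)" for Z
      using c by (simp add: cochain_def)
    have sq: "cochain (\<lambda>Y. extension ?g (extension ?g (\<lambda>Y'. B Y' Z)) Y + extension ?g (extension ?g (B Y)) Z)"
      "cochain (\<lambda>Z. extension ?g (extension ?g (\<lambda>Y'. B Y' Z)) Y + extension ?g (extension ?g (B Y)) Z)" for Y Z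
      by (intro cochain_add cochain_extension[OF \<gamma>] cochain_extension_fun c)+
    have "lin_ext (*) (\<lambda>(Y, Z). B Y Z) (lin_ext cscale cobracket ?y) = extension ?g (extension ?g (\<lambda>Z. cobracket_sum Z B)) X"
      by (simp only: field.lin_ext_lin_ext lin_ext_cobracket[of B, OF s B0(3,4)] lin_ext_coext)
    also have "\<dots> = lin_ext (*) (\<lambda>(Y, Z). extension ?g (extension ?g (\<lambda>Y'. B Y' Z)) Y + extension ?g (extension ?g (B Y)) Z) (cobracket X)"
      unfolding extension_cobracket_sum_square[OF degree_compatible_coletter
          bilinear_functional_bilinear_cochain[OF \<gamma> bc]
          bilinear_functional_bilinear_cochain[OF \<gamma> bilinear_cochain_extension[OF \<gamma> bc]]]
      by (rule lin_ext_cobracket[symmetric]) (simp_all only: cochain_Nil[OF sq(1)] cochain_Nil[OF sq(2)] sq(1)[unfolded cochain_def])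
    also have "\<dots> = lin_ext (*) (\<lambda>p. 0) (cobracket X)"
    proof (rule lin_ext_cong)
      fix p assume p: "p \<in> Poly_Mapping.keys (cobracket X :: _ \<Rightarrow>\<^sub>0 'k)"
      have "fst p \<in> bwords E" "snd p \<in> bwords E"
        using keys_cobracket[OF X] p by (auto simp: mem_Times_iff)
      then show "(\<lambda>(Y, Z). extension ?g (extension ?g (\<lambda>Y'. B Y' Z)) Y + extension ?g (extension ?g (B Y)) Z) p = 0"
        using blen_nths_cobracket[OF X p] by (simp add: split_beta extension_relations_0[OF c(1) IH] extension_relations_0[OF c(2) IH])
    qed
    finally show "lin_ext (*) (\<lambda>(Y, Z). B Y Z) (lin_ext cscale cobracket ?y) = 0"
      by (simp add: field.lin_ext_fun_0)
  qed
  have y: "?y \<in> chains E"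
    using k by (auto simp: chains_def)
  have p: "lin_ext scale proj1 ?y = ?O"
  proof -
    have "lin_ext scale proj1 ?y = lin_ext scale (\<lambda>W. extension ?g proj1 W) (coext \<gamma> X)"
      by (simp add: lin_ext_lin_ext lin_ext_coext_vector)
    also have "\<dots> = lin_ext scale \<gamma> (coext \<gamma> X)"
      by (rule lin_ext_cong, rule extension_coletter_proj1) (use keys_coext[OF \<gamma> X] in auto)
    finally show ?thesis
      by (simp add: lin_ext_coext_vector)
  qed
  have bw: "[[(cdeg X, gdeg X + 4, ?O)]] \<in> bwords E"
    using Oe by (simp add: bwords_iff letters_def)
  show ?case
  proof (rule in_relationsI)
    show "?y - basis [[(cdeg X, gdeg X + 4, ?O)]] \<in> chains E"
      using y bw by (intro chain.subspace_diff[OF chains_subspace] basis_chains)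
    fix F assume F: "cochain F" "supported F"
    have "lin_ext (*) F ?y = F [[(cdeg X, (gdeg X + 2) + 2, lin_ext scale proj1 ?y)]]"
      by (rule primitive_corestriction[OF y _ cop cob F]) (use k in auto)
    then show "lin_ext (*) F (?y - basis [[(cdeg X, gdeg X + 4, ?O)]]) = 0"
      by (simp add: field.lin_ext_diff p add.commute)
  qed
qed

text \<open>By induction on the length, the difference is killed by coproduct and cobracket modulo
  relations, as both rules refer only to shorter words. By \<open>primitive_corestriction\<close> it
  is determined by its corestriction, which is 0.\<close>

lemma coderivation_unique:
  assumes \<gamma>: "cogenerator_map scale E \<gamma>" and Q: "coderivation scale E Q"
    and p: "\<And>X. X \<in> bwords E \<Longrightarrow> lin_ext scale proj1 (Q X) = \<gamma> X" and X: "X \<in> bwords E"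
  shows "Q X - coext \<gamma> X \<in> relations scale E"
  using X
proof (induction "blen X" arbitrary: X rule: less_induct)
  case less
  note X = \<open>X \<in> bwords E\<close>
  note R = coderivation_coext[OF \<gamma>]
  let ?y = "Q X - coext \<gamma> X"
  have QX: "Q Y \<in> chains E" "\<And>Z. Z \<in> Poly_Mapping.keys (Q Y) \<Longrightarrow> gdeg Z = gdeg Y + 1 \<and> cdeg Z = cdeg Y" if "Y \<in> bwords E" for Y
    using Q that by (auto simp: coderivation_def)
  have y: "?y \<in> chains E"
    using QX(1)[OF X] coext_chains[OF \<gamma> X] by (rule chain.subspace_diff[OF chains_subspace])
  have hom: "gdeg Z = gdeg X + 1 \<and> cdeg Z = cdeg X" if "Z \<in> Poly_Mapping.keys ?y" for Z
  proof -
    have "Z \<in> Poly_Mapping.keys (Q X) \<or> Z \<in> Poly_Mapping.keys (coext \<gamma> X)"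
      using that by (auto simp: in_keys_iff lookup_minus)
    then show ?thesis
      using QX(2)[OF X] keys_coext[OF \<gamma> X] by blast
  qed
  have IH: "lin_ext (*) F (Q Y) = lin_ext (*) F (coext \<gamma> Y)" if "cochain F" "Y \<in> bwords E" "blen Y < blen X" for F Y
    using cochain_relations[OF that(1) less.hyps[OF that(3,2)]] by (simp add: field.lin_ext_diff)
  \<comment> \<open>One argument for both operations: \<open>f\<close> is the coproduct or the
    cobracket, and \<open>c\<close> is the sign in its coderivation rule.\<close>
  have main: "lin_ext cscale f ?y \<in> relations2 scale E"
    if f: "\<And>P. coderivation scale E P \<Longrightarrow> lin_ext cscale f (P X) - lin_ext cscale (\<lambda>(Y, Z). chain_tensor (P Y) (basis Z) +
        cscale (c (gdeg Y)) (chain_tensor (basis Y) (P Z))) (f X) \<in> relations2 scale E"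
      and kf: "\<And>Y. Y \<in> bwords E \<Longrightarrow> Poly_Mapping.keys (f Y :: _ \<Rightarrow>\<^sub>0 'k) \<subseteq> bwords E \<times> bwords E"
      and bf: "\<And>p. p \<in> Poly_Mapping.keys (f X) \<Longrightarrow> blen (fst p) < blen X \<and> blen (snd p) < blen X"
    for f and c :: "int \<Rightarrow> 'k"
  proof (rule in_relations2I)
    show "Poly_Mapping.keys (lin_ext cscale f ?y) \<subseteq> bwords E \<times> bwords E"
      by (intro keys_lin_ext kf) (use y in \<open>auto dest: keys_chainsD\<close>)
    fix B assume B: "bicochain B"
    have cc: "cochain (\<lambda>Y. B Y Z)" "cochain (B Y)" for Y Z
      using B by (auto simp: bicochain_def)
    have e: "lin_ext (*) (\<lambda>(Y, Z). B Y Z) (lin_ext cscale f (P X)) =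
       lin_ext (*) (\<lambda>(Y, Z). lin_ext (*) (\<lambda>Y'. B Y' Z) (P Y) + c (gdeg Y) * lin_ext (*) (B Y) (P Z)) (f X)"
      if "coderivation scale E P" for P
    proof -
      have "lin_ext (*) (\<lambda>(Y, Z). B Y Z) (lin_ext cscale f (P X)) =
        lin_ext (*) (\<lambda>(Y, Z). B Y Z) (lin_ext cscale (\<lambda>(Y, Z). chain_tensor (P Y) (basis Z) +
        cscale (c (gdeg Y)) (chain_tensor (basis Y) (P Z))) (f X))"
        using bicochain_relations2[OF B f[OF that]] by (simp add: field.lin_ext_diff)
      then show ?thesis
        by (simp add: field.lin_ext_lin_ext case_prod_unfold field.lin_ext_add field.lin_ext_cscale lin_ext_chain_tensor)
    qed
    have "lin_ext (*) (\<lambda>(Y, Z). lin_ext (*) (\<lambda>Y'. B Y' Z) (Q Y) + c (gdeg Y) * lin_ext (*) (B Y) (Q Z)) (f X) =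
      lin_ext (*) (\<lambda>(Y, Z). lin_ext (*) (\<lambda>Y'. B Y' Z) (coext \<gamma> Y) + c (gdeg Y) * lin_ext (*) (B Y) (coext \<gamma> Z)) (f X)"
    proof (rule lin_ext_cong)
      fix p assume p: "p \<in> Poly_Mapping.keys (f X)"
      have "fst p \<in> bwords E" "snd p \<in> bwords E"
        using kf[OF X] p by (auto simp: mem_Times_iff)
      then show "(\<lambda>(Y, Z). lin_ext (*) (\<lambda>Y'. B Y' Z) (Q Y) + c (gdeg Y) * lin_ext (*) (B Y) (Q Z)) p =
        (\<lambda>(Y, Z). lin_ext (*) (\<lambda>Y'. B Y' Z) (coext \<gamma> Y) + c (gdeg Y) * lin_ext (*) (B Y) (coext \<gamma> Z)) p"
        using bf[OF p] by (simp add: split_beta IH[OF cc(1)] IH[OF cc(2)])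
    qed
    then show "lin_ext (*) (\<lambda>(Y, Z). B Y Z) (lin_ext cscale f ?y) = 0"
      by (simp add: chain.lin_ext_diff field.lin_ext_diff e[OF Q] e[OF R])
  qed
  have cop: "lin_ext cscale coproduct ?y \<in> relations2 scale E"
  proof (rule main[where c = sign])
    show "lin_ext cscale coproduct (P X) - lin_ext cscale (\<lambda>(Y, Z). chain_tensor (P Y) (basis Z) +
        cscale (sign (gdeg Y)) (chain_tensor (basis Y) (P Z))) (coproduct X) \<in> relations2 scale E"
      if "coderivation scale E P" for P
      using that X unfolding coderivation_def by blast
  qed (rule keys_coproduct, assumption, intro conjI blen_nths_coproduct[OF X])
  have cob: "lin_ext cscale cobracket ?y \<in> relations2 scale E"
  proof (rule main[where c = "\<lambda>n. sign (n + 1)"])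
    show "lin_ext cscale cobracket (P X) - lin_ext cscale (\<lambda>(Y, Z). chain_tensor (P Y) (basis Z) +
        cscale (sign (gdeg Y + 1)) (chain_tensor (basis Y) (P Z))) (cobracket X) \<in> relations2 scale E"
      if "coderivation scale E P" for P
      using that X unfolding coderivation_def by blast
  qed (rule keys_cobracket, assumption, intro conjI blen_nths_cobracket[OF X])
  have p0: "lin_ext scale proj1 ?y = 0"
    by (simp add: lin_ext_diff p[OF X] lin_ext_coext_vector extension_coletter_proj1[OF X])
  show ?case
  proof (rule in_relationsI[OF y])
    fix F assume F: "cochain F" "supported F"
    have "lin_ext (*) F ?y = F [[(cdeg X, (gdeg X + 1) + 2, lin_ext scale proj1 ?y)]]"
      by (rule primitive_corestriction[OF y hom cop cob F])
    also have "\<dots> = 0"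
      unfolding p0 using letter_linear_0[OF cochain_letter_linear[OF F(1), of "[]" "[]" "[]"]] by simp
    finally show "lin_ext (*) F ?y = 0" .
  qed
qed

text \<open>Any \<open>Q\<close> differs from the explicit coextension by relations, on which the
  cogenerator map vanishes. So the existential quantifier can be replaced by one formula, in both
  directions.\<close>

lemma G_structure_iff:
  "G_structure scale E r \<gamma> \<longleftrightarrow> cogenerator_map scale E (truncate r \<gamma>) \<and>
     (\<forall>X\<in>bwords E. enat (blen X) \<le> r \<longrightarrow> extension (coletter (truncate r \<gamma>)) (truncate r \<gamma>) X = 0)"
proof (intro iffI conjI ballI impI)
  assume G: "G_structure scale E r \<gamma>"
  then show c: "cogenerator_map scale E (truncate r \<gamma>)"
    by (simp add: G_structure_def)
  fix X assume X: "X \<in> bwords E" "enat (blen X) \<le> r"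
  obtain Q where Q: "coderivation scale E Q" "\<And>X. X \<in> bwords E \<Longrightarrow> lin_ext scale proj1 (Q X) = truncate r \<gamma> X"
    "\<And>X. X \<in> bwords E \<Longrightarrow> enat (blen X) \<le> r \<Longrightarrow> lin_ext scale (truncate r \<gamma>) (Q X) = 0"
    using G unfolding G_structure_def by blast
  have "Q X - coext (truncate r \<gamma>) X \<in> relations scale E"
    by (rule coderivation_unique[OF c Q(1,2) X(1)])
  then have "lin_ext scale (truncate r \<gamma>) (Q X - coext (truncate r \<gamma>) X) = 0"
    using c by (simp add: cogenerator_map_def)
  then show "extension (coletter (truncate r \<gamma>)) (truncate r \<gamma>) X = 0"
    by (simp add: lin_ext_diff Q(3)[OF X] lin_ext_coext_vector)
next
  assume G: "cogenerator_map scale E (truncate r \<gamma>) \<and>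
     (\<forall>X\<in>bwords E. enat (blen X) \<le> r \<longrightarrow> extension (coletter (truncate r \<gamma>)) (truncate r \<gamma>) X = 0)"
  show "G_structure scale E r \<gamma>"
    unfolding G_structure_def
    using G coderivation_coext[of "truncate r \<gamma>"]
    by (intro conjI exI[of _ "coext (truncate r \<gamma>)"])
      (auto simp: lin_ext_coext_vector extension_coletter_proj1)
qed

end

section \<open>Extension of the structure\<close>

lemma enat_le_2: "enat n \<le> 2 \<longleftrightarrow> n \<le> 2"
  by (metis enat_ord_simps(1) numeral_eq_enat)

lemma truncate_infinity [simp]: "truncate \<infinity> \<gamma> = \<gamma>"
  by (simp add: truncate_def fun_eq_iff)

context graded_space
begin

lemma cogenerator_mapI:
  assumes "\<And>X. X \<in> bwords E \<Longrightarrow> \<gamma> X \<in> E (cdeg X) (gdeg X + 3)"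
    and "\<And>x. x \<in> coalgebra_rel scale E \<Longrightarrow> lin_ext scale \<gamma> x = 0"
  shows "cogenerator_map scale E \<gamma>"
proof -
  have "lin_ext scale \<gamma> x = 0" if "x \<in> relations scale E" for x
    using that unfolding relations_def
    by (induction rule: chain.span_induct_alt) (simp_all add: lin_ext_add lin_ext_cscale assms(2))
  then show ?thesis
    using assms(1) by (simp add: cogenerator_map_def)
qed

lemma lin_ext_linear:
  assumes "Vector_Spaces.linear scale scale f"
  shows "f (lin_ext scale F x) = lin_ext scale (\<lambda>w. f (F w)) x"
proof -
  interpret f: Vector_Spaces.linear scale scale f by fact
  show ?thesis
    by (simp add: lin_ext_def f.sum f.scale)
qed

text \<open>The locale asks only for subspaces, so all previous results also apply to
  \<open>V\<close> in conformal degree 0, whose parts need not span the whole type.\<close>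

lemma conformal_zero_graded_space: "graded_space scale (conformal_zero E)"
  by unfold_locales (simp add: conformal_zero_def subspace_E)

lemma letters_conformal_zero: "letters (conformal_zero E) \<subseteq> letters E"
  by (auto simp: letters_def conformal_zero_def zero_E split: if_splits)

lemma bwords_conformal_zero: "X \<in> bwords (conformal_zero E) \<Longrightarrow> X \<in> bwords E"
  using letters_conformal_zero by (auto simp: bwords_iff)

text \<open>Conformal degrees are nonnegative, so a word of total degree 0 has only letters of
  degree 0.\<close>

lemma bwords_conformal_zeroI:
  assumes "X \<in> bwords E" "cdeg X = 0"
  shows "X \<in> bwords (conformal_zero E)"
proof -
  have "fst l = 0" if "l \<in> set (concat X)" for l
    using assms(2) that by (auto simp: cdeg_def sum_list_eq_0_iff)
  then have "l \<in> letters (conformal_zero E)" if "w \<in> set X" "l \<in> set w" for w l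
    using assms(1) that by (fastforce simp: bwords_iff letters_def conformal_zero_def)
  then show ?thesis
    using assms(1) by (auto simp: bwords_iff)
qed

text \<open>One term of conformal degree 0 suffices: every relation is homogeneous, and the words to
  which its rule is applied then have degree 0 too.\<close>

lemma coalgebra_rel_conformal_zero:
  assumes x: "x \<in> coalgebra_rel scale E" and Z: "Z \<in> Poly_Mapping.keys x" "cdeg Z = 0"
  shows "x \<in> coalgebra_rel scale (conformal_zero E)"
proof -
  have diff: "Z \<in> Poly_Mapping.keys (basis A - cscale c (basis B)) \<Longrightarrow> Z = A \<or> Z = B" for A B and c :: 'k
    by (auto simp: in_keys_iff lookup_minus lookup_cscale lookup_single when_def split: if_splits)
  have diff2: "Z \<in> Poly_Mapping.keys (basis A - basis B - basis C :: _ \<Rightarrow>\<^sub>0 'k) \<Longrightarrow> Z = A \<or> Z = B \<or> Z = C" for A B C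
    by (auto simp: in_keys_iff lookup_minus lookup_single when_def split: if_splits)
  show ?thesis
    using x
  proof cases
    case (additive X p s n a q Y b)
    have "cdeg (X @ [p @ [(s, n, a)] @ q] @ Y) = 0" "cdeg (X @ [p @ [(s, n, b)] @ q] @ Y) = 0"
      using diff2[OF Z(1)[unfolded additive(1)]] Z(2) by (auto simp: cdeg_def simp del: sum_list_eq_0_iff)
    then show ?thesis
      unfolding additive(1) by (intro coalgebra_rel.additive bwords_conformal_zeroI additive(2,3))
  next
    case (homogeneous X p s n a q Y c)
    have "cdeg (X @ [p @ [(s, n, a)] @ q] @ Y) = 0"
      using diff[OF Z(1)[unfolded homogeneous(1)]] Z(2) by (auto simp: cdeg_def simp del: sum_list_eq_0_iff)
    then show ?thesis
      unfolding homogeneous(1) by (intro coalgebra_rel.homogeneous bwords_conformal_zeroI homogeneous(2))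
  next
    case (shuffle X u w Y)
    have "shuf u w (\<lambda>x. basis (X @ [x] @ Y)) \<in> {y :: _ \<Rightarrow>\<^sub>0 'k. Poly_Mapping.keys y \<subseteq>
        {Z. cdeg Z = cdeg (X @ [u, w] @ Y)}}"
    proof (rule shuf_closed[OF additive_subgroup_keys])
      fix v
      assume m: "mset v = mset u + mset w"
      have "sum_list (map fst v) = sum_list (map fst u) + sum_list (map fst w)"
        using m by (metis mset_map sum_mset_sum_list sum_list_append map_append mset_append)
      then show "basis (X @ [v] @ Y) \<in> {y :: _ \<Rightarrow>\<^sub>0 'k. Poly_Mapping.keys y \<subseteq>
        {Z. cdeg Z = cdeg (X @ [u, w] @ Y)}}"
        by (simp add: cdeg_def)
    qed
    then have "cdeg (X @ [u, w] @ Y) = 0"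
      using Z unfolding shuffle(1) chain.lin_ext_shuffle by auto
    then show ?thesis
      unfolding shuffle(1) by (intro coalgebra_rel.shuffle bwords_conformal_zeroI shuffle(2))
  next
    case (commute X u w Y)
    have "cdeg (X @ [u, w] @ Y) = 0"
      using diff[OF Z(1)[unfolded commute(1)]] Z(2) by (auto simp: cdeg_def simp del: sum_list_eq_0_iff)
    then show ?thesis
      unfolding commute(1) by (intro coalgebra_rel.commute bwords_conformal_zeroI commute(2))
  qed
qed

end

locale obstruction_data = graded_space scale E
  for scale :: "'k::field_char_0 \<Rightarrow> 'v::ab_group_add \<Rightarrow> 'v" and E +
  fixes m1 h :: "'v \<Rightarrow> 'v" and \<beta> \<gamma>0 :: "'v bword \<Rightarrow> 'v"
  assumes m1_linear: "Vector_Spaces.linear scale scale m1"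
    and h_linear: "Vector_Spaces.linear scale scale h"
    and h_degree: "\<And>s n v. v \<in> E s n \<Longrightarrow> h v \<in> E s (n - 1)"
    and homotopy: "\<And>s v. v \<in> conformal_part scale E s \<Longrightarrow> m1 (h v) + h (m1 v) = scale (of_nat s) v"
    and \<beta>: "G_structure scale E 2 \<beta>"
    and \<beta>_m1: "\<And>l. \<beta> [[l]] = m1 (snd (snd l))"
    and \<gamma>0: "G_infinity_structure scale (conformal_zero E) \<gamma>0"
    and \<gamma>0_\<beta>: "\<And>X. X \<in> bwords (conformal_zero E) \<Longrightarrow> blen X \<le> 2 \<Longrightarrow> \<gamma>0 X = \<beta> X"
begin

interpretation zero: graded_space scale "conformal_zero E"
  by (rule conformal_zero_graded_space)

text \<open>
  \<open>stage n\<close> has the components of length at most \<open>n + 2\<close>; \<open>extension (coletter \<gamma>) \<gamma> X\<close> is the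
  left-hand side of \<open>R\<^sub>1\<^sup>k\<close>, \<open>k = blen X\<close>.
\<close>

primrec stage :: "nat \<Rightarrow> 'v bword \<Rightarrow> 'v" where
  "stage 0 = truncate 2 \<beta>"
| "stage (Suc n) = (\<lambda>X. if blen X = n + 3 then
     if cdeg X = 0 then \<gamma>0 X
     else scale (- inverse (of_nat (cdeg X))) (h (extension (coletter (stage n)) (stage n) X))
   else stage n X)"

lemma stage_high: "blen X > n + 2 \<Longrightarrow> stage n X = 0"
  by (induction n) (simp_all add: truncate_def enat_le_2)

lemma stage_low: "blen X \<le> 2 \<Longrightarrow> stage n X = \<beta> X"
  by (induction n) (simp_all add: truncate_def enat_le_2)

lemma stage_eq: "blen X \<le> n + 2 \<Longrightarrow> blen X \<le> m + 2 \<Longrightarrow> stage n X = stage m X"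
proof -
  have "stage (n + d) X = stage n X" if "blen X \<le> n + 2" for n d
    using that by (induction d) auto
  then show "blen X \<le> n + 2 \<Longrightarrow> blen X \<le> m + 2 \<Longrightarrow> stage n X = stage m X"
    by (metis le_add_diff_inverse nat_le_linear)
qed

lemma stage_conformal_zero:
  assumes "X \<in> bwords E" "cdeg X = 0" "blen X \<le> n + 2"
  shows "stage n X = \<gamma>0 X"
  using assms(3)
proof (induction n)
  case 0
  then show ?case
    using \<gamma>0_\<beta>[OF bwords_conformal_zeroI[OF assms(1,2)]] by (simp add: stage_low del: stage.simps)
next
  case (Suc n)
  then show ?case
    using assms(2) by (cases "blen X = n + 3") auto
qed

text \<open>From a word of conformal degree 0 the coextension reaches only words of that degree,
  where \<open>stage n\<close> agrees with \<open>\<gamma>0\<close> up to length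
  \<open>n + 2\<close>.\<close>

lemma extension_stage_conformal_zero:
  assumes X: "X \<in> bwords E" "cdeg X = 0" "blen X \<le> n + 2"
  shows "extension (coletter (stage n)) (stage n) X = 0"
proof -
  have c0: "cogenerator_map scale (conformal_zero E) \<gamma>0"
    and e0: "extension (zero.coletter \<gamma>0) \<gamma>0 X = 0"
    using \<gamma>0 bwords_conformal_zeroI[OF X(1,2)] by (auto simp: zero.G_structure_iff)
  have X0: "X \<in> bwords (conformal_zero E)"
    by (rule bwords_conformal_zeroI[OF X(1,2)])
  have "extension (coletter (stage n)) (stage n) X = extension (zero.coletter \<gamma>0) (stage n) X"
  proof (rule extension_cong)
    fix Y
    assume Y: "Y \<noteq> []" "[] \<notin> set Y" "set (concat Y) \<subseteq> set (concat X)" "blen Y \<le> blen X" "cdeg Y \<le> cdeg X"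
    have "Y \<in> bwords E"
      using X(1) Y unfolding bwords_def by blast
    moreover have "cdeg Y = 0" "blen Y \<le> n + 2"
      using Y X by auto
    ultimately show "coletter (stage n) Y = zero.coletter \<gamma>0 Y"
      using bwords_conformal_zeroI by (simp add: coletter_def zero.coletter_def stage_conformal_zero del: stage.simps)
  qed
  also have "\<dots> = lin_ext scale (stage n) (zero.coext \<gamma>0 X)"
    by (simp add: zero.lin_ext_coext_vector)
  also have "\<dots> = lin_ext scale \<gamma>0 (zero.coext \<gamma>0 X)"
  proof (rule lin_ext_cong)
    fix Y
    assume "Y \<in> Poly_Mapping.keys (zero.coext \<gamma>0 X)"
    then have "Y \<in> bwords (conformal_zero E)" "cdeg Y = cdeg X" "blen Y \<le> blen X"
      using zero.keys_coext[OF c0 X0] by auto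
    then show "stage n Y = \<gamma>0 Y"
      using X by (intro stage_conformal_zero bwords_conformal_zero) auto
  qed
  also have "\<dots> = 0"
    by (simp add: zero.lin_ext_coext_vector e0)
  finally show ?thesis .
qed

lemma cogenerator_map_stage_Suc:
  assumes g: "cogenerator_map scale E (stage n)"
  shows "cogenerator_map scale E (stage (Suc n))"
proof (rule cogenerator_mapI)
  fix X assume X: "X \<in> bwords E"
  show "stage (Suc n) X \<in> E (cdeg X) (gdeg X + 3)"
  proof (cases "blen X = n + 3")
    case False
    then show ?thesis
      using g X by (simp add: cogenerator_map_def)
  next
    case True
    show ?thesis
    proof (cases "cdeg X = 0")
      case zero: True
      have "\<gamma>0 X \<in> conformal_zero E (cdeg X) (gdeg X + 3)"
        using \<gamma>0 bwords_conformal_zeroI[OF X zero] by (simp add: G_structure_def cogenerator_map_def)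
      then show ?thesis
        using True zero by (simp add: conformal_zero_def)
    next
      case False
      have "h (extension (coletter (stage n)) (stage n) X) \<in> E (cdeg X) (gdeg X + 4 - 1)"
        by (intro h_degree extension_degree g X)
      then show ?thesis
        using True False by (simp add: subspace_scale[OF subspace_E] subspace_neg[OF subspace_E] add.commute)
    qed
  qed
next
  fix x assume x: "x \<in> coalgebra_rel scale E"
  obtain s n' l t where "\<And>Y. Y \<in> Poly_Mapping.keys x \<Longrightarrow>
      Y \<in> bwords E \<and> cdeg Y = s \<and> gdeg Y = n' \<and> blen Y = l \<and> length Y = t"
    by (rule coalgebra_rel_homogeneous[OF x]) blast
  then have k: "cdeg Y = s \<and> blen Y = l" if "Y \<in> Poly_Mapping.keys x" for Y
    using that by blast
  have xr: "x \<in> relations scale E"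
    using x by (simp add: relations_def chain.span_base)
  show "lin_ext scale (stage (Suc n)) x = 0"
  \<comment> \<open>A relation lives in one length and one conformal degree, hence entirely in one
    branch of the definition of \<open>stage\<close>.\<close>
  proof (cases "l = n + 3")
    case False
    have "lin_ext scale (stage (Suc n)) x = lin_ext scale (stage n) x"
      by (rule lin_ext_cong) (use k False in auto)
    then show ?thesis
      using g xr by (simp add: cogenerator_map_def)
  next
    case True
    show ?thesis
    proof (cases "s = 0")
      case zero: True
      have "lin_ext scale (stage (Suc n)) x = lin_ext scale \<gamma>0 x"
        by (rule lin_ext_cong) (use k True zero in auto)
      also have "\<dots> = 0"
      proof (cases "x = 0")
        case False
        then obtain Y where "Y \<in> Poly_Mapping.keys x"
          by (metis all_not_in_conv keys_eq_empty)
        then have "x \<in> coalgebra_rel scale (conformal_zero E)"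
          using coalgebra_rel_conformal_zero[OF x] k zero by blast
        then show ?thesis
          using \<gamma>0 chain.span_base by (auto simp: G_structure_def cogenerator_map_def relations_def)
      qed simp
      finally show ?thesis .
    next
      case False
      let ?O = "extension (coletter (stage n)) (stage n)"
      have "lin_ext scale (stage (Suc n)) x = lin_ext scale (\<lambda>Y. scale (- inverse (of_nat s)) (h (?O Y))) x"
        by (rule lin_ext_cong) (use k True False in auto)
      also have "\<dots> = scale (- inverse (of_nat s)) (h (lin_ext scale ?O x))"
        by (simp only: lin_ext_fun_scale lin_ext_linear[OF h_linear])
      \<comment> \<open>The obstruction is \<open>stage n\<close> after its coextension, and both
        respect relations.\<close>
      also have "lin_ext scale ?O x = lin_ext scale (stage n) (lin_ext cscale (coext (stage n)) x)"
        by (simp add: lin_ext_lin_ext lin_ext_coext_vector)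
      also have "\<dots> = 0"
        using g coext_relations[OF g xr] by (simp add: cogenerator_map_def)
      finally show ?thesis
        by (simp add: module_hom.zero[OF Vector_Spaces.linear.axioms(3)[OF h_linear]])
    qed
  qed
qed

text \<open>Evaluate \<open>stage n\<close> on the square of the coextension at \<open>X\<close> in
  two ways. The square is the one-letter word with vector \<open>ob X\<close>, which gives
  \<open>m1 (ob X)\<close>; on the other hand \<open>stage n\<close> after one coextension is
  \<open>ob\<close>, which vanishes on shorter words, so only the length-preserving part of the
  coextension remains.\<close>

lemma stage_cocycle:
  assumes g: "cogenerator_map scale E (stage n)"
    and low: "\<And>Y. Y \<in> bwords E \<Longrightarrow> blen Y < n + 3 \<Longrightarrow> extension (coletter (stage n)) (stage n) Y = 0"
    and X: "X \<in> bwords E" "blen X = n + 3"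
  defines "ob \<equiv> extension (coletter (stage n)) (stage n)"
  shows "lin_ext scale (\<lambda>Y. if blen Y = n + 3 then ob Y else 0) (coext (stage n) X) = m1 (ob X)"
proof -
  let ?D = "coext (stage n)"
  have "lin_ext cscale ?D (?D X) - basis [[(cdeg X, gdeg X + 4, ob X)]] \<in> relations scale E"
    unfolding ob_def by (rule coext_square[OF g X(1)]) (simp add: low X)
  then have "lin_ext scale (stage n) (lin_ext cscale ?D (?D X) - basis [[(cdeg X, gdeg X + 4, ob X)]]) = 0"
    using g by (simp add: cogenerator_map_def)
  then have "lin_ext scale (stage n) (lin_ext cscale ?D (?D X)) = stage n [[(cdeg X, gdeg X + 4, ob X)]]"
    by (simp add: lin_ext_diff)
  also have "\<dots> = m1 (ob X)"
    by (simp add: stage_low blen_def \<beta>_m1)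
  finally have "lin_ext scale ob (?D X) = m1 (ob X)"
    by (simp add: lin_ext_lin_ext lin_ext_coext_vector ob_def)
  moreover have "lin_ext scale ob (?D X) = lin_ext scale (\<lambda>Y. if blen Y = n + 3 then ob Y else 0) (?D X)"
  proof (rule lin_ext_cong)
    fix Y assume "Y \<in> Poly_Mapping.keys (?D X)"
    then have "Y \<in> bwords E" "blen Y \<le> n + 3"
      using keys_coext[OF g X(1)] X(2) by auto
    then show "ob Y = (if blen Y = n + 3 then ob Y else 0)"
      using low by (auto simp: ob_def)
  qed
  ultimately show ?thesis
    by simp
qed

lemma stage_Suc_top:
  assumes g: "cogenerator_map scale E (stage n)"
    and low: "\<And>Y. Y \<in> bwords E \<Longrightarrow> blen Y < n + 3 \<Longrightarrow> extension (coletter (stage n)) (stage n) Y = 0"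
    and X: "X \<in> bwords E" "blen X = n + 3" and s: "cdeg X \<noteq> 0"
  shows "extension (coletter (stage (Suc n))) (stage (Suc n)) X = 0"
proof -
  let ?g = "stage n" and ?g' = "stage (Suc n)"
  define ob where "ob = extension (coletter ?g) ?g"
  let ?c = "- inverse (of_nat (cdeg X)) :: 'k"
  interpret m1: Vector_Spaces.linear scale scale m1 by (rule m1_linear)
  have z: "stage k [[l]] = m1 (snd (snd l))" for k l
    by (simp add: stage_low blen_def \<beta>_m1 del: stage.simps)
  \<comment> \<open>The new component occurs twice: as the letter attached to all of
    \<open>X\<close>, which \<open>extension_update\<close> isolates, and as the outer map on the
    words of \<open>coext ?g X\<close>.\<close>
  have "extension (coletter ?g') ?g' X = extension (coletter ?g) ?g' X + (?g' [[coletter ?g' X]] - ?g' [[coletter ?g X]])"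
  proof (rule extension_update)
    fix Y :: "'v bword" assume "blen Y < blen X"
    then show "coletter ?g' Y = coletter ?g Y"
      using X(2) by (simp add: coletter_def)
  qed (use X in \<open>auto simp: bwords_iff\<close>)
  also have "?g' [[coletter ?g' X]] = scale ?c (m1 (h (ob X)))"
    unfolding z using X s by (simp add: coletter_def ob_def m1.scale m1.neg)
  \<comment> \<open>\<open>stage n\<close> vanishes in length \<open>n + 3\<close>, so the old
    letter carries the zero vector.\<close>
  also have "?g' [[coletter ?g X]] = 0"
    unfolding z using X stage_high[of n X] by (simp add: coletter_def m1.zero)
  also have "extension (coletter ?g) ?g' X = lin_ext scale ?g' (coext ?g X)"
    by (simp add: lin_ext_coext_vector)
  \<comment> \<open>The coextension preserves the conformal degree, so the factor \<open>?c\<close>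
    of \<open>X\<close> is the right one for all words \<open>Y\<close>.\<close>
  also have "\<dots> = lin_ext scale (\<lambda>Y. ?g Y + scale ?c (h (if blen Y = n + 3 then ob Y else 0))) (coext ?g X)"
  proof (rule lin_ext_cong)
    fix Y assume "Y \<in> Poly_Mapping.keys (coext ?g X)"
    then have "cdeg Y = cdeg X"
      using keys_coext[OF g X(1)] by auto
    then show "?g' Y = ?g Y + scale ?c (h (if blen Y = n + 3 then ob Y else 0))"
      using s stage_high[of n Y] lin_ext_linear[OF h_linear, of "\<lambda>w. 0" 0] by (simp add: ob_def)
  qed
  also have "\<dots> = ob X + scale ?c (h (lin_ext scale (\<lambda>Y. if blen Y = n + 3 then ob Y else 0) (coext ?g X)))"
    by (simp only: lin_ext_fun_add lin_ext_fun_scale lin_ext_linear[OF h_linear]) (simp only: ob_def lin_ext_coext_vector)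
  also have "lin_ext scale (\<lambda>Y. if blen Y = n + 3 then ob Y else 0) (coext ?g X) = m1 (ob X)"
    unfolding ob_def by (rule stage_cocycle[OF g low X])
  also have "ob X + scale ?c (h (m1 (ob X))) + (scale ?c (m1 (h (ob X))) - 0) =
      ob X + scale ?c (m1 (h (ob X)) + h (m1 (ob X)))"
    by (simp add: scale_right_distrib add_ac)
  also have "m1 (h (ob X)) + h (m1 (ob X)) = scale (of_nat (cdeg X)) (ob X)"
  proof (rule homotopy)
    have "ob X \<in> E (cdeg X) (gdeg X + 4)"
      unfolding ob_def by (rule extension_degree[OF g X(1)])
    then show "ob X \<in> conformal_part scale E (cdeg X)"
      unfolding conformal_part_def by (intro span_base) blast
  qed
  finally show ?thesis
    using s by simp
qed

lemma stage_invariant: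
  "cogenerator_map scale E (stage n) \<and>
   (\<forall>X\<in>bwords E. blen X \<le> n + 2 \<longrightarrow> extension (coletter (stage n)) (stage n) X = 0)"
proof (induction n)
  case 0
  then show ?case
    using \<beta> by (simp add: G_structure_iff enat_le_2)
next
  case (Suc n)
  then have g: "cogenerator_map scale E (stage n)"
    and low: "\<And>Y. Y \<in> bwords E \<Longrightarrow> blen Y < n + 3 \<Longrightarrow> extension (coletter (stage n)) (stage n) Y = 0"
    by auto
  note g' = cogenerator_map_stage_Suc[OF g]
  have "extension (coletter (stage (Suc n))) (stage (Suc n)) X = 0" if X: "X \<in> bwords E" "blen X \<le> n + 3" for X
  proof (cases "cdeg X = 0")
    case True
    then show ?thesis
      using X by (intro extension_stage_conformal_zero) auto
  next
    case False
    show ?thesis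
    proof (cases "blen X = n + 3")
      case True
      then show ?thesis
        using stage_Suc_top[OF g low X(1) True False] by blast
    next
      case False
      then have l: "blen X \<le> n + 2"
        using X(2) by simp
      \<comment> \<open>The new component has length \<open>n + 3\<close> and cannot meet words that
        start shorter.\<close>
      have "extension (coletter (stage (Suc n))) (stage (Suc n)) X = extension (coletter (stage n)) (stage (Suc n)) X"
        by (rule extension_cong) (use l in \<open>simp add: coletter_def\<close>)
      also have "\<dots> = lin_ext scale (stage n) (coext (stage n) X)"
        unfolding lin_ext_coext_vector[symmetric]
        by (rule lin_ext_cong) (use keys_coext[OF g X(1)] l in auto)
      also have "\<dots> = 0"
        using low[OF X(1)] l by (simp add: lin_ext_coext_vector)
      finally show ?thesis .
    qed
  qed
  then show ?case
    using g' by simp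
qed

text \<open>Components of length \<open>l\<close> are final from stage \<open>l - 2\<close> on, so
  stage \<open>blen X\<close> is late enough.\<close>

definition limit :: "'v bword \<Rightarrow> 'v" where
  "limit X = stage (blen X) X"

lemma limit_eq_stage: "blen X \<le> n + 2 \<Longrightarrow> limit X = stage n X"
  unfolding limit_def by (rule stage_eq) simp_all

text \<open>Each condition involves words of bounded length, since relations are homogeneous and the
  coextension does not increase length; there \<open>limit\<close> coincides with a single
  stage.\<close>

lemma G_infinity_structure_limit: "G_infinity_structure scale E limit"
  unfolding G_structure_iff truncate_infinity
proof (intro conjI ballI impI)
  show c: "cogenerator_map scale E limit"
  proof (rule cogenerator_mapI)
    show "limit X \<in> E (cdeg X) (gdeg X + 3)" if "X \<in> bwords E" for X
      using stage_invariant[of "blen X"] that by (simp add: limit_def cogenerator_map_def)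
    fix x assume x: "x \<in> coalgebra_rel scale E"
    obtain l where l: "\<And>Y. Y \<in> Poly_Mapping.keys x \<Longrightarrow> blen Y = l"
      by (rule coalgebra_rel_homogeneous[OF x]) blast
    have "lin_ext scale limit x = lin_ext scale (stage l) x"
      by (rule lin_ext_cong) (simp add: limit_def l)
    then show "lin_ext scale limit x = 0"
      using stage_invariant[of l] x chain.span_base by (auto simp: cogenerator_map_def relations_def)
  qed
  fix X assume X: "X \<in> bwords E"
  let ?g = "stage (blen X)"
  have g: "cogenerator_map scale E ?g" "extension (coletter ?g) ?g X = 0"
    using stage_invariant[of "blen X"] X by auto
  have "extension (coletter limit) limit X = extension (coletter ?g) limit X"
    by (rule extension_cong) (auto simp: coletter_def intro: limit_eq_stage)
  also have "\<dots> = extension (coletter ?g) ?g X"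
    unfolding lin_ext_coext_vector[symmetric]
    by (rule lin_ext_cong, rule limit_eq_stage) (use keys_coext[OF g(1) X] in fastforce)
  finally show "extension (coletter limit) limit X = 0"
    using g(2) by simp
qed

lemma limit_conformal_zero:
  assumes X: "X \<in> bwords (conformal_zero E)"
  shows "limit X = \<gamma>0 X"
proof (cases "cdeg X = 0")
  case True
  then show ?thesis
    unfolding limit_def by (intro stage_conformal_zero bwords_conformal_zero[OF X]) simp_all
next
  \<comment> \<open>Words over \<open>conformal_zero E\<close> may contain letters of positive
    conformal degree, but only with the zero vector. On such words both maps vanish, the given one
    for degree reasons and \<open>limit\<close> by linearity in that letter.\<close>
  case False
  have "\<gamma>0 X \<in> conformal_zero E (cdeg X) (gdeg X + 3)"
    using \<gamma>0 X by (simp add: G_structure_def cogenerator_map_def)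
  then have "\<gamma>0 X = 0"
    using False by (simp add: conformal_zero_def)
  moreover have "limit X = 0"
  proof -
    obtain w l where wl: "w \<in> set X" "l \<in> set w" "fst l \<noteq> 0"
      using False by (auto simp: cdeg_def sum_list_eq_0_iff)
    then have "l \<in> letters (conformal_zero E)"
      using X by (auto simp: bwords_iff)
    then obtain s n where l: "l = (s, n, 0)"
      using wl(3) by (cases l) (auto simp: letters_def conformal_zero_def)
    obtain P R where PR: "X = P @ w # R"
      using wl(1) by (meson split_list)
    obtain p q where pq: "w = p @ (s, n, 0) # q"
      using wl(2) l by (meson split_list)
    have "X \<in> bwords E"
      by (rule bwords_conformal_zero[OF X])
    then have "basis X - cscale 0 (basis X) \<in> coalgebra_rel scale E"
      using coalgebra_rel.homogeneous[of P p s n 0 q R E scale 0] by (simp add: PR pq)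
    then have "basis X - cscale 0 (basis X) \<in> relations scale E"
      by (simp add: relations_def chain.span_base)
    then have "lin_ext scale limit (basis X - cscale 0 (basis X)) = 0"
      using G_infinity_structure_limit by (auto simp: G_structure_def cogenerator_map_def)
    then show ?thesis
      by (simp add: lin_ext_diff lin_ext_cscale)
  qed
  ultimately show ?thesis
    by simp
qed

end

theorem theorem3p2:
  fixes scale :: "'k::field_char_0 \<Rightarrow> 'v::ab_group_add \<Rightarrow> 'v"
    and E :: "nat \<Rightarrow> int \<Rightarrow> 'v set"
    and N' N :: "nat \<Rightarrow> int"
    and m1 h :: "'v \<Rightarrow> 'v"
    and m2 m11 :: "'v \<Rightarrow> 'v \<Rightarrow> 'v"
    and \<gamma>0 :: "'v bword \<Rightarrow> 'v"
  assumes V: "bigraded_vector_space scale E"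
    and bounds: "\<And>s. N' s \<le> N s"
    and bounded: "\<And>s n. n \<notin> {N' s..N s} \<Longrightarrow> E s n = {0}"
    and m1_linear: "Vector_Spaces.linear scale scale m1"
    and m1_degree: "\<And>s n v. v \<in> E s n \<Longrightarrow> m1 v \<in> E s (n + 1)"
    and m2_linear: "\<And>v. Vector_Spaces.linear scale scale (\<lambda>w. m2 v w)"
                   "\<And>w. Vector_Spaces.linear scale scale (\<lambda>v. m2 v w)"
    and m2_degree: "\<And>s n v s' n' w. v \<in> E s n \<Longrightarrow> w \<in> E s' n' \<Longrightarrow>
                      m2 v w \<in> E (s + s') (n + n')"
    and m11_linear: "\<And>v. Vector_Spaces.linear scale scale (\<lambda>w. m11 v w)"
                    "\<And>w. Vector_Spaces.linear scale scale (\<lambda>v. m11 v w)"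
    and m11_degree: "\<And>s n v s' n' w. v \<in> E s n \<Longrightarrow> w \<in> E s' n' \<Longrightarrow>
                      m11 v w \<in> E (s + s') (n + n' - 1)"
    and G2: "G_structure scale E 2 (binary_components scale m1 m2 m11)"
    and h_linear: "Vector_Spaces.linear scale scale h"
    and h_degree: "\<And>s n v. v \<in> E s n \<Longrightarrow> h v \<in> E s (n - 1)"
    and h_square: "\<And>v. h (h v) = 0"
    and homotopy: "\<And>s v. v \<in> conformal_part scale E s \<Longrightarrow>
                      m1 (h v) + h (m1 v) = scale (of_nat s) v"
    and G0: "G_infinity_structure scale (conformal_zero E) \<gamma>0"
    and G0_extends: "\<And>X. X \<in> bwords (conformal_zero E) \<Longrightarrow> blen X \<le> 2 \<Longrightarrow>
                      \<gamma>0 X = binary_components scale m1 m2 m11 X"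
  shows "\<exists>\<gamma>. G_infinity_structure scale E \<gamma> \<and>
            (\<forall>X\<in>bwords E. blen X \<le> 2 \<longrightarrow> \<gamma> X = binary_components scale m1 m2 m11 X) \<and>
            (\<forall>X\<in>bwords (conformal_zero E). \<gamma> X = \<gamma>0 X)"
proof -
  interpret graded_space scale E
    using V by (auto simp: bigraded_vector_space_def graded_space_def graded_space_axioms_def)
  interpret obstruction_data scale E m1 h "binary_components scale m1 m2 m11" \<gamma>0
  proof (intro obstruction_data.intro obstruction_data_axioms.intro graded_space_axioms)
    show "binary_components scale m1 m2 m11 [[l]] = m1 (snd (snd l))" for l
      by (cases l) simp
  qed (rule m1_linear h_linear h_degree homotopy G2 G0 G0_extends; assumption)+
  show ?thesis
    using G_infinity_structure_limit limit_conformal_zero limit_eq_stage[of _ 0] stage_low[of _ 0]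
    by (intro exI[of _ limit] conjI ballI impI) auto
qed

end
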